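(* Let $(\mathcal C,\mathcal D)$ be a regular MASA inclusion and let $\sigma\in\hat{\mathcal D}$. Let $$M_\sigma:=\{f\in\mathrm{pHom}_1(H_\sigma/R_1): f\text{ is dominated by }B_\sigma\}.$$ For $\tau\in\mathfrak S(\mathcal C,\mathcal D,\sigma)$ the map $\tilde\tau:H_\sigma/R_1\to\mathbb C$ given by $\tilde\tau([v]_1)=\tau(v)$ is well defined, and $\tilde\tau\in M_\sigma$. Moreover, the map $\tau\mapsto\tilde\tau$ is a bijection between $\mathfrak S(\mathcal C,\mathcal D,\sigma)$ and $M_\sigma$.
   Context: All $C^*$-algebras are unital. An inclusion is a pair $(\mathcal C,\mathcal D)$ where $\mathcal C$ is a unital $C^*$-algebra and $\mathcal D\subseteq\mathcal C$ is an abelian $C^*$-subalgebra containing the unit $I$ of $\mathcal C$. Its normalizers are $\mathcal N(\mathcal C,\mathcal D)=\{v\in\mathcal C: v^*\mathcal Dv\cup v\mathcal Dv^*\subseteq\mathcal D\}$. The inclusion is regular if $\operatorname{span}\mathcal N(\mathcal C,\mathcal D)$ is norm dense in $\mathcal C$, and a MASA inclusion if $\mathcal D$ is a maximal abelian $C^*$-subalgebra of $\mathcal C$; a regular MASA inclusion is both. $\hat{\mathcal D}$ is the character space of $\mathcal D$. $\mathfrak S(\mathcal C,\mathcal D)$ is the set of states $\rho$ on $\mathcal C$ with $|\rho(v)|^2\in\{0,\rho(v^*v)\}$ for every $v\in\mathcal N(\mathcal C,\mathcal D)$, and $\mathfrak S(\mathcal C,\mathcal D,\sigma)=\{\rho\in\mathfrak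 S(\mathcal C,\mathcal D):\rho|_{\mathcal D}=\sigma\}$. For $\sigma\in\hat{\mathcal D}$: - $B_\sigma(x)=\inf\{\|dxe\|:d,e\in\mathcal D,\ \sigma(d)=\sigma(e)=1\}$ is a seminorm on $\mathcal C$. - $H_\sigma=\{v\in\mathcal N(\mathcal C,\mathcal D):\sigma(v^*dv)=\sigma(d)\text{ for every }d\in\mathcal D\}$, a $*$-semigroup. - $R_1=\{(v,w)\in H_\sigma\times H_\sigma:B_\sigma(I-w^*v)=0\}$ is an equivalence relation; $[v]_1$ is the class of $v$. $H_\sigma/R_1$ is a group under $[v]_1[w]_1=[vw]_1$, with unit $[I]_1$ and $[v]_1^{-1}=[v^*]_1$. With the metric $d([v]_1,[w]_1)=B_\sigma(v-w)$ it is a $\mathbb T$-group, where the copy of $\mathbb T$ is $\{[\lambda I]_1:\lambda\in\mathbb T\}$. - $\mathcal C_\sigma=\overline{\operatorname{span}}H_\sigma$ is a $C^*$-subalgebra of $\mathcal C$ containing $\mathcal D$; $\mathfrak I_\sigma$ is the closed two-sided ideal of $\mathcal C_\sigma$ generated by $\ker\sigma$; $T_\sigma:H_\sigma/R_1\to\mathcal C_\sigma/\mathfrak I_\sigma$, $T_\sigma([u]_1)=u+\mathfrak I_\sigma$, is a well-defined injective homomorphism into the unitary group. A $\mathbb T$-group is a locally compact group whose identity component is clopen, isomorphic and homeomorphic to $\mathbb T$ (and identified with it), and central. Its Haar measure is the product of Haar measure on $\mathbb T$ and counting measure on the discrete quotient by $\mathbb T$ (identifying the group, as a topological space, with the product).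 A function $f$ on a $\mathbb T$-group $K$ is positive definite if it is continuous and the matrices $(f(g_i^{-1}g_j))_{i,j}$ are positive semidefinite for all finite families $g_1,\dots,g_n\in K$. A pre-homomorphism on $K$ is a positive-definite function $f$ with $f(1)=1$ and $|f(g)|\in\{0,1\}$ for all $g$; for such $f$ there is a $p\in\mathbb Z$ (the index of $f$) with $f(\lambda g)=\lambda^pf(g)$ for all $\lambda\in\mathbb T$, $g\in K$. $\mathrm{pHom}_1(K)$ is the set of pre-homomorphisms of index $1$. A positive-definite function $f$ on $H_\sigma/R_1$ is dominated by $B_\sigma$ if for every $\phi\in C_c(H_\sigma/R_1)$, $$\left|\int_{H_\sigma/R_1}\phi(t)f(t)\,dt\right|\le\left\|\int_{H_\sigma/R_1}\phi(t)T_\sigma(t)\,dt\right\|_{\mathcal C_\sigma/\mathfrak I_\sigma}.$$ *)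

theory Defs
  imports "HOL-Analysis.Analysis" "HOL-Algebra.Coset"
begin

section \<open>Unital \<open>C\<^sup>*\<close>-algebras\<close>

class unital_cstar_algebra = real_normed_algebra_1 + banach +
  fixes scaleC :: "complex \<Rightarrow> 'a \<Rightarrow> 'a"  (infixr "*\<^sub>C" 75)
    and star :: "'a \<Rightarrow> 'a"  ("(_\<^sup>\<star>)" [1000] 999)
  assumes scaleC_add_right: "a *\<^sub>C (x + y) = a *\<^sub>C x + a *\<^sub>C y"
    and scaleC_add_left: "(a + b) *\<^sub>C x = a *\<^sub>C x + b *\<^sub>C x"
    and scaleC_scaleC: "a *\<^sub>C (b *\<^sub>C x) = (a * b) *\<^sub>C x"
    and scaleC_of_real: "complex_of_real r *\<^sub>C x = r *\<^sub>R x"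
    and mult_scaleC_left: "(a *\<^sub>C x) * y = a *\<^sub>C (x * y)"
    and mult_scaleC_right: "x * (a *\<^sub>C y) = a *\<^sub>C (x * y)"
    and norm_scaleC: "norm (a *\<^sub>C x) = cmod a * norm x"
    and star_star: "(x\<^sup>\<star>)\<^sup>\<star> = x"
    and star_add: "(x + y)\<^sup>\<star> = x\<^sup>\<star> + y\<^sup>\<star>"
    and star_mult: "(x * y)\<^sup>\<star> = y\<^sup>\<star> * x\<^sup>\<star>"
    and star_scaleC: "(a *\<^sub>C x)\<^sup>\<star> = cnj a *\<^sub>C x\<^sup>\<star>"
    and cstar_identity: "norm (x\<^sup>\<star> * x) = (norm x)\<^sup>2"

global_interpretation complex_vector:
  vector_space "scaleC :: complex \<Rightarrow> 'a \<Rightarrow> 'a::unital_cstar_algebra"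
  defines cspan = complex_vector.span
    and csubspace = complex_vector.subspace
proof
  show "1 *\<^sub>C x = x" for x :: 'a
    using scaleC_of_real[of 1 x] by simp
qed (simp_all add: scaleC_add_right scaleC_add_left scaleC_scaleC)

text \<open>Abelian \<open>C\<^sup>*\<close>-subalgebras containing the unit of the ambient algebra.\<close>

definition abelian_cstar_subalgebra :: "'a::unital_cstar_algebra set \<Rightarrow> bool" where
  "abelian_cstar_subalgebra D \<longleftrightarrow>
     csubspace D \<and> closed D \<and> 1 \<in> D \<and>
     (\<forall>x\<in>D. x\<^sup>\<star> \<in> D) \<and> (\<forall>x\<in>D. \<forall>y\<in>D. x * y \<in> D \<and> x * y = y * x)"

definition positive_functional :: "('a::unital_cstar_algebra \<Rightarrow> complex) \<Rightarrow> bool" where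
  "positive_functional \<rho> \<longleftrightarrow>
     Vector_Spaces.linear scaleC (*) \<rho> \<and> (\<forall>x. \<rho> (x\<^sup>\<star> * x) \<in> \<real>\<^sub>\<ge>\<^sub>0)"

definition state :: "('a::unital_cstar_algebra \<Rightarrow> complex) \<Rightarrow> bool" where
  "state \<rho> \<longleftrightarrow> positive_functional \<rho> \<and> \<rho> 1 = 1"

text \<open>A character of \<open>D\<close> is a function on \<open>D\<close>, so it takes the dummy value
  \<^const>\<open>undefined\<close> outside \<open>D\<close>.\<close>

definition characters :: "'a::unital_cstar_algebra set \<Rightarrow> ('a \<Rightarrow> complex) set" where
  "characters D = {\<sigma> \<in> extensional D.
     (\<forall>x\<in>D. \<forall>y\<in>D. \<sigma> (x + y) = \<sigma> x + \<sigma> y) \<and>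
     (\<forall>a. \<forall>x\<in>D. \<sigma> (a *\<^sub>C x) = a * \<sigma> x) \<and>
     (\<forall>x\<in>D. \<forall>y\<in>D. \<sigma> (x * y) = \<sigma> x * \<sigma> y) \<and>
     (\<exists>x\<in>D. \<sigma> x \<noteq> 0)}"


section \<open>Regular MASA inclusions\<close>

text \<open>The algebra \<open>\<C>\<close> of an inclusion \<open>(\<C>, D)\<close> is the whole type.\<close>

definition normalizers :: "'a::unital_cstar_algebra set \<Rightarrow> 'a set" where
  "normalizers D = {v. \<forall>d\<in>D. v\<^sup>\<star> * d * v \<in> D \<and> v * d * v\<^sup>\<star> \<in> D}"

definition regular_inclusion :: "'a::unital_cstar_algebra set \<Rightarrow> bool" where
  "regular_inclusion D \<longleftrightarrow>
     abelian_cstar_subalgebra D \<and> closure (cspan (normalizers D)) = UNIV"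

definition masa_inclusion :: "'a::unital_cstar_algebra set \<Rightarrow> bool" where
  "masa_inclusion D \<longleftrightarrow>
     abelian_cstar_subalgebra D \<and> (\<forall>E. abelian_cstar_subalgebra E \<and> D \<subseteq> E \<longrightarrow> E = D)"

definition regular_masa_inclusion :: "'a::unital_cstar_algebra set \<Rightarrow> bool" where
  "regular_masa_inclusion D \<longleftrightarrow> regular_inclusion D \<and> masa_inclusion D"

definition compatible_states :: "'a::unital_cstar_algebra set \<Rightarrow> ('a \<Rightarrow> complex) set" where
  "compatible_states D = {\<rho>. state \<rho> \<and>
     (\<forall>v\<in>normalizers D. complex_of_real ((cmod (\<rho> v))\<^sup>2) \<in> {0, \<rho> (v\<^sup>\<star> * v)})}"

definition compatible_states_over ::
    "'a::unital_cstar_algebra set \<Rightarrow> ('a \<Rightarrow> complex) \<Rightarrow> ('a \<Rightarrow> complex) set" where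
  "compatible_states_over D \<sigma> = {\<rho> \<in> compatible_states D. restrict \<rho> D = \<sigma>}"


section \<open>Pre-homomorphisms and Haar measure on \<open>\<T>\<close>-groups\<close>

text \<open>A \<open>\<T>\<close>-group is presented by its group \<open>G\<close>, its topology \<open>X\<close> (with
  \<open>topspace X = carrier G\<close>) and the homomorphism \<open>\<iota>\<close> identifying \<open>\<T>\<close>, which is
  \<^term>\<open>sphere (0::complex) 1\<close>, with the identity component. Functions on \<open>G\<close> are
  extensional, i.e. they are \<^const>\<open>undefined\<close> outside the carrier.\<close>

definition positive_semidefinite :: "nat \<Rightarrow> (nat \<Rightarrow> nat \<Rightarrow> complex) \<Rightarrow> bool" where
  "positive_semidefinite n A \<longleftrightarrow>
     (\<forall>c. (\<Sum>i<n. \<Sum>j<n. cnj (c i) * A i j * c j) \<in> \<real>\<^sub>\<ge>\<^sub>0)"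

definition positive_definite ::
    "('g, 'b) monoid_scheme \<Rightarrow> 'g topology \<Rightarrow> ('g \<Rightarrow> complex) \<Rightarrow> bool" where
  "positive_definite G X f \<longleftrightarrow>
     f \<in> extensional (carrier G) \<and> continuous_map X euclidean f \<and>
     (\<forall>n g. (\<forall>i<n. g i \<in> carrier G) \<longrightarrow>
        positive_semidefinite n (\<lambda>i j. f (inv\<^bsub>G\<^esub> (g i) \<otimes>\<^bsub>G\<^esub> g j)))"

definition pre_homomorphism ::
    "('g, 'b) monoid_scheme \<Rightarrow> 'g topology \<Rightarrow> ('g \<Rightarrow> complex) \<Rightarrow> bool" where
  "pre_homomorphism G X f \<longleftrightarrow>
     positive_definite G X f \<and> f \<one>\<^bsub>G\<^esub> = 1 \<and> (\<forall>g\<in>carrier G. cmod (f g) \<in> {0, 1})"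

definition has_index ::
    "('g, 'b) monoid_scheme \<Rightarrow> (complex \<Rightarrow> 'g) \<Rightarrow> ('g \<Rightarrow> complex) \<Rightarrow> int \<Rightarrow> bool" where
  "has_index G \<iota> f p \<longleftrightarrow>
     (\<forall>z\<in>sphere 0 1. \<forall>g\<in>carrier G. f (\<iota> z \<otimes>\<^bsub>G\<^esub> g) = z powi p * f g)"

definition pHom ::
    "int \<Rightarrow> ('g, 'b) monoid_scheme \<Rightarrow> 'g topology \<Rightarrow> (complex \<Rightarrow> 'g) \<Rightarrow> ('g \<Rightarrow> complex) set" where
  "pHom p G X \<iota> = {f. pre_homomorphism G X f \<and> has_index G \<iota> f p}"

definition circle_measure :: "complex measure" where
  "circle_measure = distr (uniform_measure lborel {0..1}) borel (\<lambda>t. cis (2 * pi * t))"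

text \<open>Choosing a representative in every coset of \<open>\<T>\<close> identifies \<open>G\<close> with the product of
  \<open>\<T>\<close> and the discrete quotient. The product of \<^const>\<open>circle_measure\<close> and counting measure
  is written out on the Borel sets of \<open>X\<close> as the sum of the measures of the slices; the
  library's product measure would live on the product \<open>\<sigma>\<close>-algebra, which can be smaller than
  the Borel \<open>\<sigma>\<close>-algebra if the quotient is large.\<close>

definition haar_measure ::
    "('g, 'b) monoid_scheme \<Rightarrow> 'g topology \<Rightarrow> (complex \<Rightarrow> 'g) \<Rightarrow> 'g measure" where
  "haar_measure G X \<iota> = measure_of (carrier G) {U. openin X U}
     (\<lambda>A. \<integral>\<^sup>+ c. emeasure circle_measure {z \<in> sphere 0 1. \<iota> z \<otimes>\<^bsub>G\<^esub> (SOME g. g \<in> c) \<in> A}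
            \<partial>count_space (rcosets\<^bsub>G\<^esub> (\<iota> ` sphere 0 1)))"

definition compactly_supported :: "'g topology \<Rightarrow> ('g \<Rightarrow> complex) set" where
  "compactly_supported X = {\<phi>. continuous_map X euclidean \<phi> \<and>
     compactin X (X closure_of {t \<in> topspace X. \<phi> t \<noteq> 0})}"


section \<open>Quotients by closed ideals\<close>

definition closed_ideal :: "'a::unital_cstar_algebra set \<Rightarrow> 'a set \<Rightarrow> bool" where
  "closed_ideal A J \<longleftrightarrow>
     J \<subseteq> A \<and> csubspace J \<and> closed J \<and> (\<forall>a\<in>A. \<forall>x\<in>J. a * x \<in> J \<and> x * a \<in> J)"

text \<open>Elements of \<open>A/J\<close> are cosets of \<open>J\<close>, as sets.\<close>

definition coset_of :: "'a::unital_cstar_algebra set \<Rightarrow> 'a \<Rightarrow> 'a set" where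
  "coset_of J x = (\<lambda>j. x + j) ` J"

definition coset_norm :: "'a::unital_cstar_algebra set \<Rightarrow> real" where
  "coset_norm Y = Inf (norm ` Y)"

definition coset_scale ::
    "'a::unital_cstar_algebra set \<Rightarrow> complex \<Rightarrow> 'a set \<Rightarrow> 'a set" where
  "coset_scale J a Y = (\<Union>u\<in>Y. coset_of J (a *\<^sub>C u))"

definition coset_diff :: "'a::unital_cstar_algebra set \<Rightarrow> 'a set \<Rightarrow> 'a set" where
  "coset_diff Y Z = {y - z |y z. y \<in> Y \<and> z \<in> Z}"

text \<open>The Bochner integral of an \<open>A/J\<close>-valued function, following
  \<^const>\<open>has_bochner_integral\<close>. Since \<open>A/J\<close> is not a type, its simple functions are given by
  \<open>A\<close>-valued lifts. The first conjunct after \<open>Y \<in> coset_of J ` A\<close> is Borel measurability of \<open>F\<close>: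
  the open subsets of the quotient correspond to the open \<open>J\<close>-saturated sets.\<close>

definition has_quotient_integral ::
    "'a::unital_cstar_algebra set \<Rightarrow> 'a set \<Rightarrow> 'g measure \<Rightarrow> ('g \<Rightarrow> 'a set) \<Rightarrow> 'a set \<Rightarrow> bool" where
  "has_quotient_integral A J M F Y \<longleftrightarrow>
     (\<forall>t\<in>space M. F t \<in> coset_of J ` A) \<and> Y \<in> coset_of J ` A \<and>
     (\<forall>U. open U \<and> (\<forall>x\<in>U. coset_of J x \<subseteq> U) \<longrightarrow> {t \<in> space M. F t \<subseteq> U} \<in> sets M) \<and>
     (\<exists>s. (\<forall>i. Bochner_Integration.simple_bochner_integrable M (s i) \<and> s i ` space M \<subseteq> A) \<and>
       (\<lambda>i. \<integral>\<^sup>+ t. ennreal (coset_norm (coset_diff (F t) (coset_of J (s i t)))) \<partial>M) \<longlonglongrightarrow> 0 \<and>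
       (\<lambda>i. coset_norm (coset_diff Y (coset_of J (Bochner_Integration.simple_bochner_integral M (s i))))) \<longlonglongrightarrow> 0)"

definition quotient_integral ::
    "'a::unital_cstar_algebra set \<Rightarrow> 'a set \<Rightarrow> 'g measure \<Rightarrow> ('g \<Rightarrow> 'a set) \<Rightarrow> 'a set" where
  "quotient_integral A J M F = (THE Y. has_quotient_integral A J M F Y)"


section \<open>The \<open>\<T>\<close>-group of a character\<close>

definition B_seminorm ::
    "'a::unital_cstar_algebra set \<Rightarrow> ('a \<Rightarrow> complex) \<Rightarrow> 'a \<Rightarrow> real" where
  "B_seminorm D \<sigma> x = Inf {norm (d * x * e) |d e. d \<in> D \<and> e \<in> D \<and> \<sigma> d = 1 \<and> \<sigma> e = 1}"

definition H_set :: "'a::unital_cstar_algebra set \<Rightarrow> ('a \<Rightarrow> complex) \<Rightarrow> 'a set" where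
  "H_set D \<sigma> = {v \<in> normalizers D. \<forall>d\<in>D. \<sigma> (v\<^sup>\<star> * d * v) = \<sigma> d}"

definition R1 :: "'a::unital_cstar_algebra set \<Rightarrow> ('a \<Rightarrow> complex) \<Rightarrow> 'a rel" where
  "R1 D \<sigma> = {(v, w). v \<in> H_set D \<sigma> \<and> w \<in> H_set D \<sigma> \<and> B_seminorm D \<sigma> (1 - w\<^sup>\<star> * v) = 0}"

definition cls1 :: "'a::unital_cstar_algebra set \<Rightarrow> ('a \<Rightarrow> complex) \<Rightarrow> 'a \<Rightarrow> 'a set" where
  "cls1 D \<sigma> v = R1 D \<sigma> `` {v}"

definition HR :: "'a::unital_cstar_algebra set \<Rightarrow> ('a \<Rightarrow> complex) \<Rightarrow> 'a set monoid" where
  "HR D \<sigma> = \<lparr>carrier = H_set D \<sigma> // R1 D \<sigma>,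
     mult = (\<lambda>x y. \<Union>v\<in>x. \<Union>w\<in>y. cls1 D \<sigma> (v * w)),
     one = cls1 D \<sigma> 1\<rparr>"

text \<open>The value outside the carrier is irrelevant; \<^locale>\<open>Metric_space\<close> requires it to be
  nonnegative and symmetric.\<close>

definition HR_dist ::
    "'a::unital_cstar_algebra set \<Rightarrow> ('a \<Rightarrow> complex) \<Rightarrow> 'a set \<Rightarrow> 'a set \<Rightarrow> real" where
  "HR_dist D \<sigma> x y =
     (if x \<in> carrier (HR D \<sigma>) \<and> y \<in> carrier (HR D \<sigma>)
      then the_elem {B_seminorm D \<sigma> (v - w) |v w. v \<in> x \<and> w \<in> y} else 0)"

definition HR_top :: "'a::unital_cstar_algebra set \<Rightarrow> ('a \<Rightarrow> complex) \<Rightarrow> 'a set topology" where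
  "HR_top D \<sigma> = Metric_space.mtopology (carrier (HR D \<sigma>)) (HR_dist D \<sigma>)"

definition HR_circle ::
    "'a::unital_cstar_algebra set \<Rightarrow> ('a \<Rightarrow> complex) \<Rightarrow> complex \<Rightarrow> 'a set" where
  "HR_circle D \<sigma> z = cls1 D \<sigma> (z *\<^sub>C 1)"

abbreviation HR_haar ::
    "'a::unital_cstar_algebra set \<Rightarrow> ('a \<Rightarrow> complex) \<Rightarrow> 'a set measure" where
  "HR_haar D \<sigma> \<equiv> haar_measure (HR D \<sigma>) (HR_top D \<sigma>) (HR_circle D \<sigma>)"

definition C_sub :: "'a::unital_cstar_algebra set \<Rightarrow> ('a \<Rightarrow> complex) \<Rightarrow> 'a set" where
  "C_sub D \<sigma> = closure (cspan (H_set D \<sigma>))"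

definition I_ideal :: "'a::unital_cstar_algebra set \<Rightarrow> ('a \<Rightarrow> complex) \<Rightarrow> 'a set" where
  "I_ideal D \<sigma> = closed_ideal (C_sub D \<sigma>) hull {d \<in> D. \<sigma> d = 0}"

definition T_hom ::
    "'a::unital_cstar_algebra set \<Rightarrow> ('a \<Rightarrow> complex) \<Rightarrow> 'a set \<Rightarrow> 'a set" where
  "T_hom D \<sigma> x = (\<Union>u\<in>x. coset_of (I_ideal D \<sigma>) u)"

definition dominated ::
    "'a::unital_cstar_algebra set \<Rightarrow> ('a \<Rightarrow> complex) \<Rightarrow> ('a set \<Rightarrow> complex) \<Rightarrow> bool" where
  "dominated D \<sigma> f \<longleftrightarrow>
     (\<forall>\<phi>\<in>compactly_supported (HR_top D \<sigma>).
        cmod (\<integral>t. \<phi> t * f t \<partial>HR_haar D \<sigma>)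
        \<le> coset_norm (quotient_integral (C_sub D \<sigma>) (I_ideal D \<sigma>) (HR_haar D \<sigma>)
             (\<lambda>t. coset_scale (I_ideal D \<sigma>) (\<phi> t) (T_hom D \<sigma> t))))"

definition M_set ::
    "'a::unital_cstar_algebra set \<Rightarrow> ('a \<Rightarrow> complex) \<Rightarrow> ('a set \<Rightarrow> complex) set" where
  "M_set D \<sigma> = {f \<in> pHom 1 (HR D \<sigma>) (HR_top D \<sigma>) (HR_circle D \<sigma>). dominated D \<sigma> f}"

definition tilde ::
    "'a::unital_cstar_algebra set \<Rightarrow> ('a \<Rightarrow> complex) \<Rightarrow> ('a \<Rightarrow> complex) \<Rightarrow> 'a set \<Rightarrow> complex" where
  "tilde D \<sigma> \<tau> = (\<lambda>x\<in>carrier (HR D \<sigma>). the_elem (\<tau> ` x))"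

end

theory Submission
  imports Defs
begin

text \<open>
  The seminorm \<open>B\<^sub>\<sigma>\<close> vanishes on products containing an element of \<open>ker \<sigma>\<close> and is invariant under
  multiplication by \<open>H\<^sub>\<sigma>\<close>. Hence \<open>\<II>\<^sub>\<sigma>\<close> is its null space in \<open>\<C>\<^sub>\<sigma>\<close>, and every normalizer \<open>v\<close> either has
  \<open>B\<^sub>\<sigma>(v) = 0\<close> or is a positive multiple of an element of \<open>H\<^sub>\<sigma>\<close>. By Cauchy-Schwarz a state \<open>\<tau>\<close>
  extending \<open>\<sigma>\<close> satisfies \<open>|\<tau>| \<le> B\<^sub>\<sigma>\<close>, so it factors through the quotient, is dominated, and by
  regularity is determined by its values on \<open>H\<^sub>\<sigma>\<close>.

  That \<open>D\<close> is a MASA makes the cosets of \<open>\<T>\<close> open: if \<open>u \<in> H\<^sub>\<sigma>\<close> is close to \<open>1\<close> then, for every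
  unitary \<open>w\<close> of \<open>D\<close>, all powers of \<open>u\<^sup>* w\<^sup>* u w\<close> are close to \<open>1\<close> near \<open>\<sigma>\<close>, so this element is \<open>1\<close>
  there; thus a cut-down \<open>u k\<close> commutes with \<open>D\<close> and \<open>[u]\<close> is a scalar.

  Conversely, testing domination of \<open>f\<close> on functions that are conjugate coordinates on
  finitely many cosets gives \<open>|\<Sum> c\<^sub>i f[u\<^sub>i]| \<le> \<parallel>\<Sum> c\<^sub>i u\<^sub>i\<parallel>\<close>; replacing \<open>u\<^sub>i\<close> by \<open>d u\<^sub>i e\<close> improves the right-hand
  side to \<open>B\<^sub>\<sigma>(\<Sum> c\<^sub>i u\<^sub>i)\<close>. Since the other normalizers are null for \<open>B\<^sub>\<sigma>\<close>, \<open>f\<close> extends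
  by \<open>0\<close> to a contractive functional on the whole algebra. It is positive because a Gram sum over
  normalizers \<open>v\<^sub>i\<close> splits according to the characters \<open>d \<mapsto> \<sigma>(v\<^sub>i\<^sup>* d v\<^sub>i) / \<sigma>(v\<^sub>i\<^sup>* v\<^sub>i)\<close>, and within one
  class it reduces to the positive definiteness of \<open>f\<close>.
\<close>

section \<open>Elementary facts on \<open>C\<^sup>*\<close>-algebras\<close>

text \<open>The real and imaginary parts of a normalizer \<open>v\<close> lie outside
  \<open>D\<close> in general, and yet \<open>v\<^sup>\<star> * v\<close> must be shown positive
  before \<open>v\<close> can be rescaled into \<open>H\<close>. Positivity is therefore phrased
  through norms of \<open>t - h\<close>, which mean the same in every subalgebra: an estimate proved
  in the bicommutant of one self-adjoint element is an estimate in the whole algebra. The group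
  enters only through finitely many cosets of the circle. A compact set meets finitely many of these
  open cosets, each has mass one, and on each of them points differ from a fixed class by a scalar;
  both sides of the domination inequality thus become finite sums with the same coefficients. In the
  converse direction \<open>f\<close> is known only on \<open>H\<close>, whereas positivity of the
  extension involves products \<open>v\<^sup>\<star> * w\<close> of arbitrary normalizers. If
  \<open>v\<close> and \<open>w\<close> move \<open>\<sigma>\<close> to the same character, a
  normalizer \<open>c\<close> that also does so serves as a base point:
  \<open>c\<^sup>\<star> * v\<close> and \<open>c\<^sup>\<star> * w\<close> are multiples of
  elements of \<open>H\<close>, and \<open>c * c\<^sup>\<star>\<close> can be inserted between
  \<open>v\<^sup>\<star>\<close> and \<open>w\<close> at the cost of a scalar.\<close>

lemma norm_star [simp]: "norm (x\<^sup>\<star>) = norm (x :: 'a::unital_cstar_algebra)"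
proof -
  have le: "norm y \<le> norm (y\<^sup>\<star>)" for y :: 'a
  proof (cases "y = 0")
    case False
    have "(norm y)\<^sup>2 \<le> norm (y\<^sup>\<star>) * norm y"
      using norm_mult_ineq[of "y\<^sup>\<star>" y] by (simp add: cstar_identity)
    then show ?thesis using False by (simp add: power2_eq_square)
  qed simp
  show ?thesis using le[of x] le[of "x\<^sup>\<star>"] by (simp add: star_star)
qed

lemmas scaleC_simps [simp] =
  complex_vector.scale_zero_right complex_vector.scale_one
  complex_vector.scale_minus_left complex_vector.scale_minus_right scaleC_scaleC

lemma scaleC_diff_right: "a *\<^sub>C (x - y) = a *\<^sub>C x - a *\<^sub>C (y :: 'a::unital_cstar_algebra)"
  by (rule complex_vector.scale_right_diff_distrib)

lemma scaleC_diff_left: "(a - b) *\<^sub>C x = a *\<^sub>C x - b *\<^sub>C (x :: 'a::unital_cstar_algebra)"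
  by (rule complex_vector.scale_left_diff_distrib)

lemma star_zero [simp]: "(0 :: 'a::unital_cstar_algebra)\<^sup>\<star> = 0"
  using star_scaleC[of 0 "0::'a"] by simp

lemma star_minus [simp]: "(- x :: 'a::unital_cstar_algebra)\<^sup>\<star> = - x\<^sup>\<star>"
  using star_scaleC[of "-1" x] by simp

lemma star_diff: "(x - y :: 'a::unital_cstar_algebra)\<^sup>\<star> = x\<^sup>\<star> - y\<^sup>\<star>"
  using star_add[of x "- y"] by simp

lemma star_one [simp]: "(1 :: 'a::unital_cstar_algebra)\<^sup>\<star> = 1"
  by (metis mult.left_neutral mult.right_neutral star_mult star_star)

lemma star_scaleR [simp]: "(r *\<^sub>R x :: 'a::unital_cstar_algebra)\<^sup>\<star> = r *\<^sub>R x\<^sup>\<star>"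
  by (simp add: star_scaleC flip: scaleC_of_real)

lemma star_of_real [simp]: "(of_real r :: 'a::unital_cstar_algebra)\<^sup>\<star> = of_real r"
  by (simp add: of_real_def)

lemma star_sum: "(\<Sum>i\<in>I. f i :: 'a::unital_cstar_algebra)\<^sup>\<star> = (\<Sum>i\<in>I. (f i)\<^sup>\<star>)"
  by (induction I rule: infinite_finite_induct) (simp_all add: star_add)

declare star_star [simp]

lemma bounded_linear_star: "bounded_linear (star :: 'a::unital_cstar_algebra \<Rightarrow> 'a)"
  by (rule bounded_linear_intro[where K = 1]) (simp_all add: star_add)

lemma bounded_linear_scaleC_right: "bounded_linear (\<lambda>x :: 'a::unital_cstar_algebra. c *\<^sub>C x)"
proof (rule bounded_linear_intro[where K = "cmod c"])
  show "c *\<^sub>C (r *\<^sub>R x) = r *\<^sub>R (c *\<^sub>C x)" for r and x :: 'a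
    by (simp add: mult.commute flip: scaleC_of_real)
qed (simp_all add: scaleC_add_right norm_scaleC)

lemma bounded_linear_scaleC_left: "bounded_linear (\<lambda>c. c *\<^sub>C (x :: 'a::unital_cstar_algebra))"
proof (rule bounded_linear_intro[where K = "norm x"])
  show "(r *\<^sub>R c) *\<^sub>C x = r *\<^sub>R (c *\<^sub>C x)" for r c
    by (metis scaleC_of_real scaleC_scaleC scaleR_conv_of_real)
qed (simp_all add: scaleC_add_left norm_scaleC)

lemmas tendsto_star [tendsto_intros] = bounded_linear.tendsto[OF bounded_linear_star]
  and continuous_on_star [continuous_intros] = bounded_linear.continuous_on[OF bounded_linear_star]
  and continuous_on_scaleC_right [continuous_intros] =
    bounded_linear.continuous_on[OF bounded_linear_scaleC_right]
  and continuous_on_scaleC_left [continuous_intros] =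
    bounded_linear.continuous_on[OF bounded_linear_scaleC_left]

lemma csubspace_scaleR: "csubspace A \<Longrightarrow> x \<in> A \<Longrightarrow> r *\<^sub>R x \<in> A"
  for x :: "'a::unital_cstar_algebra"
  by (metis complex_vector.subspace_scale scaleC_of_real)

lemma norm_selfadjoint_square: "x\<^sup>\<star> = x \<Longrightarrow> norm (x * x) = (norm x)\<^sup>2"
  for x :: "'a::unital_cstar_algebra"
  using cstar_identity[of x] by simp

lemma norm_mult_star: "norm (x * x\<^sup>\<star>) = (norm (x :: 'a::unital_cstar_algebra))\<^sup>2"
  using cstar_identity[of "x\<^sup>\<star>"] by simp

lemma norm_mult_le_one_left: "norm k \<le> 1 \<Longrightarrow> norm (k * x) \<le> norm (x :: 'a::real_normed_algebra)"
  by (meson mult_left_le_one_le norm_ge_zero norm_mult_ineq order.trans)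

lemma norm_mult_le_one_right: "norm k \<le> 1 \<Longrightarrow> norm (x * k) \<le> norm (x :: 'a::real_normed_algebra)"
  by (meson mult_right_le_one_le norm_ge_zero norm_mult_ineq order.trans)

text \<open>The root is \<open>1 - y\<close>, where \<open>y\<close> is the fixed point of \<open>y \<mapsto> (h + y\<^sup>2) / 2\<close>.\<close>

lemma sqrt_one_minus:
  fixes A :: "'a::unital_cstar_algebra set"
  assumes A: "closed A" "csubspace A" "1 \<in> A" "\<And>x y. x \<in> A \<Longrightarrow> y \<in> A \<Longrightarrow> x * y \<in> A"
    and h: "h \<in> A" "h\<^sup>\<star> = h" "norm h < 1"
  obtains k where "k \<in> A" "k\<^sup>\<star> = k" "k * k = 1 - h" "norm (1 - k) < 1"
proof -
  define r where "r = norm h"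
  have r: "0 \<le> r" "r < 1" using h by (auto simp: r_def)
  \<comment> \<open>The radius \<open>r = norm h\<close> works because (r + r^2)/2 is at most
    \<open>r\<close>, and on this ball the map contracts by the factor \<open>r\<close>. All three
    sets are closed, so the fixed point is a self-adjoint element of \<open>A\<close>.\<close>
  define S where "S = A \<inter> {y. y\<^sup>\<star> = y} \<inter> cball 0 r"
  define f where "f = (\<lambda>y. (1/2) *\<^sub>R (h + y * y))"
  have "closed {y :: 'a. y\<^sup>\<star> = y}"
    by (intro closed_Collect_eq continuous_intros)
  then have cl: "complete S"
    unfolding S_def complete_eq_closed using A(1) by (intro closed_Int) auto
  have "0 \<in> S" using r A(2) by (simp add: S_def complex_vector.subspace_0)
  then have ne: "S \<noteq> {}" by blast
  have maps: "f ` S \<subseteq> S"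
  proof clarify
    fix y assume "y \<in> S"
    then have y: "y \<in> A" "y\<^sup>\<star> = y" "norm y \<le> r" by (auto simp: S_def)
    have "norm (y * y) \<le> r * r"
      using y(3) r by (smt (verit) norm_mult_ineq mult_mono norm_ge_zero)
    also have "\<dots> \<le> r" using r by (simp add: mult_left_le)
    finally have "norm (h + y * y) \<le> 2 * r"
      using norm_triangle_ineq[of h "y * y"] by (simp add: r_def)
    then show "f y \<in> S"
      using A y h by (simp add: S_def f_def star_add star_mult csubspace_scaleR complex_vector.subspace_add)
  qed
  have lip: "dist (f x) (f y) \<le> r * dist x y" if "x \<in> S" "y \<in> S" for x y
  proof -
    have eq: "f x - f y = (1/2) *\<^sub>R (x * (x - y) + (x - y) * y)"
      by (simp add: f_def algebra_simps)
    have "norm (x * (x - y)) \<le> r * norm (x - y)" "norm ((x - y) * y) \<le> norm (x - y) * r"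
      using that by (auto simp: S_def intro!: order.trans[OF norm_mult_ineq] mult_right_mono mult_left_mono)
    then have "norm (x * (x - y) + (x - y) * y) \<le> 2 * (r * norm (x - y))"
      using norm_triangle_ineq[of "x * (x - y)" "(x - y) * y"] by (simp add: mult.commute)
    then show ?thesis unfolding dist_norm eq by simp
  qed
  obtain y where y: "y \<in> S" "f y = y"
    using Banach_fix[OF cl ne r maps] lip by blast
  show thesis
  proof
    show "1 - y \<in> A" using y A by (simp add: S_def complex_vector.subspace_diff)
    show "(1 - y)\<^sup>\<star> = 1 - y" using y by (simp add: S_def star_diff)
    have "2 *\<^sub>R f y = h + y * y" by (simp add: f_def)
    then have "h + y * y = y + y" using y(2) by (simp add: scaleR_2)
    then have "h = y + y - y * y" by (simp add: algebra_simps)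
    then show "(1 - y) * (1 - y) = 1 - h" by (simp add: algebra_simps)
    show "norm (1 - (1 - y)) < 1" using y r by (simp add: S_def)
  qed
qed

text \<open>The inverse is the fixed point of \<open>r \<mapsto> 1 + y * r\<close>. Since
  \<open>A\<close> is only a closed set stable under this map, it can later be taken to consist of
  the self-adjoint elements of \<open>D\<close>.\<close>

lemma neumann_inverse:
  fixes A :: "'a::{real_normed_algebra_1, banach} set"
  assumes A: "closed A" "a \<in> A" "\<And>r. r \<in> A \<Longrightarrow> 1 + y * r \<in> A" and y: "norm y < 1"
  obtains r where "r \<in> A" "(1 - y) * r = 1"
proof -
  have "\<exists>!r. r \<in> A \<and> 1 + y * r = r"
  proof (rule Banach_fix[where c = "norm y"])
    show "dist (1 + y * r) (1 + y * s) \<le> norm y * dist r s" for r s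
      using norm_mult_ineq[of y "r - s"] by (simp add: dist_norm algebra_simps)
  qed (use assms in \<open>auto simp: complete_eq_closed\<close>)
  then obtain r where "r \<in> A" "1 + y * r = r" by blast
  then show thesis using that[of r] by (simp add: algebra_simps)
qed

section \<open>Positive elements of an abelian subalgebra\<close>

locale abelian_subalgebra =
  fixes D :: "'a::unital_cstar_algebra set"
  assumes abelian: "abelian_cstar_subalgebra D"
begin

lemma D_closed: "closed D" and D_csubspace: "csubspace D" and D_one [simp]: "1 \<in> D"
  and D_star [simp]: "x \<in> D \<Longrightarrow> x\<^sup>\<star> \<in> D"
  and D_mult [simp]: "x \<in> D \<Longrightarrow> y \<in> D \<Longrightarrow> x * y \<in> D"
  and D_comm: "x \<in> D \<Longrightarrow> y \<in> D \<Longrightarrow> x * y = y * x"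
  using abelian unfolding abelian_cstar_subalgebra_def by blast+

lemma D_add [simp]: "x \<in> D \<Longrightarrow> y \<in> D \<Longrightarrow> x + y \<in> D"
  and D_diff [simp]: "x \<in> D \<Longrightarrow> y \<in> D \<Longrightarrow> x - y \<in> D"
  and D_zero [simp]: "0 \<in> D"
  and D_scaleC [simp]: "x \<in> D \<Longrightarrow> c *\<^sub>C x \<in> D"
  and D_scaleR [simp]: "x \<in> D \<Longrightarrow> r *\<^sub>R x \<in> D"
  using D_csubspace
  by (auto simp: complex_vector.subspace_add complex_vector.subspace_diff
      complex_vector.subspace_0 complex_vector.subspace_scale csubspace_scaleR)

lemma D_of_real [simp]: "of_real r \<in> D"
  by (simp add: of_real_def)

lemma D_minus [simp]: "x \<in> D \<Longrightarrow> - x \<in> D"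
  using D_diff[of 0 x] by simp

text \<open>This is the norm form of having spectrum in the nonnegative reals. Asking for every
  \<open>t \<ge> norm h\<close> makes the condition convenient to use; \<open>posI\<close> recovers
  it from a single \<open>t\<close>.\<close>

definition pos :: "'a \<Rightarrow> bool" where
  "pos h \<longleftrightarrow> h \<in> D \<and> h\<^sup>\<star> = h \<and> (\<forall>t \<ge> norm h. norm (of_real t - h) \<le> t)"

lemma pos_D: "pos h \<Longrightarrow> h \<in> D" and pos_star: "pos h \<Longrightarrow> h\<^sup>\<star> = h"
  and pos_norm: "pos h \<Longrightarrow> norm h \<le> t \<Longrightarrow> norm (of_real t - h) \<le> t"
  by (auto simp: pos_def)

text \<open>A rescaling of the root of \<open>1 - h / t\<close>. The last bound makes the root
  itself positive, by \<open>posI\<close>.\<close>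

lemma sqrt_pos_scale:
  assumes h: "h \<in> D" "h\<^sup>\<star> = h" "norm h < t"
  obtains k where "k \<in> D" "k\<^sup>\<star> = k" "k * k = of_real t - h" "norm (of_real (sqrt t) - k) \<le> sqrt t"
proof -
  have t: "0 < t" using h(3) norm_ge_zero[of h] by linarith
  have "norm ((1/t) *\<^sub>R h) < 1" using h t by simp
  then obtain l where l: "l \<in> D" "l\<^sup>\<star> = l" "l * l = 1 - (1/t) *\<^sub>R h" "norm (1 - l) < 1"
    using sqrt_one_minus[of D "(1/t) *\<^sub>R h"] h D_closed D_csubspace by auto
  show thesis
  proof
    show "sqrt t *\<^sub>R l \<in> D" "(sqrt t *\<^sub>R l)\<^sup>\<star> = sqrt t *\<^sub>R l" using l by auto
    have "(sqrt t *\<^sub>R l) * (sqrt t *\<^sub>R l) = t *\<^sub>R (l * l)" using t by simp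
    then show "(sqrt t *\<^sub>R l) * (sqrt t *\<^sub>R l) = of_real t - h"
      using t by (simp add: l(3) scaleR_diff_right of_real_def)
    have "of_real (sqrt t) - sqrt t *\<^sub>R l = sqrt t *\<^sub>R (1 - l)"
      by (simp add: of_real_def scaleR_diff_right)
    then show "norm (of_real (sqrt t) - sqrt t *\<^sub>R l) \<le> sqrt t"
      using l(4) t by (simp add: mult_left_le)
  qed
qed

text \<open>Since \<open>h\<^sup>2 + k\<^sup>2 = t\<close>, the element \<open>u = h + i k\<close> has \<open>u\<^sup>* u = t\<close> and \<open>h\<close> is its
  real part.\<close>

lemma norm_le_of_squares:
  assumes h: "h \<in> D" "h\<^sup>\<star> = h" and k: "k \<in> D" "k\<^sup>\<star> = k"
    and eq: "h * h + k * k = of_real t" and t: "0 \<le> t"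
  shows "(norm h)\<^sup>2 \<le> t"
proof -
  define u where "u = h + \<i> *\<^sub>C k"
  have us: "u\<^sup>\<star> = h - \<i> *\<^sub>C k" using h k by (simp add: u_def star_add star_scaleC)
  have "u\<^sup>\<star> * u = h * h + k * k" using D_comm[of h k] h k
    unfolding us by (simp add: u_def algebra_simps mult_scaleC_left mult_scaleC_right)
  then have "(norm u)\<^sup>2 = t" using eq t by (simp flip: cstar_identity)
  then have nu: "norm u = sqrt t" by (metis norm_ge_zero real_sqrt_unique)
  have "2 *\<^sub>R h = u + u\<^sup>\<star>" unfolding us by (simp add: u_def scaleR_2)
  then have "2 * norm h \<le> norm u + norm u"
    using norm_triangle_ineq[of u "u\<^sup>\<star>"] by (metis norm_scaleR norm_star abs_numeral)
  then have "norm h \<le> sqrt t" using nu by simp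
  then show ?thesis using t by (metis norm_ge_zero power_mono real_sqrt_pow2)
qed

text \<open>If \<open>l\<close> is the root of \<open>t - k * k\<close>, then l^2 + k^2 = t, so the
  norm of l^2 is at most \<open>t\<close>.\<close>

lemma norm_diff_square_le:
  assumes k: "k \<in> D" "k\<^sup>\<star> = k" and t: "norm (k * k) < t"
  shows "norm (of_real t - k * k) \<le> t"
proof -
  have t0: "0 < t" using t norm_ge_zero[of "k * k"] by linarith
  have "(k * k)\<^sup>\<star> = k * k" using k by (simp add: star_mult)
  then obtain l where l: "l \<in> D" "l\<^sup>\<star> = l" "l * l = of_real t - k * k"
    using sqrt_pos_scale[of "k * k" t] k t by auto
  have "(norm l)\<^sup>2 \<le> t"
    using l k t0 by (intro norm_le_of_squares[of l k]) auto
  then show ?thesis using norm_selfadjoint_square[OF l(2)] l(3) by simp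
qed

lemma pos_of_approx_squares:
  assumes h: "h \<in> D" "h\<^sup>\<star> = h"
    and sq: "\<And>\<epsilon>. 0 < \<epsilon> \<Longrightarrow> \<exists>k\<in>D. k\<^sup>\<star> = k \<and> k * k = h + of_real \<epsilon>"
  shows "pos h"
  unfolding pos_def
proof (intro conjI allI impI)
  fix t assume t: "norm h \<le> t"
  show "norm (of_real t - h) \<le> t"
  proof (rule field_le_epsilon)
    fix e :: real assume e: "0 < e"
    \<comment> \<open>One third is lost by subtracting \<open>\<epsilon>\<close> again, and two
      thirds by enlarging \<open>t\<close> to \<open>t + 2 * \<epsilon>\<close>, which strictly
      exceeds \<open>norm (k * k)\<close>.\<close>
    define \<epsilon> where "\<epsilon> = e / 3"
    have \<epsilon>: "0 < \<epsilon>" "e = 3 * \<epsilon>" using e by (auto simp: \<epsilon>_def)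
    obtain k where k: "k \<in> D" "k\<^sup>\<star> = k" "k * k = h + of_real \<epsilon>" using sq \<epsilon> by blast
    have "norm (k * k) \<le> t + \<epsilon>"
      using k(3) t \<epsilon> norm_triangle_ineq[of h "of_real \<epsilon>"] by simp
    then have "norm (of_real (t + 2 * \<epsilon>) - k * k) \<le> t + 2 * \<epsilon>"
      using \<epsilon> by (intro norm_diff_square_le k) auto
    moreover have eq: "of_real t - h = (of_real (t + 2 * \<epsilon>) - k * k) - of_real \<epsilon>"
      unfolding k(3) by (simp add: algebra_simps) (rule mult_2_right[symmetric])
    moreover have "norm (of_real t - h) \<le> norm (of_real (t + 2 * \<epsilon>) - k * k) + norm (of_real \<epsilon> :: 'a)"
      unfolding eq by (rule norm_triangle_ineq4)
    moreover have "norm (of_real \<epsilon> :: 'a) = \<epsilon>" using \<epsilon> by simp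
    ultimately show "norm (of_real t - h) \<le> t + e" using \<epsilon> by linarith
  qed
qed (use h in auto)

text \<open>The element \<open>t - h\<close> has norm less than \<open>t + \<epsilon>\<close>, and
  subtracting it from \<open>t + \<epsilon>\<close> leaves \<open>h + \<epsilon>\<close>.\<close>

lemma approx_root:
  assumes h: "h \<in> D" "h\<^sup>\<star> = h" "norm (of_real t - h) \<le> t" and \<epsilon>: "0 < \<epsilon>"
  obtains k where "k \<in> D" "k\<^sup>\<star> = k" "k * k = h + of_real \<epsilon>"
    "norm (of_real (sqrt (t + \<epsilon>)) - k) \<le> sqrt (t + \<epsilon>)"
proof -
  have "of_real t - h \<in> D" "(of_real t - h)\<^sup>\<star> = of_real t - h" "norm (of_real t - h) < t + \<epsilon>"
    using h \<epsilon> by (auto simp: star_diff)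
  then obtain k where "k \<in> D" "k\<^sup>\<star> = k" "k * k = of_real (t + \<epsilon>) - (of_real t - h)"
    "norm (of_real (sqrt (t + \<epsilon>)) - k) \<le> sqrt (t + \<epsilon>)"
    using sqrt_pos_scale by metis
  then show thesis using that by (simp add: algebra_simps)
qed

lemma posI:
  assumes "h \<in> D" "h\<^sup>\<star> = h" "norm (of_real t - h) \<le> t"
  shows "pos h"
  using assms(1,2) by (rule pos_of_approx_squares) (use assms in \<open>metis approx_root\<close>)

lemma pos_approx_root:
  assumes "pos h" "0 < \<epsilon>"
  obtains k where "pos k" "k * k = h + of_real \<epsilon>"
  using approx_root[of h "norm h" \<epsilon>] assms posI unfolding pos_def by (metis order.refl)

lemma pos_of_real: "0 \<le> c \<Longrightarrow> pos (of_real c)"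
  by (rule posI[where t = c]) auto

lemma pos_square: "k \<in> D \<Longrightarrow> k\<^sup>\<star> = k \<Longrightarrow> pos (k * k)"
  using norm_diff_square_le[of k "norm (k * k) + 1"]
  by (intro posI[where t = "norm (k * k) + 1"]) (auto simp: star_mult)

lemma pos_add: assumes "pos g" "pos h" shows "pos (g + h)"
proof (rule posI[where t = "norm g + norm h"])
  have "of_real (norm g + norm h) - (g + h) = (of_real (norm g) - g) + (of_real (norm h) - h)"
    by simp
  then show "norm (of_real (norm g + norm h) - (g + h)) \<le> norm g + norm h"
    using pos_norm[OF assms(1) order.refl] pos_norm[OF assms(2) order.refl]
    by (metis norm_triangle_mono)
qed (use assms in \<open>auto simp: pos_D pos_star star_add\<close>)

lemma pos_scaleR: assumes "pos h" "0 \<le> c" shows "pos (c *\<^sub>R h)"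
proof (rule posI[where t = "c * norm h"])
  have "of_real (c * norm h) - c *\<^sub>R h = c *\<^sub>R (of_real (norm h) - h)"
    by (simp add: of_real_def scaleR_diff_right)
  then show "norm (of_real (c * norm h) - c *\<^sub>R h) \<le> c * norm h"
    using pos_norm[OF assms(1) order.refl] assms(2) by (simp add: mult_left_mono)
qed (use assms in \<open>auto simp: pos_D pos_star\<close>)

lemma pos_limit:
  assumes h: "\<And>n. pos (h n)" and lim: "h \<longlonglongrightarrow> l"
  shows "pos l"
proof (rule posI)
  show "l \<in> D" using closed_sequentially[OF D_closed] h lim pos_D by blast
  have "(\<lambda>n. (h n)\<^sup>\<star>) \<longlonglongrightarrow> l\<^sup>\<star>" by (intro tendsto_intros lim)
  then show "l\<^sup>\<star> = l" using h lim LIMSEQ_unique by (auto simp: pos_star)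
  show "norm (of_real (norm l) - l) \<le> norm l"
    by (rule LIMSEQ_le[of "\<lambda>n. norm (of_real (norm (h n)) - h n)" _ "\<lambda>n. norm (h n)"])
      (auto intro!: tendsto_intros lim pos_norm h)
qed

lemma inverse_Suc_to_zero: "(\<lambda>n. of_real (inverse (real (Suc n))) :: 'a) \<longlonglongrightarrow> 0"
  using tendsto_of_real[OF LIMSEQ_inverse_real_of_nat, where 'a = 'a] by simp

text \<open>After adding a small scalar both factors have positive roots; these commute, so the
  perturbed product is the square of a self-adjoint element.\<close>

lemma pos_mult: assumes "pos g" "pos h" shows "pos (g * h)"
proof (rule pos_limit)
  let ?e = "\<lambda>n. of_real (inverse (real (Suc n))) :: 'a"
  show "pos ((g + ?e n) * (h + ?e n))" for n
  proof -
    have "0 < inverse (real (Suc n))" by simp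
    note root = pos_approx_root[OF _ this]
    obtain k where k: "pos k" "k * k = g + ?e n"
      using root[OF assms(1)] .
    obtain l where l: "pos l" "l * l = h + ?e n"
      using root[OF assms(2)] .
    have "(k * l)\<^sup>\<star> = k * l" "k * l \<in> D"
      using k l D_comm by (auto simp: star_mult pos_star pos_D)
    then have "pos ((k * l) * (k * l))" by (rule pos_square[rotated])
    moreover have "(k * l) * (k * l) = (k * k) * (l * l)"
      using D_comm[OF pos_D[OF k(1)] pos_D[OF l(1)]] by (metis mult.assoc)
    ultimately show ?thesis using k l by simp
  qed
  show "(\<lambda>n. (g + ?e n) * (h + ?e n)) \<longlonglongrightarrow> g * h"
    using tendsto_mult[OF tendsto_add[OF tendsto_const inverse_Suc_to_zero]
      tendsto_add[OF tendsto_const inverse_Suc_to_zero], of g h] by simp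
qed

text \<open>The product of the two positive elements is t^2 - h^2. An approximate root
  \<open>k\<close> of it satisfies h^2 + k^2 = t^2 + e, which bounds \<open>h\<close>.\<close>

lemma norm_le_of_order:
  assumes h: "h \<in> D" "h\<^sup>\<star> = h" and b: "pos (of_real t - h)" "pos (of_real t + h)" and t: "0 \<le> t"
  shows "norm h \<le> t"
proof -
  have eq: "(of_real t - h) * (of_real t + h) = of_real (t * t) - h * h"
    by (simp add: algebra_simps of_real_def)
  have p: "pos (of_real (t * t) - h * h)" using pos_mult[OF b] unfolding eq .
  have "(norm h)\<^sup>2 \<le> t * t"
  proof (rule field_le_epsilon)
    fix e :: real assume e: "0 < e"
    obtain k where k: "pos k" "k * k = of_real (t * t) - h * h + of_real e"
      using pos_approx_root[OF p e] .
    show "(norm h)\<^sup>2 \<le> t * t + e"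
      using k e t h by (intro norm_le_of_squares[of h k]) (auto simp: pos_D pos_star)
  qed
  then show ?thesis using t by (simp add: power2_eq_square abs_le_square_iff flip: power2_eq_square)
qed

lemma pos_norm_le:
  assumes "pos h" "pos (of_real t - h)" "0 \<le> t"
  shows "norm h \<le> t"
  using assms by (intro norm_le_of_order pos_add pos_of_real) (auto simp: pos_D pos_star)

section \<open>Real and imaginary parts, inverses, square roots, positive and negative parts\<close>

lemma real_imaginary_parts:
  fixes a :: 'a
  defines "b \<equiv> (1/2) *\<^sub>R (a + a\<^sup>\<star>)" and "c \<equiv> (- \<i> / 2) *\<^sub>C (a - a\<^sup>\<star>)"
  shows "b\<^sup>\<star> = b" "c\<^sup>\<star> = c" "a = b + \<i> *\<^sub>C c"
proof -
  show "b\<^sup>\<star> = b" by (simp add: b_def star_add add.commute)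
  show "c\<^sup>\<star> = c" by (simp add: c_def star_scaleC star_diff scaleC_diff_right)
  have "\<i> *\<^sub>C c = (1/2) *\<^sub>R (a - a\<^sup>\<star>)" by (simp add: c_def flip: scaleC_of_real)
  then show "a = b + \<i> *\<^sub>C c"
    by (simp add: b_def scaleR_add_right scaleR_diff_right flip: scaleR_add_left)
qed

lemma pos_star_mult: assumes a: "a \<in> D" shows "pos (a\<^sup>\<star> * a)"
proof -
  obtain b c where bc: "b \<in> D" "c \<in> D" "b\<^sup>\<star> = b" "c\<^sup>\<star> = c" "a = b + \<i> *\<^sub>C c"
    using real_imaginary_parts[of a] a by (metis D_add D_diff D_scaleC D_scaleR D_star)
  have "a\<^sup>\<star> * a = b * b + c * c" using D_comm[OF bc(1,2)]
    unfolding bc(5) by (simp add: bc star_add star_scaleC algebra_simps mult_scaleC_left mult_scaleC_right)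
  then show ?thesis using bc by (simp add: pos_add pos_square)
qed

lemma pos_inverse:
  assumes h: "pos (h - of_real \<delta>)" and \<delta>: "0 < \<delta>"
  obtains r where "pos r" "r * h = 1" "h * r = 1"
proof -
  \<comment> \<open>For this \<open>t\<close>, positivity of \<open>h - \<delta>\<close> bounds
    \<open>t - h\<close> by \<open>t - \<delta>\<close>, so that \<open>y\<close> below has norm
    less than one.\<close>
  define t where "t = norm (h - of_real \<delta>) + \<delta>"
  have t: "0 < t" using \<delta> by (simp add: t_def add_nonneg_pos)
  have ph: "pos h" using pos_add[OF h pos_of_real[of \<delta>]] \<delta> by simp
  have hD: "h \<in> D" "h\<^sup>\<star> = h" using ph by (auto simp: pos_D pos_star)
  define y where "y = (1/t) *\<^sub>R (of_real t - h)"
  have "norm (of_real (norm (h - of_real \<delta>)) - (h - of_real \<delta>)) \<le> norm (h - of_real \<delta>)"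
    by (rule pos_norm[OF h order.refl])
  then have "norm (of_real t - h) \<le> t - \<delta>" by (simp add: t_def algebra_simps)
  then have "norm y < 1" using t \<delta> by (simp add: y_def)
  moreover have "y \<in> D" "y\<^sup>\<star> = y" using hD by (auto simp: y_def star_diff)
  moreover have "closed (D \<inter> {x. x\<^sup>\<star> = x})"
    using D_closed by (intro closed_Int closed_Collect_eq continuous_intros) auto
  ultimately obtain s where s: "s \<in> D" "s\<^sup>\<star> = s" "(1 - y) * s = 1"
    using neumann_inverse[of "D \<inter> {x. x\<^sup>\<star> = x}" 0 y] by (auto simp: star_add star_mult D_comm)
  have "1 - y = (1/t) *\<^sub>R h" using t by (simp add: y_def of_real_def scaleR_diff_right)
  then have hr: "h * ((1/t) *\<^sub>R s) = 1" using s(3) by simp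
  define r where "r = (1/t) *\<^sub>R s"
  have r: "r \<in> D" "r\<^sup>\<star> = r" using s by (auto simp: r_def)
  \<comment> \<open>Positivity of the inverse: it is the product of \<open>h\<close> with the square
    of the inverse.\<close>
  have "r = h * (r * r)" using hr by (metis mult.assoc mult.left_neutral r_def)
  then have "pos r" using pos_mult[OF ph pos_square[OF r]] by simp
  then show thesis using that[of r] hr r hD D_comm by (metis r_def)
qed

text \<open>The difference \<open>s - s'\<close> is (a^2 - b^2) times the inverse of
  \<open>s + s'\<close>, and \<open>s + s'\<close> is at least \<open>a + b\<close>. The estimate
  makes the roots of \<open>H + e^2\<close> a Cauchy family as \<open>e\<close> tends to 0, which
  yields exact square roots.\<close>

lemma pos_root_diff_le:
  assumes H: "pos H" and s: "pos s" "s * s = H + of_real (a * a)"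
    and s': "pos s'" "s' * s' = H + of_real (b * b)" and ab: "0 < b" "b \<le> a"
  shows "norm (s - s') \<le> a - b"
proof -
  \<comment> \<open>Here \<open>x - c\<close> equals \<open>H\<close> times the inverse of
    \<open>x + c\<close>, a product of positive elements.\<close>
  have ge: "pos (x - of_real c)" if x: "pos x" "x * x = H + of_real (c * c)" and c: "0 < c" for x c
  proof -
    have "pos (x + of_real c - of_real c)" using x by simp
    then obtain r where r: "pos r" "(x + of_real c) * r = 1" using pos_inverse c by metis
    have "(x - of_real c) * (x + of_real c) = H"
      using x(2) by (simp add: algebra_simps of_real_def)
    then have "x - of_real c = H * r" using r(2) by (metis mult.assoc mult.right_neutral)
    then show ?thesis using pos_mult[OF H r(1)] by simp
  qed
  have D: "s \<in> D" "s' \<in> D" using s s' by (auto simp: pos_D)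
  have "pos ((s - of_real a) + (s' - of_real b))"
    using ge s s' ab by (intro pos_add) auto
  then have p: "pos (s + s' - of_real (a + b))" by (simp add: algebra_simps)
  then obtain r where r: "pos r" "r * (s + s') = 1" "(s + s') * r = 1"
    using pos_inverse ab by (metis add_pos_pos order.strict_trans2)
  have "pos ((1 / (a + b)) *\<^sub>R (r * (s + s' - of_real (a + b))))"
    using p r ab by (intro pos_scaleR pos_mult) auto
  moreover have "(1 / (a + b)) *\<^sub>R (r * (s + s' - of_real (a + b))) = of_real (1 / (a + b)) - r"
    using r(2) ab by (simp add: right_diff_distrib of_real_def scaleR_diff_right)
  ultimately have nr: "norm r \<le> 1 / (a + b)" using ab r by (intro pos_norm_le) auto
  have "(s - s') * (s + s') = of_real (a * a - b * b)"
    using D_comm[OF D] s(2) s'(2) by (simp add: algebra_simps)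
  then have "s - s' = of_real (a * a - b * b) * r" using r(3) by (metis mult.assoc mult.right_neutral)
  then have "norm (s - s') = (a * a - b * b) * norm r"
    using ab mult_mono[of b a b a] by (simp add: of_real_def)
  also have "\<dots> \<le> (a * a - b * b) * (1 / (a + b))"
    using nr ab mult_mono[of b a b a] by (intro mult_left_mono) auto
  also have "a * a - b * b = (a - b) * (a + b)" by (simp add: algebra_simps)
  finally show ?thesis using ab by simp
qed

lemma pos_sqrt: assumes H: "pos H" obtains s where "pos s" "s * s = H"
proof -
  let ?e = "\<lambda>n. inverse (real (Suc n))"
  have "\<exists>s. pos s \<and> s * s = H + of_real (?e n * ?e n)" for n
    using pos_approx_root[OF H, of "?e n * ?e n"] by (metis inverse_positive_iff_positive mult_pos_pos of_nat_0_less_iff zero_less_Suc)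
  then obtain s where s: "\<And>n. pos (s n)" "\<And>n. s n * s n = H + of_real (?e n * ?e n)" by metis
  have "Cauchy s"
  proof (rule metric_CauchyI)
    fix e :: real assume "0 < e"
    then obtain N where N: "?e N < e" using reals_Archimedean by blast
    have *: "dist (s m) (s n) < e" if "N \<le> m" "m \<le> n" for m n
    proof -
      have "?e n \<le> ?e m" "?e m \<le> ?e N" "0 < ?e n"
        using that by (auto intro!: le_imp_inverse_le)
      then have "norm (s m - s n) \<le> ?e m - ?e n"
        using s by (intro pos_root_diff_le[OF H]) auto
      then show ?thesis using \<open>?e m \<le> ?e N\<close> \<open>0 < ?e n\<close> N unfolding dist_norm by linarith
    qed
    show "\<exists>M. \<forall>m\<ge>M. \<forall>n\<ge>M. dist (s m) (s n) < e"
      using * by (metis dist_commute nle_le)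
  qed
  then obtain l where l: "s \<longlonglongrightarrow> l" using Cauchy_convergent convergentD by blast
  have "(\<lambda>n. s n * s n) \<longlonglongrightarrow> l * l" by (intro tendsto_mult l)
  moreover have "(\<lambda>n. s n * s n) \<longlonglongrightarrow> H"
    using tendsto_add[OF tendsto_const tendsto_mult[OF inverse_Suc_to_zero inverse_Suc_to_zero], of H] s(2)
    by simp
  ultimately show thesis using that[of l] pos_limit[OF s(1) l] LIMSEQ_unique by blast
qed

text \<open>Up to \<open>\<epsilon>\<close>, \<open>d\<close> is the product of \<open>d\<^sup>3\<close> and the inverse of \<open>d\<^sup>2 + \<epsilon>\<^sup>2\<close>.\<close>

lemma pos_of_cube:
  assumes d: "d \<in> D" "d\<^sup>\<star> = d" and cube: "pos (d * (d * d))"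
  shows "pos d"
proof -
  have approx: "\<exists>x. pos x \<and> norm (d - x) \<le> e" if e: "0 < e" for e
  proof -
    have "pos (d * d + of_real (e * e) - of_real (e * e))" using d by (simp add: pos_square)
    then obtain r where r: "pos r" "r * (d * d + of_real (e * e)) = 1" "(d * d + of_real (e * e)) * r = 1"
      using pos_inverse e by (metis mult_pos_pos)
    define y where "y = d * r"
    have rd: "r * d = d * r" using D_comm r d pos_D by blast
    have y: "y \<in> D" "y\<^sup>\<star> = y" using r d rd by (auto simp: y_def pos_D pos_star star_mult)
    have eq: "d - d * (d * d) * r = (e * e) *\<^sub>R y"
    proof -
      have "d = d * ((d * d + of_real (e * e)) * r)" using r(3) by simp
      also have "\<dots> = d * (d * d) * r + (e * e) *\<^sub>R y"
        by (simp add: y_def of_real_def algebra_simps)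
      finally show ?thesis by (metis add_diff_cancel_left')
    qed
    \<comment> \<open>Expanding this square gives \<open>1 / (2 * e) + z * r\<close>, the order form
      of 2 e |d| \<le> d^2 + e^2. Both signs together bound \<open>d * r\<close> by
      \<open>1 / (2 * e)\<close>, so the error e^2 \<open>y\<close> is at most e/2.\<close>
    have sq: "pos ((1 / (2 * e)) *\<^sub>R ((of_real e + z) * (of_real e + z) * r))" 
      if "z = d \<or> z = - d" for z
      using that d e r by (intro pos_scaleR pos_mult pos_square) (auto simp: star_add star_diff)
    have "pos (of_real (1 / (2 * e)) + z * r)" if "z = d \<or> z = - d" for z
    proof -
      have "(of_real e + z) * (of_real e + z) * r = (d * d + of_real (e * e)) * r + (2 * e) *\<^sub>R (z * r)"
        using that by (auto simp: of_real_def algebra_simps simp flip: scaleR_add_left)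
      then have "(1 / (2 * e)) *\<^sub>R ((of_real e + z) * (of_real e + z) * r) = of_real (1 / (2 * e)) + z * r"
        using r(3) e by (simp add: scaleR_add_right of_real_def)
      then show ?thesis using sq[OF that] by simp
    qed
    from this[of d] this[of "- d"] have "norm y \<le> 1 / (2 * e)"
      using y e by (intro norm_le_of_order) (auto simp: y_def)
    then have "norm (d - d * (d * d) * r) \<le> (e * e) * (1 / (2 * e))"
      unfolding eq using e by (simp del: times_divide_eq_right add: mult_left_mono)
    also have "\<dots> \<le> e" using e by simp
    finally show ?thesis using pos_mult[OF cube r(1)] by blast
  qed
  define e where "e = (\<lambda>n. inverse (real (Suc n)))"
  have e0: "e \<longlonglongrightarrow> 0" "\<And>n. 0 < e n"
    using LIMSEQ_inverse_real_of_nat by (simp_all add: e_def)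
  have "\<exists>x. pos x \<and> norm (d - x) \<le> e n" for n using approx e0(2) by blast
  then obtain x where x: "\<And>n. pos (x n)" "\<And>n. norm (d - x n) \<le> e n" by metis
  have "(\<lambda>n. d - x n) \<longlonglongrightarrow> 0"
    by (rule Lim_null_comparison[OF _ e0(1)]) (use x in auto)
  then have "x \<longlonglongrightarrow> d" using tendsto_diff[OF tendsto_const, of _ 0 _ d] by fastforce
  then show ?thesis using pos_limit x by blast
qed

text \<open>With \<open>c\<close> the root of \<open>h * h\<close>, the parts are half of
  \<open>c + h\<close> and half of \<open>c - h\<close>. From c^2 = h^2 one gets (c + h)^2 = 2c(c +
  h), so the cube of \<open>c + h\<close> is 2c(c + h)^2, which is visibly positive; likewise for
  \<open>c - h\<close>. This is where \<open>pos_of_cube\<close> is needed.\<close>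

lemma positive_negative_parts:
  assumes h: "h \<in> D" "h\<^sup>\<star> = h"
  obtains k m where "pos k" "pos m" "k * m = 0" "h = k - m"
proof -
  obtain c where c: "pos c" "c * c = h * h"
    using pos_sqrt pos_square h by blast
  have cD: "c \<in> D" "c\<^sup>\<star> = c" using c by (auto simp: pos_D pos_star)
  have dom: "pos (c + z)" if z: "z = h \<or> z = - h" for z
  proof (rule pos_of_cube)
    have zD: "z \<in> D" "z\<^sup>\<star> = z" "z * z = c * c" using z h c by auto
    then show "c + z \<in> D" "(c + z)\<^sup>\<star> = c + z" using cD by (auto simp: star_add)
    have "c * z = z * c" using D_comm cD zD by blast
    then have "(c + z) * ((c + z) * (c + z)) = 2 *\<^sub>R (c * ((c + z) * (c + z)))"
      using zD by (simp add: algebra_simps scaleR_2 flip: mult.assoc)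
    then show "pos ((c + z) * ((c + z) * (c + z)))"
      using zD cD c by (auto intro!: pos_scaleR pos_mult[OF c(1)] pos_square simp: star_add)
  qed
  show thesis
  proof
    show "pos ((1/2) *\<^sub>R (c + h))" "pos ((1/2) *\<^sub>R (c + - h))"
      using dom[of h] dom[of "- h"] by (auto intro!: pos_scaleR)
    show "(1/2) *\<^sub>R (c + h) * (1/2) *\<^sub>R (c + - h) = 0"
      using c D_comm[OF cD(1) h(1)] by (simp add: algebra_simps)
    show "h = (1/2) *\<^sub>R (c + h) - (1/2) *\<^sub>R (c + - h)"
      by (simp add: scaleR_add_right scaleR_diff_right flip: scaleR_add_left)
  qed
qed

end

section \<open>Commutants\<close>

definition commutant :: "'a::unital_cstar_algebra set \<Rightarrow> 'a set" where
  "commutant S = {z. \<forall>s\<in>S. z * s = s * z}"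

lemma subset_bicommutant: "S \<subseteq> commutant (commutant S)"
  by (auto simp: commutant_def)

text \<open>The bicommutant stands in for the generated algebra: it is closed and unital by its
  form, and abelian because \<open>S \<subseteq> commutant S\<close> puts it inside
  \<open>commutant S\<close>.\<close>

lemma abelian_bicommutant:
  assumes comm: "S \<subseteq> commutant S" and star: "\<And>x. x \<in> S \<Longrightarrow> x\<^sup>\<star> \<in> S"
  shows "abelian_cstar_subalgebra (commutant (commutant S))"
  unfolding abelian_cstar_subalgebra_def
proof (intro conjI ballI)
  let ?E = "commutant (commutant S)"
  have sub: "commutant (commutant S) \<subseteq> commutant S"
    using comm by (auto simp: commutant_def)
  show "csubspace ?E"
    by (rule complex_vector.subspaceI)
      (auto simp: commutant_def algebra_simps mult_scaleC_left mult_scaleC_right)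
  have "?E = (\<Inter>s\<in>commutant S. {z. z * s = s * z})" by (auto simp: commutant_def)
  moreover have "closed \<dots>"
    by (intro closed_INT ballI closed_Collect_eq continuous_intros)
  ultimately show "closed ?E" by simp
  show "1 \<in> ?E" by (simp add: commutant_def)
  have star': "z\<^sup>\<star> \<in> commutant S" if z: "z \<in> commutant S" for z
    unfolding commutant_def
  proof (intro CollectI ballI)
    fix s assume "s \<in> S"
    then have "z * s\<^sup>\<star> = s\<^sup>\<star> * z" using z star by (auto simp: commutant_def)
    then have "(z * s\<^sup>\<star>)\<^sup>\<star> = (s\<^sup>\<star> * z)\<^sup>\<star>" by simp
    then show "z\<^sup>\<star> * s = s * z\<^sup>\<star>" by (simp add: star_mult)
  qed
  show "x\<^sup>\<star> \<in> ?E" if x: "x \<in> ?E" for x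
    unfolding commutant_def[of "commutant S"]
  proof (intro CollectI ballI)
    fix s assume "s \<in> commutant S"
    then have "x * s\<^sup>\<star> = s\<^sup>\<star> * x" using x star' by (auto simp: commutant_def[of "commutant S"])
    then have "(x * s\<^sup>\<star>)\<^sup>\<star> = (s\<^sup>\<star> * x)\<^sup>\<star>" by simp
    then show "x\<^sup>\<star> * s = s * x\<^sup>\<star>" by (simp add: star_mult)
  qed
  fix x y assume x: "x \<in> ?E" and y: "y \<in> ?E"
  show "x * y = y * x" using x y sub by (auto simp: commutant_def[of "commutant S"])
  show "x * y \<in> ?E"
    unfolding commutant_def[of "commutant S"]
  proof (intro CollectI ballI)
    fix s assume "s \<in> commutant S"
    then have "x * s = s * x" "y * s = s * y" using x y by (auto simp: commutant_def[of "commutant S"])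
    then show "x * y * s = s * (x * y)" by (metis mult.assoc)
  qed
qed

text \<open>Carries the estimate from \<open>D\<close> to self-adjoint elements anywhere, in
  particular to the real and imaginary parts of a normalizer.\<close>

lemma norm_diff_selfadjoint_square_le:
  fixes a :: "'a::unital_cstar_algebra"
  assumes a: "a\<^sup>\<star> = a" and t: "norm (a * a) < t"
  shows "norm (of_real t - a * a) \<le> t"
proof -
  interpret abelian_subalgebra "commutant (commutant {a})"
    by unfold_locales (rule abelian_bicommutant; use a in \<open>auto simp: commutant_def\<close>)
  show ?thesis using subset_bicommutant[of "{a}"] a t by (intro norm_diff_square_le) auto
qed

section \<open>Characters and the seminorm \<open>B\<^sub>\<sigma>\<close>\<close>

locale character = abelian_subalgebra D for D :: "'a::unital_cstar_algebra set" +
  fixes \<sigma> :: "'a \<Rightarrow> complex"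
  assumes \<sigma>: "\<sigma> \<in> characters D"
begin

lemma s_add: "x \<in> D \<Longrightarrow> y \<in> D \<Longrightarrow> \<sigma> (x + y) = \<sigma> x + \<sigma> y"
  and s_scaleC: "x \<in> D \<Longrightarrow> \<sigma> (c *\<^sub>C x) = c * \<sigma> x"
  and s_mult: "x \<in> D \<Longrightarrow> y \<in> D \<Longrightarrow> \<sigma> (x * y) = \<sigma> x * \<sigma> y"
  and s_extensional: "\<sigma> \<in> extensional D"
  using \<sigma> unfolding characters_def mem_Collect_eq by (simp_all only: simp_thms)

lemma s_one [simp]: "\<sigma> 1 = 1"
proof -
  obtain x where "x \<in> D" "\<sigma> x \<noteq> 0" using \<sigma> unfolding characters_def by auto
  then show ?thesis using s_mult[of 1 x] by simp
qed

lemma s_diff: "x \<in> D \<Longrightarrow> y \<in> D \<Longrightarrow> \<sigma> (x - y) = \<sigma> x - \<sigma> y"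
  using s_add[of x "- y"] s_scaleC[of y "-1"] by simp

lemma s_scaleR: "x \<in> D \<Longrightarrow> \<sigma> (r *\<^sub>R x) = of_real r * \<sigma> x"
  by (simp add: s_scaleC flip: scaleC_of_real)

lemma s_of_real [simp]: "\<sigma> (of_real r) = of_real r"
  using s_scaleR[of 1 r] by (simp add: of_real_def[where 'a = 'a])

text \<open>Otherwise \<open>1 - d / \<sigma> d\<close> would be invertible in \<open>D\<close>
  although \<open>\<sigma>\<close> vanishes on it.\<close>

lemma s_bound: assumes d: "d \<in> D" shows "cmod (\<sigma> d) \<le> norm d"
proof (rule ccontr)
  assume less: "\<not> cmod (\<sigma> d) \<le> norm d"
  then have nz: "\<sigma> d \<noteq> 0" by auto
  define y where "y = (1 / \<sigma> d) *\<^sub>C d"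
  have y: "y \<in> D" "\<sigma> y = 1" using d nz by (auto simp: y_def s_scaleC)
  have "norm y < 1" using less nz by (simp add: y_def norm_scaleC norm_divide divide_simps)
  then obtain r where r: "r \<in> D" "(1 - y) * r = 1"
    using neumann_inverse[OF D_closed D_zero, of y] y by auto
  have "\<sigma> ((1 - y) * r) = (\<sigma> 1 - \<sigma> y) * \<sigma> r"
    using y r(1) by (simp only: s_mult s_diff D_diff D_one)
  then show False using r y by simp
qed

text \<open>Adding \<open>\<i> t\<close> to \<open>h\<close> raises the squared norm by at most t^2,
  but raises the squared modulus of the value by t^2 plus a term linear in \<open>t\<close>; for
  suitable \<open>t\<close> this is impossible unless the imaginary part vanishes.\<close>

lemma s_selfadjoint_real: assumes h: "h \<in> D" "h\<^sup>\<star> = h" shows "Im (\<sigma> h) = 0"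
proof (rule ccontr)
  assume b: "Im (\<sigma> h) \<noteq> 0"
  have ineq: "2 * Im (\<sigma> h) * t \<le> (norm h)\<^sup>2" for t
  proof -
    define x where "x = h + (\<i> * of_real t) *\<^sub>C 1"
    have "x\<^sup>\<star> * x = h * h + (t * t) *\<^sub>R 1"
      using h by (simp add: x_def star_add star_scaleC algebra_simps mult_scaleC_left
          mult_scaleC_right flip: scaleC_of_real)
    then have "(norm x)\<^sup>2 \<le> norm (h * h) + t * t"
      unfolding cstar_identity[symmetric] using norm_triangle_ineq[of "h * h" "(t * t) *\<^sub>R 1"] by simp
    then have "(norm x)\<^sup>2 \<le> (norm h)\<^sup>2 + t * t" using norm_selfadjoint_square[OF h(2)] by simp
    moreover have "x \<in> D" using h by (simp add: x_def)
    then have "(cmod (\<sigma> x))\<^sup>2 \<le> (norm x)\<^sup>2" by (intro power_mono s_bound) auto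
    moreover have "\<sigma> x = \<sigma> h + \<i> * of_real t" using h by (simp add: x_def s_add s_scaleC)
    then have "(cmod (\<sigma> x))\<^sup>2 = (Re (\<sigma> h))\<^sup>2 + (Im (\<sigma> h) + t)\<^sup>2" by (simp add: cmod_power2)
    moreover have "(Im (\<sigma> h) + t)\<^sup>2 = (Im (\<sigma> h))\<^sup>2 + 2 * Im (\<sigma> h) * t + t * t"
      by (simp add: power2_eq_square algebra_simps)
    ultimately show ?thesis
      using zero_le_power2[of "Re (\<sigma> h)"] zero_le_power2[of "Im (\<sigma> h)"] by linarith
  qed
  have "2 * Im (\<sigma> h) * (((norm h)\<^sup>2 + 1) / (2 * Im (\<sigma> h))) = (norm h)\<^sup>2 + 1"
    using b by (simp add: field_simps)
  then show False using ineq[of "((norm h)\<^sup>2 + 1) / (2 * Im (\<sigma> h))"] by linarith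
qed

text \<open>The ball condition at \<open>t = norm h\<close> puts \<open>\<sigma> h\<close> in the
  disc of radius \<open>norm h\<close> about \<open>norm h\<close>, hence in the right half
  plane.\<close>

lemma s_pos: assumes h: "pos h" shows "0 \<le> Re (\<sigma> h)" "Im (\<sigma> h) = 0"
proof -
  have "cmod (\<sigma> (of_real (norm h) - h)) \<le> norm h"
    using s_bound[of "of_real (norm h) - h"] pos_norm[OF h order.refl] pos_D[OF h] by (metis D_diff D_of_real order.trans)
  then have "cmod (of_real (norm h) - \<sigma> h) \<le> norm h" using pos_D[OF h] by (simp add: s_diff)
  then have "Re (of_real (norm h) - \<sigma> h) \<le> norm h" using complex_Re_le_cmod order.trans by blast
  then show "0 \<le> Re (\<sigma> h)" by simp
  show "Im (\<sigma> h) = 0" using h by (intro s_selfadjoint_real pos_D pos_star)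
qed

lemma s_star: assumes a: "a \<in> D" shows "\<sigma> (a\<^sup>\<star>) = cnj (\<sigma> a)"
proof -
  obtain b c where bc: "b \<in> D" "c \<in> D" "b\<^sup>\<star> = b" "c\<^sup>\<star> = c" "a = b + \<i> *\<^sub>C c"
    using real_imaginary_parts[of a] a by (metis D_add D_diff D_scaleC D_scaleR D_star)
  have "cnj (\<sigma> b) = \<sigma> b" "cnj (\<sigma> c) = \<sigma> c"
    using s_selfadjoint_real bc by (auto simp: complex_eq_iff)
  moreover have "a\<^sup>\<star> = b + (- \<i>) *\<^sub>C c" using bc by (simp add: star_add star_scaleC)
  ultimately show ?thesis using bc by (simp add: s_add s_scaleC s_diff)
qed

text \<open>The approximate units are \<open>k = (1 + N a\<^sup>* a)\<^sup>-\<^sup>1\<close> with \<open>N\<close> large.\<close>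

lemma local_unit:
  assumes a: "a \<in> D" "\<sigma> a = 0" and \<epsilon>: "0 < \<epsilon>"
  obtains k where "k \<in> D" "k\<^sup>\<star> = k" "\<sigma> k = 1" "norm k \<le> 1" "norm (a * k) \<le> \<epsilon>" "norm (k * a) \<le> \<epsilon>"
proof -
  \<comment> \<open>The element \<open>(a * k)\<^sup>\<star> * (a * k)\<close> equals
    \<open>k * (1 - k) / N\<close> and has norm at most \<open>1 / N\<close>, which is the square of
    the desired bound.\<close>
  define N where "N = 1 / \<epsilon>\<^sup>2"
  have N: "0 < N" using \<epsilon> by (simp add: N_def)
  define q where "q = a\<^sup>\<star> * a"
  have q: "pos q" "q \<in> D" using pos_star_mult a by (auto simp: q_def)
  have "pos (1 + N *\<^sub>R q - of_real 1)" using pos_scaleR[OF q(1), of N] N by simp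
  then obtain k where k: "pos k" "k * (1 + N *\<^sub>R q) = 1" "(1 + N *\<^sub>R q) * k = 1"
    using pos_inverse zero_less_one by blast
  have kD: "k \<in> D" "k\<^sup>\<star> = k" using k by (auto simp: pos_D pos_star)
  have qk: "1 - k = N *\<^sub>R (q * k)" using k(3) by (simp add: algebra_simps)
  have "pos (of_real 1 - k)" unfolding of_real_1 qk using q k N by (intro pos_scaleR pos_mult) auto
  then have nk: "norm k \<le> 1" using k by (intro pos_norm_le) auto
  then have n1k: "norm (1 - k) \<le> 1" using pos_norm[OF k(1), of 1] by simp
  have "\<sigma> (1 + N *\<^sub>R q) = 1" using a by (simp add: s_add s_scaleR s_mult q_def)
  then have sk: "\<sigma> k = 1" using s_mult[of k "1 + N *\<^sub>R q"] k kD q by simp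
  have "(a * k)\<^sup>\<star> * (a * k) = k * (q * k)" using kD by (simp add: star_mult q_def mult.assoc)
  also have "\<dots> = (1 / N) *\<^sub>R (k * (1 - k))" unfolding qk using N by simp
  finally have "(norm (a * k))\<^sup>2 = (1 / N) * norm (k * (1 - k))"
    using N by (simp flip: cstar_identity)
  also have "\<dots> \<le> (1 / N) * 1"
    using norm_mult_le_one_left[OF nk, of "1 - k"] n1k N by (intro mult_left_mono) auto
  finally have "(norm (a * k))\<^sup>2 \<le> \<epsilon>\<^sup>2" by (simp add: N_def)
  then have "norm (a * k) \<le> \<epsilon>" using \<epsilon> by (simp add: power2_le_iff_abs_le)
  then show thesis using that[of k] kD sk nk a D_comm by metis
qed

section \<open>The seminorm: contractive cut-downs, subadditivity and its null elements\<close>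

abbreviation B :: "'a \<Rightarrow> real" where "B \<equiv> B_seminorm D \<sigma>"

lemma B_le: "d \<in> D \<Longrightarrow> e \<in> D \<Longrightarrow> \<sigma> d = 1 \<Longrightarrow> \<sigma> e = 1 \<Longrightarrow> B x \<le> norm (d * x * e)"
  unfolding B_seminorm_def by (rule cInf_lower) (auto intro!: bdd_belowI[where m = 0])

lemma B_greatest: "(\<And>d e. d \<in> D \<Longrightarrow> e \<in> D \<Longrightarrow> \<sigma> d = 1 \<Longrightarrow> \<sigma> e = 1 \<Longrightarrow> c \<le> norm (d * x * e)) \<Longrightarrow> c \<le> B x"
  unfolding B_seminorm_def by (rule cInf_greatest) (use D_one s_one in \<open>blast+\<close>)

lemma B_nonneg [simp]: "0 \<le> B x"
  by (rule B_greatest) simp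

lemma B_le_norm: "B x \<le> norm x"
  using B_le[of 1 1 x] by simp

lemma B_le_zeroI: "(\<And>\<epsilon>. 0 < \<epsilon> \<Longrightarrow> B x \<le> \<epsilon>) \<Longrightarrow> B x = 0"
  by (meson B_nonneg field_le_epsilon antisym add_0 le_add_same_cancel1 dense_ge)

text \<open>The infimum allows \<open>d\<close> and \<open>e\<close> of any norm, and such cut-downs
  cannot be combined without losing control. Local units absorbing \<open>1 - d\<close> and
  \<open>1 - e\<close> replace both by a single contraction.\<close>

lemma B_less_obtain:
  assumes "B x < c"
  obtains k where "k \<in> D" "\<sigma> k = 1" "norm k \<le> 1" "norm (k * x * k) < c"
proof -
  obtain d e where de: "d \<in> D" "e \<in> D" "\<sigma> d = 1" "\<sigma> e = 1" "norm (d * x * e) < c"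
    using assms B_greatest[of c x] by (meson not_le)
  \<comment> \<open>The errors below amount to \<open>\<eta> * norm x\<close> and
    \<open>2 * \<eta> * norm x\<close>, the 2 coming from
    \<open>norm (k * d) \<le> 1 + \<eta>\<close>. The larger factor 4 leaves room for a strict
    inequality, and the added 1 avoids division by zero.\<close>
  define \<eta> where "\<eta> = min 1 ((c - norm (d * x * e)) / (4 * (norm x + 1)))"
  have \<eta>: "0 < \<eta>" "\<eta> \<le> 1" using de(5) by (auto simp: \<eta>_def intro!: divide_pos_pos add_nonneg_pos)
  have "\<eta> * (4 * (norm x + 1)) \<le> c - norm (d * x * e)"
    by (subst pos_le_divide_eq[symmetric]) (simp_all add: \<eta>_def add_nonneg_pos)
  then have \<eta>c: "norm (d * x * e) + 3 * \<eta> * norm x < c"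
  proof -
    have "\<eta> * (4 * (norm x + 1)) = 4 * (\<eta> * norm x) + 4 * \<eta>" "3 * \<eta> * norm x = 3 * (\<eta> * norm x)"
      by (simp_all add: algebra_simps)
    moreover have "0 \<le> \<eta> * norm x" using \<eta> by simp
    ultimately show ?thesis using \<open>\<eta> * _ \<le> c - _\<close> \<eta>(1) by linarith
  qed
  obtain k where k: "k \<in> D" "\<sigma> k = 1" "norm k \<le> 1" "norm (k * (1 - d)) \<le> \<eta>"
    using local_unit[of "1 - d" \<eta>] de \<eta> by (auto simp: s_diff)
  obtain l where l: "l \<in> D" "\<sigma> l = 1" "norm l \<le> 1" "norm ((1 - e) * l) \<le> \<eta>"
    using local_unit[of "1 - e" \<eta>] de \<eta> by (auto simp: s_diff)
  have "norm (k * d) = norm (k - k * (1 - d))" by (simp add: algebra_simps)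
  also have "\<dots> \<le> norm k + norm (k * (1 - d))" by (rule norm_triangle_ineq4)
  finally have kd: "norm (k * d) \<le> 2" using k \<eta> by linarith
  have 1: "norm (k * (1 - d) * x * l) \<le> \<eta> * norm x"
    using norm_mult_le_one_right[OF l(3), of "k * (1 - d) * x"] norm_mult_ineq[of "k * (1 - d)" x]
      mult_right_mono[OF k(4) norm_ge_zero[of x]] by linarith
  have "norm (k * d * x) \<le> 2 * norm x"
    using norm_mult_ineq[of "k * d" x] mult_right_mono[OF kd norm_ge_zero[of x]] by linarith
  then have 2: "norm (k * d * x * ((1 - e) * l)) \<le> (2 * norm x) * \<eta>"
    by (rule order.trans[OF norm_mult_ineq mult_mono]) (use l(4) \<eta> in auto)
  have 3: "norm (k * (d * x * e) * l) \<le> norm (d * x * e)"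
    using norm_mult_le_one_right[OF l(3)] norm_mult_le_one_left[OF k(3)] by (metis order.trans)
  have "k * x * l = k * (1 - d) * x * l + (k * d * x * ((1 - e) * l) + k * (d * x * e) * l)"
    by (simp add: algebra_simps)
  then have "norm (k * x * l) \<le> \<eta> * norm x + ((2 * norm x) * \<eta> + norm (d * x * e))"
    using 1 2 3 by (metis norm_triangle_mono)
  then have less: "norm (k * x * l) < c" using \<eta>c by (simp add: algebra_simps)
  have "norm (l * k) \<le> 1" using norm_mult_le_one_left[OF l(3), of k] k(3) by linarith
  moreover have "l * k * x * (l * k) = l * (k * x * l) * k" by (simp add: mult.assoc)
  then have "norm (l * k * x * (l * k)) < c"
    using less norm_mult_le_one_right[OF k(3), of "l * (k * x * l)"]
      norm_mult_le_one_left[OF l(3), of "k * x * l"] by simp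
  ultimately show thesis using that[of "l * k"] k l by (simp add: s_mult)
qed

text \<open>The cut-downs \<open>k\<close> and \<open>l\<close> commute and are contractive, so
  \<open>k * l\<close> cuts down each summand at least as well as its own.\<close>

lemma B_triangle: "B (x + y) \<le> B x + B y"
proof (rule field_le_epsilon)
  fix e :: real assume e: "0 < e"
  obtain k where k: "k \<in> D" "\<sigma> k = 1" "norm k \<le> 1" "norm (k * x * k) < B x + e / 2"
    using B_less_obtain[of x "B x + e / 2"] e by auto
  obtain l where l: "l \<in> D" "\<sigma> l = 1" "norm l \<le> 1" "norm (l * y * l) < B y + e / 2"
    using B_less_obtain[of y "B y + e / 2"] e by auto
  have kl: "k * l = l * k" using D_comm k l by blast
  have "k * l * x * (k * l) = l * (k * x * k) * l" "k * l * y * (k * l) = k * (l * y * l) * k"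
    using kl by (metis mult.assoc)+
  then have "norm (k * l * x * (k * l)) \<le> norm (k * x * k)" "norm (k * l * y * (k * l)) \<le> norm (l * y * l)"
    using norm_mult_le_one_right norm_mult_le_one_left k l by (metis order.trans)+
  moreover have "k * l * (x + y) * (k * l) = k * l * x * (k * l) + k * l * y * (k * l)"
    by (simp add: algebra_simps)
  then have "norm (k * l * (x + y) * (k * l)) \<le> norm (k * l * x * (k * l)) + norm (k * l * y * (k * l))"
    using norm_triangle_ineq by metis
  moreover have "B (x + y) \<le> norm (k * l * (x + y) * (k * l))"
    using k l by (intro B_le) (auto simp: s_mult)
  ultimately show "B (x + y) \<le> B x + B y + e" using k l by linarith
qed

lemma B_zero [simp]: "B 0 = 0"
  using B_le_norm[of 0] B_nonneg[of 0] by simp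

lemma B_scaleC: "B (c *\<^sub>C x) = cmod c * B x"
proof -
  have le: "B (c *\<^sub>C x) \<le> cmod c * B x" for c x
  proof (rule dense_ge)
    fix b assume b: "cmod c * B x < b"
    show "B (c *\<^sub>C x) \<le> b"
    proof (cases "c = 0")
      case False
      then have "B x < b / cmod c" using b by (simp add: pos_less_divide_eq mult.commute)
      then obtain k where k: "k \<in> D" "\<sigma> k = 1" "norm (k * x * k) < b / cmod c"
        using B_less_obtain by blast
      have "B (c *\<^sub>C x) \<le> norm (k * (c *\<^sub>C x) * k)" using k by (intro B_le)
      also have "\<dots> = cmod c * norm (k * x * k)"
        by (simp add: mult_scaleC_left mult_scaleC_right norm_scaleC)
      finally show ?thesis using k(3) False by (simp add: pos_less_divide_eq mult.commute)
    qed (use b in simp)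
  qed
  show ?thesis
  proof (cases "c = 0")
    case False
    have "B x \<le> cmod (1 / c) * B (c *\<^sub>C x)" using le[of "1 / c" "c *\<^sub>C x"] False by simp
    then have "cmod c * B x \<le> B (c *\<^sub>C x)" using False by (simp add: norm_divide field_simps)
    then show ?thesis using le[of c x] by simp
  qed simp
qed

lemma B_minus [simp]: "B (- x) = B x"
  using B_scaleC[of "-1" x] by simp

lemma B_minus_commute: "B (x - y) = B (y - x)"
  using B_minus[of "x - y"] by simp

lemma B_diff_triangle: "B (x - z) \<le> B (x - y) + B (y - z)"
  using B_triangle[of "x - y" "y - z"] by simp

lemma B_eqI: "B (x - y) = 0 \<Longrightarrow> B x = B y"
  using B_triangle[of y "x - y"] B_triangle[of x "y - x"] B_minus_commute[of x y] by simp

lemma B_add_zero: "B x = 0 \<Longrightarrow> B y = 0 \<Longrightarrow> B (x + y) = 0"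
  using B_triangle[of x y] B_nonneg[of "x + y"] by linarith

lemma B_sum_le: "B (\<Sum>i\<in>I. f i) \<le> (\<Sum>i\<in>I. B (f i))"
proof (induction I rule: infinite_finite_induct)
  case (insert i I)
  then show ?case using B_triangle[of "f i" "\<Sum>i\<in>I. f i"] by simp
qed auto

lemma B_star [simp]: "B (x\<^sup>\<star>) = B x"
proof -
  have le: "B (x\<^sup>\<star>) \<le> B x" for x
  proof (rule B_greatest)
    fix d e assume de: "d \<in> D" "e \<in> D" "\<sigma> d = 1" "\<sigma> e = 1"
    then have "B (x\<^sup>\<star>) \<le> norm (e\<^sup>\<star> * x\<^sup>\<star> * d\<^sup>\<star>)" by (intro B_le) (auto simp: s_star)
    also have "e\<^sup>\<star> * x\<^sup>\<star> * d\<^sup>\<star> = (d * x * e)\<^sup>\<star>" by (simp add: star_mult mult.assoc)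
    finally show "B (x\<^sup>\<star>) \<le> norm (d * x * e)" by simp
  qed
  show ?thesis using le[of x] le[of "x\<^sup>\<star>"] by simp
qed

lemma B_mult_zero_left:
  assumes "\<And>\<epsilon>. 0 < \<epsilon> \<Longrightarrow> \<exists>k\<in>D. \<sigma> k = 1 \<and> norm (k * y) \<le> \<epsilon>"
  shows "B (y * x) = 0"
proof (rule B_le_zeroI)
  fix \<epsilon> :: real assume \<epsilon>: "0 < \<epsilon>"
  define \<delta> where "\<delta> = \<epsilon> / (norm x + 1)"
  have nx: "0 < norm x + 1" using norm_ge_zero[of x] by linarith
  have "0 < \<delta>" using \<epsilon> nx by (simp add: \<delta>_def)
  then obtain k where k: "k \<in> D" "\<sigma> k = 1" "norm (k * y) \<le> \<delta>" using assms by blast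
  have "B (y * x) \<le> norm (k * (y * x) * 1)" using k by (intro B_le) auto
  also have "\<dots> \<le> norm (k * y) * norm x" using norm_mult_ineq[of "k * y" x] by (simp add: mult.assoc)
  also have "\<dots> \<le> \<delta> * norm x" using k by (intro mult_right_mono) auto
  also have "\<dots> \<le> \<delta> * (norm x + 1)" using \<open>0 < \<delta>\<close> by (intro mult_left_mono) auto
  also have "\<dots> = \<epsilon>" using nx by (simp add: \<delta>_def)
  finally show "B (y * x) \<le> \<epsilon>" .
qed

lemma B_ker_left: "a \<in> D \<Longrightarrow> \<sigma> a = 0 \<Longrightarrow> B (a * x) = 0"
  by (rule B_mult_zero_left) (metis local_unit)

lemma B_ker_right: "a \<in> D \<Longrightarrow> \<sigma> a = 0 \<Longrightarrow> B (x * a) = 0"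
  using B_ker_left[of "a\<^sup>\<star>" "x\<^sup>\<star>"] B_star[of "x * a"] by (simp add: star_mult s_star)

lemma B_scale_left: assumes "d \<in> D" shows "B (d * x - \<sigma> d *\<^sub>C x) = 0"
proof -
  have "d * x - \<sigma> d *\<^sub>C x = (d - \<sigma> d *\<^sub>C 1) * x" by (simp add: left_diff_distrib mult_scaleC_left)
  then show ?thesis using assms by (simp add: B_ker_left s_diff s_scaleC)
qed

lemma B_scale_right: assumes "d \<in> D" shows "B (x * d - \<sigma> d *\<^sub>C x) = 0"
proof -
  have "x * d - \<sigma> d *\<^sub>C x = x * (d - \<sigma> d *\<^sub>C 1)" by (simp add: right_diff_distrib mult_scaleC_right)
  then show ?thesis using assms by (simp add: B_ker_right s_diff s_scaleC)
qed

lemma B_one: "B 1 = 1"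
proof (rule antisym)
  show "1 \<le> B 1"
  proof (rule B_greatest)
    fix d e assume "d \<in> D" "e \<in> D" "\<sigma> d = 1" "\<sigma> e = 1"
    then show "1 \<le> norm (d * 1 * e)" using s_bound[of "d * e"] by (simp add: s_mult)
  qed
qed (use B_le_norm[of 1] in simp)

section \<open>Normalizers\<close>

abbreviation "N \<equiv> normalizers D"
abbreviation "H \<equiv> H_set D \<sigma>"

lemma N_D: "v \<in> N \<Longrightarrow> d \<in> D \<Longrightarrow> v\<^sup>\<star> * d * v \<in> D" "v \<in> N \<Longrightarrow> d \<in> D \<Longrightarrow> v * d * v\<^sup>\<star> \<in> D"
  by (auto simp: normalizers_def)

lemma N_D_one: "v \<in> N \<Longrightarrow> v\<^sup>\<star> * v \<in> D" "v \<in> N \<Longrightarrow> v * v\<^sup>\<star> \<in> D"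
  using N_D[of v 1] by auto

lemma N_star: "v \<in> N \<Longrightarrow> v\<^sup>\<star> \<in> N"
  by (auto simp: normalizers_def)

lemma N_mult: assumes v: "v \<in> N" and w: "w \<in> N" shows "v * w \<in> N"
  unfolding normalizers_def
proof (intro CollectI ballI conjI)
  fix d assume d: "d \<in> D"
  show "(v * w)\<^sup>\<star> * d * (v * w) \<in> D" using N_D(1)[OF w N_D(1)[OF v d]] by (simp add: star_mult mult.assoc)
  show "(v * w) * d * (v * w)\<^sup>\<star> \<in> D" using N_D(2)[OF v N_D(2)[OF w d]] by (simp add: star_mult mult.assoc)
qed

lemma D_N: "d \<in> D \<Longrightarrow> d \<in> N"
  by (simp add: normalizers_def)

lemma N_scaleC: "v \<in> N \<Longrightarrow> c *\<^sub>C v \<in> N"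
  by (auto simp: normalizers_def star_scaleC mult_scaleC_left mult_scaleC_right)

lemma H_N: "v \<in> H \<Longrightarrow> v \<in> N" and H_s: "v \<in> H \<Longrightarrow> d \<in> D \<Longrightarrow> \<sigma> (v\<^sup>\<star> * d * v) = \<sigma> d"
  by (auto simp: H_set_def)

lemma H_s_one: "v \<in> H \<Longrightarrow> \<sigma> (v\<^sup>\<star> * v) = 1"
  using H_s[of v 1] by simp

lemma H_mult: assumes v: "v \<in> H" and w: "w \<in> H" shows "v * w \<in> H"
  unfolding H_set_def
proof (intro CollectI conjI ballI)
  fix d assume d: "d \<in> D"
  show "\<sigma> ((v * w)\<^sup>\<star> * d * (v * w)) = \<sigma> d"
    using H_s[OF w N_D(1)[OF H_N[OF v] d]] H_s[OF v d] by (simp add: star_mult mult.assoc)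
qed (use v w H_N N_mult in blast)

lemma H_star: assumes v: "v \<in> H" shows "v\<^sup>\<star> \<in> H"
  unfolding H_set_def
proof (intro CollectI conjI ballI)
  fix d assume d: "d \<in> D"
  have vD: "v * d * v\<^sup>\<star> \<in> D" "v\<^sup>\<star> * v \<in> D" using N_D N_D_one H_N v d by blast+
  have "\<sigma> (v * d * v\<^sup>\<star>) = \<sigma> (v\<^sup>\<star> * (v * d * v\<^sup>\<star>) * v)" using H_s[OF v vD(1)] by simp
  also have "v\<^sup>\<star> * (v * d * v\<^sup>\<star>) * v = (v\<^sup>\<star> * v) * d * (v\<^sup>\<star> * v)" by (simp add: mult.assoc)
  also have "\<sigma> \<dots> = \<sigma> d" using vD d H_s_one[OF v] by (simp add: s_mult)
  finally show "\<sigma> ((v\<^sup>\<star>)\<^sup>\<star> * d * v\<^sup>\<star>) = \<sigma> d" by simp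
qed (use v H_N N_star in blast)

lemma H_D: assumes "d \<in> D" "cmod (\<sigma> d) = 1" shows "d \<in> H"
  using assms complex_norm_square[of "\<sigma> d"] D_N
  by (auto simp: H_set_def s_mult s_star mult.commute)

lemma H_one [simp]: "1 \<in> H"
  by (rule H_D) auto

lemma H_scaleC: assumes "v \<in> H" "cmod z = 1" shows "z *\<^sub>C v \<in> H"
  using H_mult[OF H_D[of "z *\<^sub>C 1"] assms(1)] assms(2) by (simp add: s_scaleC mult_scaleC_left)

section \<open>Invariance of the seminorm under \<open>H\<close>\<close>

lemma H_s_one': "v \<in> H \<Longrightarrow> \<sigma> (v * v\<^sup>\<star>) = 1"
  using H_s_one[OF H_star] by simp

text \<open>A local unit for an element outside \<open>D\<close>: the squared norm of
  \<open>k * y\<close> is the norm of \<open>k * (y * y\<^sup>\<star>) * k\<close>, and the middle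
  factor lies in the kernel of \<open>\<sigma>\<close>.\<close>

lemma small_left:
  assumes y: "y * y\<^sup>\<star> \<in> D" "\<sigma> (y * y\<^sup>\<star>) = 0" and \<epsilon>: "0 < \<epsilon>"
  obtains k where "k \<in> D" "\<sigma> k = 1" "norm (k * y) \<le> \<epsilon>"
proof -
  obtain k where k: "k \<in> D" "k\<^sup>\<star> = k" "\<sigma> k = 1" "norm k \<le> 1" "norm (k * (y * y\<^sup>\<star>)) \<le> \<epsilon>\<^sup>2"
    using local_unit[OF y, of "\<epsilon>\<^sup>2"] \<epsilon> by auto
  have "(norm (k * y))\<^sup>2 = norm ((k * y) * (k * y)\<^sup>\<star>)" by (rule norm_mult_star[symmetric])
  also have "(k * y) * (k * y)\<^sup>\<star> = k * (y * y\<^sup>\<star>) * k" using k by (simp add: star_mult mult.assoc)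
  also have "norm \<dots> \<le> \<epsilon>\<^sup>2" using norm_mult_le_one_right[OF k(4)] k(5) order.trans by blast
  finally have "norm (k * y) \<le> \<epsilon>" using \<epsilon> by (simp add: power2_le_iff_abs_le)
  then show thesis using that k by blast
qed

lemma B_small_left: "y * y\<^sup>\<star> \<in> D \<Longrightarrow> \<sigma> (y * y\<^sup>\<star>) = 0 \<Longrightarrow> B (y * x) = 0"
  by (rule B_mult_zero_left) (metis small_left)

lemma B_small_right: "y\<^sup>\<star> * y \<in> D \<Longrightarrow> \<sigma> (y\<^sup>\<star> * y) = 0 \<Longrightarrow> B (x * y) = 0"
  using B_small_left[of "y\<^sup>\<star>" "x\<^sup>\<star>"] B_star[of "x * y"] by (simp add: star_mult)

text \<open>An element of \<open>H\<close> may have large norm, but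
  \<open>\<sigma> (v * v\<^sup>\<star>) = 1\<close> makes the norm of \<open>k * v\<close> at most
  \<open>1 + \<epsilon>\<close> for a suitable local unit \<open>k\<close>. This bounds
  \<open>B (v * z)\<close> by \<open>norm z\<close>; it is then applied to a cut-down
  \<open>k * x * k\<close> whose norm is close to \<open>B x\<close>.\<close>

lemma B_H_left_le: assumes v: "v \<in> H" shows "B (v * x) \<le> B x"
proof -
  have vv: "v * v\<^sup>\<star> \<in> D" "\<sigma> (v * v\<^sup>\<star>) = 1" using v N_D_one H_N H_s_one' by auto
  have bound: "B (v * z) \<le> norm z" for z
  proof -
    have le: "B (v * z) \<le> (1 + \<epsilon>) * norm z" if \<epsilon>: "0 < \<epsilon>" for \<epsilon>
    proof -
      obtain k where k: "k \<in> D" "k\<^sup>\<star> = k" "\<sigma> k = 1" "norm k \<le> 1" "norm (k * (v * v\<^sup>\<star> - 1)) \<le> \<epsilon>"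
        using local_unit[of "v * v\<^sup>\<star> - 1" \<epsilon>] vv \<epsilon> by (auto simp: s_diff)
      have "(k * v) * (k * v)\<^sup>\<star> = k * (v * v\<^sup>\<star> - 1) * k + k * k"
        using k by (simp add: star_mult algebra_simps)
      then have "(norm (k * v))\<^sup>2 \<le> norm (k * (v * v\<^sup>\<star> - 1) * k) + norm (k * k)"
        by (metis norm_mult_star norm_triangle_ineq)
      also have "\<dots> \<le> \<epsilon> + 1"
        using k norm_mult_le_one_right[OF k(4), of k] norm_mult_le_one_right[OF k(4), of "k * (v * v\<^sup>\<star> - 1)"]
        by linarith
      also have "\<dots> \<le> (1 + \<epsilon>)\<^sup>2" using \<epsilon> by (simp add: power2_eq_square algebra_simps)
      finally have kv: "norm (k * v) \<le> 1 + \<epsilon>" using \<epsilon> by (simp add: power2_le_iff_abs_le)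
      have "B (v * z) \<le> norm (k * (v * z) * 1)" using k by (intro B_le) auto
      also have "\<dots> \<le> norm (k * v) * norm z" using norm_mult_ineq[of "k * v" z] by (simp add: mult.assoc)
      also have "\<dots> \<le> (1 + \<epsilon>) * norm z" using kv by (intro mult_right_mono) auto
      finally show ?thesis .
    qed
    have "((\<lambda>\<epsilon>. (1 + \<epsilon>) * norm z) \<longlongrightarrow> (1 + 0) * norm z) (at_right 0)"
      by (intro tendsto_intros)
    moreover have "eventually (\<lambda>\<epsilon>. B (v * z) \<le> (1 + \<epsilon>) * norm z) (at_right 0)"
      using le by (simp add: eventually_at_filter)
    ultimately show ?thesis
      using tendsto_lowerbound[of "\<lambda>\<epsilon>. (1 + \<epsilon>) * norm z" "(1 + 0) * norm z" "at_right 0" "B (v * z)"] by simp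
  qed
  show ?thesis
  proof (rule dense_ge)
    fix c assume "B x < c"
    then obtain k where k: "k \<in> D" "\<sigma> k = 1" "norm k \<le> 1" "norm (k * x * k) < c"
      using B_less_obtain by blast
    \<comment> \<open>The products of \<open>v\<close> with \<open>x\<close> and with
      \<open>k * x * k\<close> differ by \<open>v * a * x + v * k * x * a\<close>. The first term
      has \<open>a\<close> on the far side of \<open>v\<close>; it is null because
      \<open>\<sigma> (v * d * v\<^sup>\<star>) = \<sigma> d\<close> puts
      \<open>v * a * (v * a)\<^sup>\<star>\<close> in the kernel of \<open>\<sigma>\<close>.\<close>
    define a where "a = 1 - k"
    have a: "a \<in> D" "\<sigma> a = 0" using k by (auto simp: a_def s_diff)
    have eq: "v * a * (v * a)\<^sup>\<star> = v * (a * a\<^sup>\<star>) * v\<^sup>\<star>" by (simp add: star_mult mult.assoc)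
    have "v * (a * a\<^sup>\<star>) * v\<^sup>\<star> \<in> D" "\<sigma> (v * (a * a\<^sup>\<star>) * v\<^sup>\<star>) = 0"
      using a N_D(2)[OF H_N[OF v]] H_s[OF H_star[OF v], of "a * a\<^sup>\<star>"] by (auto simp: s_mult)
    then have "B (v * a * x) = 0" by (intro B_small_left) (simp_all add: eq)
    moreover have "B (v * k * x * a) = 0" using a by (rule B_ker_right)
    ultimately have "B (v * a * x + v * k * x * a) = 0" by (rule B_add_zero)
    moreover have "v * a * x + v * k * x * a = v * x - v * (k * x * k)"
      by (simp add: a_def algebra_simps)
    ultimately have "B (v * x) = B (v * (k * x * k))" using B_eqI by metis
    then show "B (v * x) \<le> c" using bound[of "k * x * k"] k(4) by linarith
  qed
qed

text \<open>As \<open>v\<^sup>\<star> * v\<close> acts as the scalar 1 up to null elements,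
  \<open>v\<^sup>\<star>\<close> undoes \<open>v\<close> and the inequality becomes an
  equality.\<close>

lemma B_H_left [simp]: assumes v: "v \<in> H" shows "B (v * x) = B x"
proof -
  have "B (v\<^sup>\<star> * v * x - \<sigma> (v\<^sup>\<star> * v) *\<^sub>C x) = 0" using v N_D_one H_N by (intro B_scale_left) auto
  then have "B (v\<^sup>\<star> * (v * x)) = B x" using H_s_one[OF v] by (simp add: B_eqI mult.assoc)
  then show ?thesis using B_H_left_le[OF v, of x] B_H_left_le[OF H_star[OF v], of "v * x"] by linarith
qed

lemma B_H_right [simp]: "v \<in> H \<Longrightarrow> B (x * v) = B x"
  using B_H_left[OF H_star, of v "x\<^sup>\<star>"] B_star[of "x * v"] by (simp add: star_mult)

lemma B_H: "v \<in> H \<Longrightarrow> B v = 1"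
  using B_H_left[of v 1] B_one by simp

text \<open>Multiplication by \<open>w\<close> preserves \<open>B\<close>, and
  \<open>w * w\<^sup>\<star>\<close> acts as the scalar 1. In this symmetric form the relation is
  that of distance zero, so the equivalence laws are those of a seminorm.\<close>

lemma R1_iff: "(v, w) \<in> R1 D \<sigma> \<longleftrightarrow> v \<in> H \<and> w \<in> H \<and> B (v - w) = 0"
proof -
  have "B (1 - w\<^sup>\<star> * v) = B (v - w)" if v: "v \<in> H" and w: "w \<in> H"
  proof -
    have ww: "w * w\<^sup>\<star> \<in> D" "\<sigma> (w * w\<^sup>\<star>) = 1" using w N_D_one H_N H_s_one' by auto
    have "B (1 - w\<^sup>\<star> * v) = B (w * (1 - w\<^sup>\<star> * v))" using w by simp
    also have "\<dots> = B (w - v)"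
    proof (rule B_eqI)
      have eq: "w * (1 - w\<^sup>\<star> * v) - (w - v) = - (w * w\<^sup>\<star> * v - \<sigma> (w * w\<^sup>\<star>) *\<^sub>C v)"
        unfolding ww(2) by (simp add: algebra_simps)
      show "B (w * (1 - w\<^sup>\<star> * v) - (w - v)) = 0"
        unfolding eq B_minus by (rule B_scale_left[OF ww(1)])
    qed
    finally show ?thesis by (simp add: B_minus_commute)
  qed
  then show ?thesis by (auto simp: R1_def)
qed

text \<open>For \<open>v = a + \<i> b\<close> the sum is 2(a^2 + b^2). The squares need not lie in
  \<open>D\<close>, but each satisfies the ball estimate; adding these gives the ball estimate for
  the sum, which does lie in \<open>D\<close>.\<close>

lemma N_sum_pos: assumes v: "v \<in> N" shows "pos (v\<^sup>\<star> * v + v * v\<^sup>\<star>)"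
proof -
  obtain a b where ab: "a\<^sup>\<star> = a" "b\<^sup>\<star> = b" "v = a + \<i> *\<^sub>C b"
    using real_imaginary_parts by metis
  define p where "p = 2 *\<^sub>R (a * a + b * b)"
  have vs: "v\<^sup>\<star> = a - \<i> *\<^sub>C b" using ab by (simp add: star_add star_scaleC)
  have eq: "p = v\<^sup>\<star> * v + v * v\<^sup>\<star>" unfolding vs unfolding ab(3)
    by (simp add: p_def algebra_simps mult_scaleC_left mult_scaleC_right scaleR_2)
  define s where "s = norm (a * a) + 1"
  define t where "t = norm (b * b) + 1"
  have "norm (of_real s - a * a) \<le> s" "norm (of_real t - b * b) \<le> t"
    using ab by (auto simp: s_def t_def simp del: of_real_add intro!: norm_diff_selfadjoint_square_le)
  then have "norm ((of_real s - a * a) + (of_real t - b * b)) \<le> s + t" by (rule norm_triangle_mono)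
  then have "norm (2 *\<^sub>R ((of_real s - a * a) + (of_real t - b * b))) \<le> 2 * (s + t)" by simp
  moreover have "2 *\<^sub>R ((of_real s - a * a) + (of_real t - b * b)) = of_real (2 * (s + t)) - p"
    by (simp add: p_def of_real_def scaleR_add_right scaleR_diff_right scaleR_add_left flip: scaleR_scaleR)
  ultimately have le: "norm (of_real (2 * (s + t)) - p) \<le> 2 * (s + t)" by simp
  show ?thesis unfolding eq[symmetric]
    by (rule posI[OF _ _ le]) (use N_D_one[OF v] in \<open>auto simp: eq star_add star_mult\<close>)
qed

text \<open>If \<open>m\<close> is the negative part of \<open>v\<^sup>* v\<close> and \<open>n\<^sup>2 = m\<^sup>3\<close>, then \<open>z = v m n\<close> satisfies
  \<open>z\<^sup>* z = - (m\<^sup>3)\<^sup>2\<close> and \<open>z z\<^sup>* = - (v m\<^sup>2 v\<^sup>*)\<^sup>2\<close>, whereas \<open>z\<^sup>* z + z z\<^sup>*\<close> is positive.\<close>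

lemma N_pos: assumes v: "v \<in> N" shows "pos (v\<^sup>\<star> * v)"
proof -
  define p where "p = v\<^sup>\<star> * v"
  have p: "p \<in> D" "p\<^sup>\<star> = p" using N_D_one v by (auto simp: p_def star_mult)
  obtain k m where k: "pos k" and m: "pos m" and km: "k * m = 0" and pkm: "p = k - m"
    using positive_negative_parts[OF p] by metis
  have kD: "k \<in> D" and mD: "m \<in> D" "m\<^sup>\<star> = m" using k m pos_D pos_star by auto
  define q where "q = m * (m * m)"
  have q: "pos q" using m by (simp add: q_def pos_mult)
  then obtain n where n: "pos n" "n * n = q" using pos_sqrt by blast
  have nD: "n \<in> D" "n\<^sup>\<star> = n" using n pos_D pos_star by auto
  define r where "r = v * (m * m) * v\<^sup>\<star>"
  have r: "r \<in> D" "r\<^sup>\<star> = r" using N_D(2)[OF v, of "m * m"] mD by (auto simp: r_def star_mult mult.assoc)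
  define z where "z = v * (m * n)"
  have zN: "z \<in> N" unfolding z_def by (rule N_mult[OF v D_N]) (simp add: mD nD)
  have pm: "p * m = - (m * m)" unfolding pkm using km by (simp add: algebra_simps)
  have "z\<^sup>\<star> * z = n * (m * (p * m)) * n" using mD nD by (simp add: z_def p_def star_mult mult.assoc)
  also have "\<dots> = - (n * (q * n))" unfolding pm by (simp add: q_def mult.assoc)
  also have "n * (q * n) = q * q" using D_comm[OF pos_D[OF q] nD(1)] n(2) by (metis mult.assoc)
  finally have 1: "z\<^sup>\<star> * z = - (q * q)" .
  have "z * z\<^sup>\<star> = v * (m * (n * n) * m) * v\<^sup>\<star>" using mD nD by (simp add: z_def star_mult mult.assoc)
  also have "m * (n * n) * m = - ((m * m) * (p * m) * m)" unfolding n pm by (simp add: q_def mult.assoc)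
  also have "v * (- ((m * m) * (p * m) * m)) * v\<^sup>\<star> = - (r * r)" by (simp add: r_def p_def mult.assoc)
  finally have 2: "z * z\<^sup>\<star> = - (r * r)" .
  have "pos (- (q * q) + - (r * r))" using N_sum_pos[OF zN] unfolding 1 2 .
  then have "pos (- (q * q) + - (r * r) + r * r)" using pos_square[OF r] by (rule pos_add)
  then have "pos (of_real 0 - q * q)" by simp
  moreover have "pos (of_real 0 + q * q)" using pos_mult[OF q q] by simp
  ultimately have "norm (q * q) \<le> 0" using q by (intro norm_le_of_order) (auto simp: star_mult pos_D pos_star)
  then have "q = 0" using norm_selfadjoint_square[OF pos_star[OF q]] by simp
  then have "norm ((m * m) * (m * m)) = 0" by (simp add: q_def mult.assoc)
  then have "m * m = 0" using norm_selfadjoint_square[of "m * m"] mD by (simp add: star_mult)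
  then have "m = 0" using norm_selfadjoint_square[OF mD(2)] by simp
  then show ?thesis using k pkm by (simp add: p_def)
qed

text \<open>Put \<open>b = v\<^sup>\<star> * v\<close> and
  \<open>e = v\<^sup>\<star> * d * v\<close>. Since \<open>v * v\<^sup>\<star>\<close> commutes with
  \<open>d\<close>, one has \<open>v * e = d * (v * b)\<close>. Up to null elements, elements of
  \<open>D\<close> act on either side through \<open>\<sigma>\<close>, so \<open>\<sigma> e\<close>
  and \<open>\<sigma> d * \<sigma> b\<close> are equal as soon as \<open>v\<close> is not
  null.\<close>

lemma N_cases:
  assumes v: "v \<in> N"
  obtains "B v = 0" | t u where "0 < t" "u \<in> H" "v = t *\<^sub>R u"
proof (cases "B v = 0")
  case False
  define b where "b = v\<^sup>\<star> * v"
  have bD: "b \<in> D" using v N_D_one by (simp add: b_def)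
  have sb: "\<sigma> b \<noteq> 0"
  proof
    assume "\<sigma> b = 0"
    then have "B (1 * v) = 0" using bD unfolding b_def by (intro B_small_right)
    then show False using False by simp
  qed
  have eq: "\<sigma> (v\<^sup>\<star> * d * v) = \<sigma> b * \<sigma> d" if d: "d \<in> D" for d
  proof -
    define e where "e = v\<^sup>\<star> * d * v"
    have eD: "e \<in> D" using v d N_D by (simp add: e_def)
    have "v * e = (v * v\<^sup>\<star>) * d * v" by (simp add: e_def mult.assoc)
    also have "\<dots> = d * (v * v\<^sup>\<star>) * v" using D_comm[OF d N_D_one(2)[OF v]] by simp
    finally have ve: "v * e = d * (v * b)" by (simp add: b_def mult.assoc)
    have 1: "B (v * e - \<sigma> e *\<^sub>C v) = 0" using eD by (rule B_scale_right)
    have 2: "B (d * (v * b) - \<sigma> d *\<^sub>C (v * b)) = 0" using d by (rule B_scale_left)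
    have 3: "B (\<sigma> d *\<^sub>C (v * b - \<sigma> b *\<^sub>C v)) = 0" using B_scale_right[OF bD, of v] by (simp add: B_scaleC)
    have "(\<sigma> e - \<sigma> d * \<sigma> b) *\<^sub>C v = - (v * e - \<sigma> e *\<^sub>C v) + ((d * (v * b) - \<sigma> d *\<^sub>C (v * b))
        + \<sigma> d *\<^sub>C (v * b - \<sigma> b *\<^sub>C v))"
      by (simp add: ve scaleC_diff_left scaleC_diff_right)
    then have "B ((\<sigma> e - \<sigma> d * \<sigma> b) *\<^sub>C v) = 0" using 1 2 3 by (simp only: B_add_zero B_minus)
    then show ?thesis using False by (simp add: B_scaleC e_def mult.commute)
  qed
  have re: "0 \<le> Re (\<sigma> b)" and im: "Im (\<sigma> b) = 0" using s_pos[OF N_pos[OF v]] by (auto simp: b_def)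
  \<comment> \<open>\<open>N_pos\<close> is what makes \<open>\<sigma> b\<close> a nonnegative real,
    so that its root can normalize \<open>v\<close>.\<close>
  define t where "t = sqrt (Re (\<sigma> b))"
  have "Re (\<sigma> b) \<noteq> 0" using sb im by (auto simp: complex_eq_iff)
  then have t: "0 < t" "of_real (t * t) = \<sigma> b" using re im by (auto simp: t_def complex_eq_iff)
  define u where "u = (1 / t) *\<^sub>R v"
  have "u \<in> N" using N_scaleC[OF v, of "of_real (1/t)"] unfolding u_def scaleC_of_real .
  moreover have "\<sigma> (u\<^sup>\<star> * d * u) = \<sigma> d" if d: "d \<in> D" for d
  proof -
    have "u\<^sup>\<star> * d * u = (1 / (t * t)) *\<^sub>R (v\<^sup>\<star> * d * v)" by (simp add: u_def)
    have "\<sigma> (u\<^sup>\<star> * d * u) = of_real (1 / (t * t)) * (of_real (t * t) * \<sigma> d)"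
      unfolding t(2) \<open>u\<^sup>\<star> * d * u = _\<close> eq[OF d, symmetric] by (rule s_scaleR[OF N_D(1)[OF v d]])
    also have "\<dots> = \<sigma> d" using t(1) by (simp del: of_real_mult flip: mult.assoc of_real_mult)
    finally show ?thesis .
  qed
  ultimately have "u \<in> H" by (simp add: H_set_def)
  moreover have "v = t *\<^sub>R u" using t(1) by (simp add: u_def)
  ultimately show thesis using that(2) t(1) by blast
qed

end

section \<open>Elements of \<open>H\<^sub>\<sigma>\<close> close to the identity\<close>

locale masa_character = character +
  assumes masa: "masa_inclusion D"
begin

text \<open>Maximality enters here: the bicommutant of \<open>insert y D\<close> is an abelian
  subalgebra containing \<open>D\<close>, hence equal to it.\<close>

lemma commuting_selfadjoint_in_D:
  assumes y: "y\<^sup>\<star> = y" "\<And>d. d \<in> D \<Longrightarrow> y * d = d * y"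
  shows "y \<in> D"
proof -
  let ?E = "commutant (commutant (insert y D))"
  have "abelian_cstar_subalgebra ?E"
    using y D_comm by (intro abelian_bicommutant) (auto simp: commutant_def)
  moreover have "insert y D \<subseteq> ?E" by (rule subset_bicommutant)
  ultimately show ?thesis using masa by (auto simp: masa_inclusion_def)
qed

lemma commuting_in_D:
  assumes x: "\<And>d. d \<in> D \<Longrightarrow> x * d = d * x"
  shows "x \<in> D"
proof -
  have xs: "x\<^sup>\<star> * d = d * x\<^sup>\<star>" if "d \<in> D" for d
    using arg_cong[OF x[OF D_star[OF that]], of star] by (simp add: star_mult)
  have "(1/2) *\<^sub>R (x + x\<^sup>\<star>) \<in> D" "(- \<i> / 2) *\<^sub>C (x - x\<^sup>\<star>) \<in> D"
    using x xs real_imaginary_parts[of x]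
    by (auto intro!: commuting_selfadjoint_in_D
        simp: algebra_simps mult_scaleC_left mult_scaleC_right scaleC_diff_right)
  then show ?thesis using real_imaginary_parts(3)[of x] by (metis D_add D_scaleC)
qed

text \<open>A self-adjoint \<open>h\<close> with h^2 + l^2 = t is a multiple of the mean of the two
  unitaries \<open>h + \<i> l\<close> and \<open>h - \<i> l\<close>, each divided by the root of
  \<open>t\<close>.\<close>

lemma commute_of_unitaries:
  assumes x: "\<And>w. w \<in> D \<Longrightarrow> w\<^sup>\<star> * w = 1 \<Longrightarrow> x * w = w * x" and d: "d \<in> D"
  shows "x * d = d * x"
proof -
  have sa: "x * h = h * x" if h: "h \<in> D" "h\<^sup>\<star> = h" for h
  proof -
    define t where "t = norm (h * h) + 1"
    have "norm (h * h) < t" by (simp add: t_def)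
    moreover have t: "0 < t" by (simp add: t_def add_nonneg_pos)
    ultimately obtain l where l: "l \<in> D" "l\<^sup>\<star> = l" "l * l = of_real t - h * h"
      using sqrt_pos_scale[of "h * h" t] h by (auto simp: star_mult)
    define s where "s = 1 / sqrt t"
    have s: "s * s * t = 1" "s \<noteq> 0" using t by (auto simp: s_def)
    have comm: "x * (h + c *\<^sub>C l) = (h + c *\<^sub>C l) * x" if c: "cnj c * c = 1" "c = - cnj c" for c
    proof -
      have "(h + c *\<^sub>C l)\<^sup>\<star> * (h + c *\<^sub>C l) = h * h + (cnj c * c) *\<^sub>C (l * l) + (c + cnj c) *\<^sub>C (h * l)"
        using h l D_comm[of h l]
        by (simp add: star_add star_scaleC algebra_simps mult_scaleC_left mult_scaleC_right scaleC_add_left)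
      also have "\<dots> = of_real t" using c(1) l(3) c(2)[unfolded eq_neg_iff_add_eq_0] by simp
      finally have "(s *\<^sub>R (h + c *\<^sub>C l))\<^sup>\<star> * (s *\<^sub>R (h + c *\<^sub>C l)) = (s * s) *\<^sub>R of_real t" by simp
      then have "x * (s *\<^sub>R (h + c *\<^sub>C l)) = (s *\<^sub>R (h + c *\<^sub>C l)) * x"
        using s(1) h l by (intro x) (auto simp: of_real_def)
      then show ?thesis using s(2) by simp
    qed
    have "x * (h + \<i> *\<^sub>C l) + x * (h + (- \<i>) *\<^sub>C l) = (h + \<i> *\<^sub>C l) * x + (h + (- \<i>) *\<^sub>C l) * x"
      using comm[of \<i>] comm[of "- \<i>"] by simp
    then have "2 *\<^sub>R (x * h) = 2 *\<^sub>R (h * x)" by (simp add: algebra_simps scaleR_2)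
    then show ?thesis by simp
  qed
  obtain b c where bc: "b \<in> D" "c \<in> D" "b\<^sup>\<star> = b" "c\<^sup>\<star> = c" "d = b + \<i> *\<^sub>C c"
    using real_imaginary_parts[of d] d by (metis D_add D_diff D_scaleC D_scaleR D_star)
  then show ?thesis using sa[of b] sa[of c]
    by (simp add: algebra_simps mult_scaleC_left mult_scaleC_right)
qed

lemma D_left_comm: "x \<in> D \<Longrightarrow> y \<in> D \<Longrightarrow> x * (y * z) = y * (x * z)"
  by (metis D_comm mult.assoc)

text \<open>Let \<open>p = u\<^sup>* u\<close>, \<open>k = (p - 1/2)\<^sub>+\<close>, and let \<open>r\<close> be the inverse of \<open>p\<close> on the support of
  \<open>k\<close>. For a unitary \<open>w \<in> D\<close> put \<open>\<theta>(w) = r u\<^sup>* w\<^sup>* u w\<close>, which is multiplicative in \<open>w\<close> after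
  multiplication by \<open>k\<close>. As \<open>u\<close> is close to an element of \<open>D\<close>, all powers of \<open>\<theta>(w)\<close> are
  close to \<open>1\<close>, which forces \<open>\<theta>(w) k = k\<close>. So \<open>u k\<close> commutes with the unitaries of \<open>D\<close>.\<close>

lemma near_D_locally_in_D:
  assumes u: "u \<in> N" "\<sigma> (u\<^sup>\<star> * u) = 1"
    and g: "g \<in> D" "norm g \<le> 1" "norm (g - u) \<le> 1 / 8"
  obtains k where "k \<in> D" "\<sigma> k \<noteq> 0" "u * k \<in> D"
proof -
  define p where "p = u\<^sup>\<star> * u"
  have p: "p \<in> D" "p\<^sup>\<star> = p" using u N_D_one by (auto simp: p_def star_mult)
  obtain k m where k: "pos k" and m: "pos m" and km: "k * m = 0" and pkm: "p - of_real (1/2) = k - m"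
    using positive_negative_parts[of "p - of_real (1/2)"] p
    by (metis D_diff D_of_real star_diff star_of_real)
  have kD: "k \<in> D" and mD: "m \<in> D" using k m pos_D by auto
  have sk: "\<sigma> k \<noteq> 0"
  proof
    assume "\<sigma> k = 0"
    moreover have "\<sigma> (p - of_real (1/2)) = of_real (1/2)"
      using p(1) u(2) unfolding p_def by (subst s_diff) auto
    moreover have "\<sigma> (k - m) = \<sigma> k - \<sigma> m" using kD mD by (rule s_diff)
    ultimately have "\<sigma> m = - of_real (1/2)" using pkm by (metis diff_0 minus_minus)
    then show False using s_pos(1)[OF m] by simp
  qed
  have "pos (k + of_real (1/2) - of_real (1/2))" using k by simp
  then obtain r where r: "pos r" "r * (k + of_real (1/2)) = 1"
    using pos_inverse[of "k + of_real (1/2)" "1/2"] by auto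
  have rD: "r \<in> D" using r pos_D by blast
  have p_eq: "p = k + of_real (1/2) - m" using pkm by (simp add: algebra_simps)
  have "p * k = (k + of_real (1/2)) * k"
    unfolding p_eq using km D_comm[OF kD mD] by (simp add: algebra_simps)
  then have rpk: "r * (p * k) = k" using r(2) by (metis mult.assoc mult.left_neutral)
  have "2 *\<^sub>R (r * (k + of_real (1/2))) = 2 *\<^sub>R (r * k) + r"
    by (simp add: algebra_simps of_real_def)
  then have "of_real 2 - r = 2 *\<^sub>R (r * k)" unfolding r(2) by (simp add: algebra_simps of_real_def)
  then have nr: "norm r \<le> 2" using r k by (intro pos_norm_le) (auto intro!: pos_scaleR pos_mult)
  have "norm u \<le> norm g + norm (g - u)" using norm_triangle_ineq4[of g "g - u"] by simp
  then have nu: "norm u \<le> 9/8" using g by linarith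
  \<comment> \<open>This is 2 times 1 + 1/8. Conjugation will move \<open>u\<close> by at most 1/4,
    so the product of the two bounds is 9/16; the doubling argument below works because this number
    is less than 1, which is the reason for the distance 1/8.\<close>
  have nru: "norm (r * u\<^sup>\<star>) \<le> 9/4"
    using mult_mono[OF nr nu] by (intro order.trans[OF norm_mult_ineq]) auto

  define W where "W = {w \<in> D. w\<^sup>\<star> * w = 1}"
  have W_D: "w \<in> D" if "w \<in> W" for w using that by (simp add: W_def)
  have W_star: "w\<^sup>\<star> * w = 1" "w * w\<^sup>\<star> = 1" if "w \<in> W" for w
    using that D_comm by (auto simp: W_def)
  have W_norm: "norm w = 1" if "w \<in> W" for w
    using cstar_identity[of w] W_star[OF that] by (simp add: power2_eq_1_iff) (smt (verit) norm_ge_zero)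
  have W_square: "w * w \<in> W" if "w \<in> W" for w
    using that W_star[OF that] by (auto simp: W_def star_mult) (metis mult.assoc mult.left_neutral)
  define \<theta> where "\<theta> = (\<lambda>w. r * (u\<^sup>\<star> * w\<^sup>\<star> * u) * w)"
  have \<alpha>: "u\<^sup>\<star> * w\<^sup>\<star> * u \<in> D" if "w \<in> W" for w using N_D(1)[OF u(1)] W_D[OF that] by simp
  have \<theta>D: "\<theta> w \<in> D" if "w \<in> W" for w using \<alpha>[OF that] W_D[OF that] rD by (simp add: \<theta>_def)

  \<comment> \<open>As \<open>g\<close> commutes with \<open>w\<close>, conjugation by
    \<open>w\<close> moves \<open>u\<close> by at most twice its distance from \<open>g\<close>. The
    condition on \<open>z\<close> says that \<open>r\<close> inverts \<open>p\<close> on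
    \<open>z\<close>, so that \<open>r * u\<^sup>\<star> * u\<close> fixes \<open>z\<close>.\<close>
  have close: "norm (z - \<theta> w * z) \<le> (9/16) * norm z" if w: "w \<in> W" and z: "r * (p * z) = z" for w z
  proof -
    have conj: "w\<^sup>\<star> * g * w = g"
      using D_comm[OF g(1) W_D[OF w]] W_star[OF w] by (metis mult.assoc mult.left_neutral)
    have eq: "u - w\<^sup>\<star> * u * w = - (g - u) + w\<^sup>\<star> * (g - u) * w"
      using conj by (simp add: algebra_simps)
    moreover have "norm (w\<^sup>\<star> * (g - u) * w) \<le> norm (g - u)"
      using W_norm[OF w] norm_mult_le_one_left[of "w\<^sup>\<star>" "g - u"]
        norm_mult_le_one_right[of w "w\<^sup>\<star> * (g - u)"] by simp
    ultimately have "norm (u - w\<^sup>\<star> * u * w) \<le> 1/4"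
      unfolding eq using norm_triangle_ineq[of "- (g - u)" "w\<^sup>\<star> * (g - u) * w"] g(3) norm_minus_cancel[of "g - u"] by linarith
    then have "norm ((r * u\<^sup>\<star>) * (u - w\<^sup>\<star> * u * w)) \<le> (9/4) * (1/4)"
      by (intro order.trans[OF norm_mult_ineq mult_mono] nru) auto
    then have "norm ((r * u\<^sup>\<star>) * (u - w\<^sup>\<star> * u * w) * z) \<le> (9/16) * norm z"
      by (intro order.trans[OF norm_mult_ineq mult_right_mono]) auto
    moreover have "(r * u\<^sup>\<star>) * (u - w\<^sup>\<star> * u * w) * z = r * (p * z) - \<theta> w * z"
      by (simp add: p_def \<theta>_def algebra_simps)
    ultimately show ?thesis using z by simp
  qed

  \<comment> \<open>Since \<open>u * u\<^sup>\<star>\<close> commutes with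
    \<open>w\<^sup>\<star>\<close>, the square of
    \<open>u\<^sup>\<star> * w\<^sup>\<star> * u\<close> is the corresponding expression for
    \<open>w * w\<close> times \<open>p\<close>; the surplus \<open>p\<close> is absorbed by the
    second \<open>r\<close> on \<open>k\<close>.\<close>
  have \<theta>_square: "\<theta> w * (\<theta> w * k) = \<theta> (w * w) * k" if w: "w \<in> W" for w
  proof -
    define a where "a = u\<^sup>\<star> * w\<^sup>\<star> * u"
    have aD: "a \<in> D" using \<alpha>[OF w] by (simp add: a_def)
    note wD = W_D[OF w]
    have "a * a = u\<^sup>\<star> * (w\<^sup>\<star> * (u * u\<^sup>\<star>) * w\<^sup>\<star>) * u" by (simp add: a_def mult.assoc)
    also have "w\<^sup>\<star> * (u * u\<^sup>\<star>) * w\<^sup>\<star> = w\<^sup>\<star> * w\<^sup>\<star> * (u * u\<^sup>\<star>)"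
      using D_comm[OF N_D_one(2)[OF u(1)] D_star[OF wD]] by (simp add: mult.assoc)
    finally have aa: "a * a = u\<^sup>\<star> * (w * w)\<^sup>\<star> * u * p" by (simp add: p_def star_mult mult.assoc)
    have "\<theta> w * (\<theta> w * k) = r * a * w * (r * a * w * k)" by (simp add: \<theta>_def a_def)
    also have "\<dots> = r * (a * a) * (w * w) * (r * k)"
      using aD wD rD kD by (simp add: mult.assoc D_left_comm)
    also have "\<dots> = r * (u\<^sup>\<star> * (w * w)\<^sup>\<star> * u) * (w * w) * (r * (p * k))"
      unfolding aa using \<alpha>[OF W_square[OF w]] wD rD kD p(1) by (simp add: mult.assoc D_left_comm)
    finally show ?thesis unfolding rpk by (simp add: \<theta>_def)
  qed

  have \<theta>_k: "\<theta> w * k = k" if w: "w \<in> W" for w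
  proof (rule ccontr)
    assume ne: "\<theta> w * k \<noteq> k"
    \<comment> \<open>Repeated squaring: 1 - \<theta>^2 = 2(1 - \<theta>) - (1 - \<theta>)^2, so
      each squaring enlarges the deviation at least by the factor 2 - 9/16 = 23/16. A nonzero
      deviation would eventually exceed the uniform bound from \<open>close\<close>.\<close>
    have grow: "\<exists>w'\<in>W. (23/16) ^ n * norm (k - \<theta> w * k) \<le> norm (k - \<theta> w' * k)" for n
    proof (induction n)
      case 0
      then show ?case using w by auto
    next
      case (Suc n)
      then obtain w' where w': "w' \<in> W" "(23/16) ^ n * norm (k - \<theta> w * k) \<le> norm (k - \<theta> w' * k)" by blast
      define a where "a = k - \<theta> w' * k"
      have "r * (p * (\<theta> w' * k)) = \<theta> w' * (r * (p * k))"
        unfolding D_left_comm[OF p(1) \<theta>D[OF w'(1)]] by (rule D_left_comm[OF rD \<theta>D[OF w'(1)]])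
      then have "r * (p * a) = a" unfolding a_def using rpk by (simp add: right_diff_distrib)
      then have le: "norm (a - \<theta> w' * a) \<le> (9/16) * norm a" by (rule close[OF w'(1)])
      have "k - \<theta> (w' * w') * k = 2 *\<^sub>R a - (a - \<theta> w' * a)"
        unfolding \<theta>_square[OF w'(1), symmetric] by (simp add: a_def algebra_simps scaleR_2)
      then have "2 * norm a - norm (a - \<theta> w' * a) \<le> norm (k - \<theta> (w' * w') * k)"
        using norm_triangle_ineq2[of "2 *\<^sub>R a" "a - \<theta> w' * a"] by simp
      then have "(23/16) * norm a \<le> norm (k - \<theta> (w' * w') * k)" using le by linarith
      moreover have "(23/16) ^ Suc n * norm (k - \<theta> w * k) \<le> (23/16) * norm a"
        using w'(2) by (simp add: a_def mult.commute)
      ultimately show ?case using W_square[OF w'(1)] order.trans by blast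
    qed
    have bound: "(23/16) ^ n * norm (k - \<theta> w * k) \<le> (9/16) * norm k" for n
      using grow[of n] close[OF _ rpk] by (meson order.trans)
    have pos: "0 < norm (k - \<theta> w * k)" using ne by simp
    obtain n where "(9/16) * norm k / norm (k - \<theta> w * k) < (23/16) ^ n"
      using real_arch_pow[of "23/16"] by auto
    then show False using bound[of n] pos by (simp add: divide_less_eq)
  qed

  have "(u * k) * w = w * (u * k)" if "w \<in> D" "w\<^sup>\<star> * w = 1" for w
  proof -
    have w: "w \<in> W" using that by (simp add: W_def)
    \<comment> \<open>Inserting \<open>\<theta> w\<close> before \<open>k\<close> produces
      \<open>u * r * u\<^sup>\<star>\<close>, an element of \<open>D\<close>, past which
      \<open>w\<^sup>\<star>\<close> can be moved to cancel against \<open>w\<close>.\<close>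
    have uru: "u * r * u\<^sup>\<star> \<in> D" using N_D(2)[OF u(1) rD] .
    have "w * u * k = w * u * (\<theta> w * k)" using \<theta>_k[OF w] by simp
    also have "\<dots> = w * ((u * r * u\<^sup>\<star>) * w\<^sup>\<star>) * (u * w * k)" by (simp add: \<theta>_def mult.assoc)
    also have "(u * r * u\<^sup>\<star>) * w\<^sup>\<star> = w\<^sup>\<star> * (u * r * u\<^sup>\<star>)" using D_comm uru that by simp
    also have "w * (w\<^sup>\<star> * (u * r * u\<^sup>\<star>)) * (u * w * k) = (w * w\<^sup>\<star>) * (u * (r * (p * (w * k))))"
      by (simp add: p_def mult.assoc)
    also have "r * (p * (w * k)) = w * (r * (p * k))"
      using rD p(1) that by (simp add: D_left_comm)
    finally have "w * u * k = u * (w * k)" using W_star[OF w] rpk by simp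
    then show ?thesis using D_comm[OF kD that(1)] by (simp add: mult.assoc)
  qed
  then have "u * k \<in> D" using commute_of_unitaries commuting_in_D by blast
  then show thesis using that kD sk by blast
qed

text \<open>A contractive cut-down turns closeness in the seminorm into closeness in norm:
  \<open>d * u * d\<close> is within 1/8 of \<open>d * d\<close>, which lies in \<open>D\<close>,
  and it still represents the class of \<open>u\<close>.\<close>

lemma near_one_scalar:
  assumes u: "u \<in> H" and near: "B (1 - u) < 1/8"
  obtains z where "cmod z = 1" "B (u - z *\<^sub>C 1) = 0"
proof -
  obtain d where d: "d \<in> D" "\<sigma> d = 1" "norm d \<le> 1" "norm (d * (1 - u) * d) < 1/8"
    using B_less_obtain[OF near] by blast
  define v where "v = d * u * d"
  have dH: "d \<in> H" using d by (intro H_D) auto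
  have vH: "v \<in> H" unfolding v_def using dH u by (intro H_mult)
  have "norm (d * d) \<le> 1" using norm_mult_le_one_left[OF d(3), of d] d(3) by linarith
  moreover have "norm (d * d - v) \<le> 1/8" using d(4) by (simp add: v_def algebra_simps)
  ultimately obtain k where k: "k \<in> D" "\<sigma> k \<noteq> 0" "v * k \<in> D"
    using near_D_locally_in_D[of v "d * d"] H_N[OF vH] H_s_one[OF vH] d(1) by auto
  \<comment> \<open>Up to null elements \<open>v * k\<close> is \<open>\<sigma> k\<close> times
    \<open>v\<close>, and, being in \<open>D\<close>, it is also the scalar
    \<open>\<sigma> (v * k)\<close>.\<close>
  define c where "c = \<sigma> (v * k) / \<sigma> k"
  have 1: "B (v * k - \<sigma> k *\<^sub>C v) = 0" using k by (intro B_scale_right)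
  have 2: "B (v * k - \<sigma> (v * k) *\<^sub>C 1) = 0" using B_scale_right[OF k(3), of 1] by simp
  have "\<sigma> k *\<^sub>C (v - c *\<^sub>C 1) = - (v * k - \<sigma> k *\<^sub>C v) + (v * k - \<sigma> (v * k) *\<^sub>C 1)"
    using k by (simp add: c_def scaleC_diff_right)
  then have "B (\<sigma> k *\<^sub>C (v - c *\<^sub>C 1)) = 0" using 1 2 by (simp only: B_add_zero B_minus)
  then have vc: "B (v - c *\<^sub>C 1) = 0" using k by (simp add: B_scaleC)
  have "B v = B (c *\<^sub>C 1)" by (rule B_eqI[OF vc])
  then have "cmod c = 1" using B_H[OF vH] B_one by (simp add: B_scaleC)
  moreover have "B (d * u - u) = 0" "B (d * u * d - d * u) = 0"
    using B_scale_left[OF d(1), of u] B_scale_right[OF d(1), of "d * u"] d by simp_all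
  then have "B (u - v) = 0" using B_diff_triangle[of u v "d * u"] B_minus_commute[of u "d * u"]
      B_minus_commute[of "d * u" v] B_nonneg[of "u - v"] by (simp add: v_def antisym)
  then have "B (u - c *\<^sub>C 1) = 0" using vc B_diff_triangle[of u "c *\<^sub>C 1" v] B_nonneg[of "u - c *\<^sub>C 1"] by linarith
  ultimately show thesis using that by blast
qed

end

section \<open>The group \<open>H\<^sub>\<sigma> / R\<^sub>1\<close> and its cosets of \<open>\<T>\<close>\<close>

context character
begin

abbreviation "cls \<equiv> cls1 D \<sigma>"
abbreviation "G \<equiv> HR D \<sigma>"
abbreviation "X \<equiv> HR_top D \<sigma>"
abbreviation "gdist \<equiv> HR_dist D \<sigma>"

lemma equiv_R1: "equiv H (R1 D \<sigma>)"
proof (rule equivI)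
  show "R1 D \<sigma> \<subseteq> H \<times> H" by (auto simp: R1_iff)
  show "refl_on H (R1 D \<sigma>)" by (auto simp: refl_on_def R1_iff)
  show "sym (R1 D \<sigma>)" by (auto simp: sym_def R1_iff B_minus_commute)
  have "B (v - w) = 0" if "B (v - u) = 0" "B (u - w) = 0" for u v w
    using that B_diff_triangle[of v w u] B_nonneg[of "v - w"] by linarith
  then show "trans (R1 D \<sigma>)" by (auto simp: trans_def R1_iff)
qed

lemma cls_eq_iff: "v \<in> H \<Longrightarrow> w \<in> H \<Longrightarrow> cls v = cls w \<longleftrightarrow> B (v - w) = 0"
  using eq_equiv_class_iff[OF equiv_R1, of v w] by (auto simp: cls1_def R1_iff)

lemma mem_cls_iff: "w \<in> cls v \<longleftrightarrow> v \<in> H \<and> w \<in> H \<and> B (v - w) = 0"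
  by (simp add: cls1_def R1_iff)

lemma carrier_G: "carrier G = cls ` H"
  by (auto simp: HR_def quotient_def cls1_def)

lemma cls_carrier [simp]: "v \<in> H \<Longrightarrow> cls v \<in> carrier G"
  by (simp add: carrier_G)

text \<open>Operations on classes are written as unions over representatives; such a union collapses
  once the family is constant on the class.\<close>

lemma UN_cls_const:
  assumes "v \<in> H" "\<And>w. w \<in> H \<Longrightarrow> B (v - w) = 0 \<Longrightarrow> f w = f v"
  shows "(\<Union>w\<in>cls v. f w) = f v"
proof -
  have ne: "cls v \<noteq> {}" using assms(1) mem_cls_iff[of v v] by auto
  have "(\<Union>w\<in>cls v. f w) = (\<Union>w\<in>cls v. f v)"
    by (rule SUP_cong[OF refl], rule assms(2)) (simp_all add: mem_cls_iff)
  also have "\<dots> = f v" by (rule SUP_const[OF ne])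
  finally show ?thesis .
qed

lemma mult_G [simp]:
  assumes v: "v \<in> H" and w: "w \<in> H"
  shows "cls v \<otimes>\<^bsub>G\<^esub> cls w = cls (v * w)"
proof -
  have const: "cls (v' * w') = cls (v * w)"
    if "v' \<in> H" "w' \<in> H" "B (v - v') = 0" "B (w - w') = 0" for v' w'
  proof -
    have "v * w - v' * w' = (v - v') * w + v' * (w - w')" by (simp add: algebra_simps)
    moreover have "B ((v - v') * w) = 0" "B (v' * (w - w')) = 0" using that w by auto
    ultimately have "B (v * w - v' * w') = 0" by (simp add: B_add_zero)
    then show ?thesis using that v w by (simp add: cls_eq_iff H_mult B_minus_commute)
  qed
  have "(\<Union>v\<in>cls v. \<Union>w\<in>cls w. cls (v * w)) = (\<Union>v'\<in>cls v. cls (v' * w))"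
  proof (intro SUP_cong refl UN_cls_const[OF w])
    fix v' w' assume "v' \<in> cls v" "w' \<in> H" "B (w - w') = 0"
    then show "cls (v' * w') = cls (v' * w)" using const[of v' w'] const[of v' w] w by (simp add: mem_cls_iff)
  qed
  also have "\<dots> = cls (v * w)" using const w by (intro UN_cls_const[OF v]) auto
  finally show ?thesis by (simp add: HR_def)
qed

lemma one_G: "\<one>\<^bsub>G\<^esub> = cls 1"
  by (simp add: HR_def)

lemma cls_star_left: "v \<in> H \<Longrightarrow> cls (v\<^sup>\<star> * v) = cls 1"
  using B_scale_left[OF N_D_one(1)[OF H_N], of v 1] H_s_one[of v]
  by (simp add: cls_eq_iff H_mult H_star)

lemma group_G: "group G"
proof (rule groupI)
  show "\<one>\<^bsub>G\<^esub> \<in> carrier G" by (simp add: one_G)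
  fix x assume "x \<in> carrier G"
  then obtain v where v: "v \<in> H" "x = cls v" by (auto simp: carrier_G)
  show "\<one>\<^bsub>G\<^esub> \<otimes>\<^bsub>G\<^esub> x = x" using v by (simp add: one_G)
  show "\<exists>y\<in>carrier G. y \<otimes>\<^bsub>G\<^esub> x = \<one>\<^bsub>G\<^esub>"
    using v by (intro bexI[of _ "cls (v\<^sup>\<star>)"]) (auto simp: one_G H_star cls_star_left)
qed (auto simp: carrier_G H_mult mult.assoc)

lemma inv_G: "v \<in> H \<Longrightarrow> inv\<^bsub>G\<^esub> cls v = cls (v\<^sup>\<star>)"
  by (rule group.inv_equality[OF group_G]) (auto simp: one_G H_star cls_star_left)

lemma gdist_cls [simp]:
  assumes v: "v \<in> H" and w: "w \<in> H"
  shows "gdist (cls v) (cls w) = B (v - w)"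
proof -
  have "{B (v' - w') |v' w'. v' \<in> cls v \<and> w' \<in> cls w} = {B (v - w)}"
  proof -
    have "B (v' - w') = B (v - w)" if "v' \<in> cls v" "w' \<in> cls w" for v' w'
    proof (rule B_eqI)
      have eq: "v' - w' - (v - w) = - (v - v') + (w - w')" by simp
      show "B (v' - w' - (v - w)) = 0"
        unfolding eq using that by (intro B_add_zero) (simp_all only: B_minus mem_cls_iff)
    qed
    moreover have "v \<in> cls v" "w \<in> cls w" using v w by (auto simp: mem_cls_iff)
    ultimately show ?thesis by blast
  qed
  then show ?thesis using v w by (simp add: HR_dist_def)
qed

sublocale GM: Metric_space "carrier G" gdist
proof
  have out: "gdist x y = 0" if "x \<notin> carrier G \<or> y \<notin> carrier G" for x y
    using that by (auto simp: HR_dist_def)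
  show "0 \<le> gdist x y" for x y
    by (cases "x \<in> carrier G \<and> y \<in> carrier G") (auto simp: out carrier_G)
  show "gdist x y = gdist y x" for x y
    by (cases "x \<in> carrier G \<and> y \<in> carrier G") (auto simp: out carrier_G B_minus_commute)
  show "gdist x y = 0 \<longleftrightarrow> x = y" if "x \<in> carrier G" "y \<in> carrier G" for x y
  proof -
    obtain v w where "v \<in> H" "w \<in> H" "x = cls v" "y = cls w" using \<open>x \<in> _\<close> \<open>y \<in> _\<close> by (auto simp: carrier_G)
    then show ?thesis by (simp add: cls_eq_iff)
  qed
qed (auto simp: carrier_G B_diff_triangle)

lemma X_def: "X = GM.mtopology"
  by (simp add: HR_top_def)

lemma topspace_X [simp]: "topspace X = carrier G"
  by (simp add: X_def)

lemma openin_X: "openin X U \<longleftrightarrow>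
    U \<subseteq> carrier G \<and> (\<forall>x\<in>U. \<exists>r>0. \<forall>y\<in>carrier G. gdist x y < r \<longrightarrow> y \<in> U)"
proof -
  have "GM.mball x r \<subseteq> U \<longleftrightarrow> (\<forall>y\<in>carrier G. gdist x y < r \<longrightarrow> y \<in> U)" if "x \<in> carrier G" for x r
    using that by auto
  then show ?thesis unfolding X_def GM.openin_mtopology by (meson subsetD)
qed

lemma continuous_on_X:
  fixes f :: "'a set \<Rightarrow> complex"
  assumes "\<And>x e. x \<in> carrier G \<Longrightarrow> 0 < e \<Longrightarrow>
    \<exists>r>0. \<forall>y\<in>carrier G. gdist x y < r \<longrightarrow> dist (f x) (f y) < e"
  shows "continuous_map X euclidean f"
  unfolding continuous_map_def
proof (intro conjI allI impI)
  fix U :: "complex set" assume "openin euclidean U"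
  then have U: "open U" by simp
  show "openin X {x \<in> topspace X. f x \<in> U}"
    unfolding openin_X
  proof (intro conjI ballI)
    fix x assume "x \<in> {x \<in> topspace X. f x \<in> U}"
    then have x: "x \<in> carrier G" "f x \<in> U" by auto
    then obtain e where e: "0 < e" "\<And>z. dist z (f x) < e \<Longrightarrow> z \<in> U"
      using U unfolding open_dist by blast
    obtain r where "r > 0" "\<forall>y\<in>carrier G. gdist x y < r \<longrightarrow> dist (f x) (f y) < e"
      using assms[OF x(1) e(1)] by blast
    then show "\<exists>r>0. \<forall>y\<in>carrier G. gdist x y < r \<longrightarrow> y \<in> {x \<in> topspace X. f x \<in> U}"
      using e(2) by (intro exI[of _ r]) (auto simp: dist_commute)
  qed auto
qed auto

abbreviation "\<iota> \<equiv> HR_circle D \<sigma>"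

lemma circle_mult [simp]: "cmod z = 1 \<Longrightarrow> v \<in> H \<Longrightarrow> \<iota> z \<otimes>\<^bsub>G\<^esub> cls v = cls (z *\<^sub>C v)"
  by (simp add: HR_circle_def H_scaleC mult_scaleC_left)

section \<open>Cosets of the circle and their coordinates\<close>

definition orb :: "'a \<Rightarrow> 'a set set" where
  "orb v = (\<lambda>z. cls (z *\<^sub>C v)) ` sphere 0 1"

lemma r_coset_orb: "v \<in> H \<Longrightarrow> \<iota> ` sphere 0 1 #>\<^bsub>G\<^esub> cls v = orb v"
  by (auto simp: r_coset_def orb_def)

lemma rcosets_orb: "rcosets\<^bsub>G\<^esub> (\<iota> ` sphere 0 1) = orb ` H"
  by (auto simp: RCOSETS_def carrier_G r_coset_orb)

lemma orb_carrier: "v \<in> H \<Longrightarrow> orb v \<subseteq> carrier G"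
  by (auto simp: orb_def H_scaleC)

lemma cls_mem_orb: "v \<in> H \<Longrightarrow> cls v \<in> orb v"
  unfolding orb_def by (rule image_eqI[of _ _ 1]) auto

lemma some_orb: assumes "v \<in> H" shows "\<exists>w\<in>H. (SOME g. g \<in> orb v) = cls w \<and> cls w \<in> orb v"
proof -
  have "(SOME g. g \<in> orb v) \<in> orb v" using cls_mem_orb[OF assms] by (rule someI)
  moreover then have "(SOME g. g \<in> orb v) \<in> cls ` H" using orb_carrier[OF assms] unfolding carrier_G by blast
  ultimately show ?thesis by auto
qed

lemma cls_scaleC_eq_iff:
  assumes "v \<in> H" "w \<in> H" "cmod z = 1"
  shows "cls (z *\<^sub>C v) = cls w \<longleftrightarrow> cls v = cls (cnj z *\<^sub>C w)"
proof -
  have "z * cnj z = 1" "cnj z * z = 1" using assms(3) complex_norm_square[of z] by (simp_all add: mult.commute)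
  then have "v - cnj z *\<^sub>C w = cnj z *\<^sub>C (z *\<^sub>C v - w)" by (simp add: scaleC_diff_right)
  then show ?thesis using assms by (simp add: cls_eq_iff H_scaleC B_scaleC)
qed

lemma orb_eq:
  assumes v: "v \<in> H" and w: "w \<in> H" and t: "t \<in> orb v" "t \<in> orb w"
  shows "orb v = orb w"
proof -
  have sub: "orb v' \<subseteq> orb w'"
    if H: "v' \<in> H" "w' \<in> H" and t: "t \<in> orb v'" "t \<in> orb w'" for v' w' t
  proof
    fix s assume "s \<in> orb v'"
    then obtain c where c: "cmod c = 1" "s = cls (c *\<^sub>C v')" by (auto simp: orb_def)
    obtain a b where ab: "cmod a = 1" "cmod b = 1" "t = cls (a *\<^sub>C v')" "t = cls (b *\<^sub>C w')"
      using t by (auto simp: orb_def)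
    then have "cls v' = cls ((cnj a * b) *\<^sub>C w')"
      using cls_scaleC_eq_iff[of v' "b *\<^sub>C w'" a] H H_scaleC by simp
    then have "cls (c *\<^sub>C v') = cls ((c * (cnj a * b)) *\<^sub>C w')"
      using c ab H circle_mult[of c v'] circle_mult[of c "(cnj a * b) *\<^sub>C w'"]
      by (simp add: H_scaleC norm_mult)
    then show "s \<in> orb w'" unfolding c(2) orb_def
      using c ab by (intro image_eqI[of _ _ "c * (cnj a * b)"]) (auto simp: norm_mult)
  qed
  show ?thesis using sub[OF v w t] sub[OF w v t(2,1)] by blast
qed

lemma gdist_scaleC: "v \<in> H \<Longrightarrow> cmod z = 1 \<Longrightarrow> cmod w = 1 \<Longrightarrow>
    gdist (cls (z *\<^sub>C v)) (cls (w *\<^sub>C v)) = cmod (z - w)"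
  by (simp add: H_scaleC B_scaleC B_H flip: scaleC_diff_left)

text \<open>The coordinate of \<open>t\<close> on the coset of \<open>v\<close>, with the default 0
  elsewhere. The default keeps \<open>co v\<close> continuous on the whole group, as cosets turn out
  to be clopen.\<close>

definition co :: "'a \<Rightarrow> 'a set \<Rightarrow> complex" where
  "co v t = (if t \<in> orb v then THE z. z \<in> sphere 0 1 \<and> t = cls (z *\<^sub>C v) else 0)"

lemma co_cls: assumes "v \<in> H" "cmod z = 1" shows "co v (cls (z *\<^sub>C v)) = z"
proof -
  have unique: "w = z" if "cmod w = 1" "cls (z *\<^sub>C v) = cls (w *\<^sub>C v)" for w
  proof -
    have "cmod (z - w) = gdist (cls (w *\<^sub>C v)) (cls (w *\<^sub>C v))"
      using gdist_scaleC[OF assms(1,2) that(1)] unfolding that(2) by (rule sym)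
    then show ?thesis using assms(1) that(1) by (simp add: H_scaleC)
  qed
  have "(THE w. w \<in> sphere 0 1 \<and> cls (z *\<^sub>C v) = cls (w *\<^sub>C v)) = z"
  proof (rule the_equality)
    show "z \<in> sphere 0 1 \<and> cls (z *\<^sub>C v) = cls (z *\<^sub>C v)" using assms(2) by simp
  qed (metis mem_sphere_0 unique)
  then show ?thesis using assms by (auto simp: co_def orb_def)
qed

lemma co_orb: assumes "v \<in> H" "t \<in> orb v" shows "cmod (co v t) = 1" "t = cls (co v t *\<^sub>C v)"
  using assms co_cls by (auto simp: orb_def)

lemma co_outside: "t \<notin> orb v \<Longrightarrow> co v t = 0"
  by (simp add: co_def)

lemma continuous_scaleC_cls:
  assumes v: "v \<in> H" shows "continuous_map (top_of_set (sphere 0 1)) X (\<lambda>z. cls (z *\<^sub>C v))"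
  unfolding continuous_map_def
proof (intro conjI allI impI)
  show "(\<lambda>z. cls (z *\<^sub>C v)) \<in> topspace (top_of_set (sphere 0 1)) \<rightarrow> topspace X"
    using v by (auto simp: H_scaleC)
  fix U assume U: "openin X U"
  show "openin (top_of_set (sphere 0 1)) {z \<in> topspace (top_of_set (sphere 0 1)). cls (z *\<^sub>C v) \<in> U}"
    unfolding openin_euclidean_subtopology_iff
  proof (intro conjI ballI)
    fix z assume z: "z \<in> {z \<in> topspace (top_of_set (sphere 0 1)). cls (z *\<^sub>C v) \<in> U}"
    then obtain r where r: "r > 0" "\<And>y. y \<in> carrier G \<Longrightarrow> gdist (cls (z *\<^sub>C v)) y < r \<Longrightarrow> y \<in> U"
      using U unfolding openin_X by blast
    show "\<exists>e>0. \<forall>w\<in>sphere 0 1. dist w z < e \<longrightarrow> w \<in> {z \<in> topspace (top_of_set (sphere 0 1)). cls (z *\<^sub>C v) \<in> U}"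
    proof (intro exI[of _ r] conjI ballI impI r(1))
      fix w :: complex assume w: "w \<in> sphere 0 1" "dist w z < r"
      then have "gdist (cls (z *\<^sub>C v)) (cls (w *\<^sub>C v)) < r"
        using z v gdist_scaleC[of v z w] by (simp add: dist_norm norm_minus_commute)
      then have "cls (w *\<^sub>C v) \<in> U" using w v by (intro r(2)) (auto simp: H_scaleC)
      then show "w \<in> {z \<in> topspace (top_of_set (sphere 0 1)). cls (z *\<^sub>C v) \<in> U}" using w by simp
    qed
  qed auto
qed

lemma compactin_orb: assumes "v \<in> H" shows "compactin X (orb v)"
  unfolding orb_def
  by (rule image_compactin[OF _ continuous_scaleC_cls[OF assms]])
    (simp add: compactin_subtopology)

end

context masa_character
begin

text \<open>Translation by \<open>v\<^sup>\<star>\<close> reduces to the neighbourhood of the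
  identity: \<open>v\<^sup>\<star> * w\<close> is a scalar \<open>z\<close> up to a null element,
  and multiplying back by \<open>v\<close> gives \<open>w\<close> as \<open>z\<close> times
  \<open>v\<close>.\<close>

lemma near_same_orb:
  assumes v: "v \<in> H" and w: "w \<in> H" and near: "B (v - w) < 1/8"
  shows "cls w \<in> orb v"
proof -
  have "v\<^sup>\<star> * (v - w) - (1 - v\<^sup>\<star> * w) = v\<^sup>\<star> * v * 1 - \<sigma> (v\<^sup>\<star> * v) *\<^sub>C 1"
    using v by (simp add: H_s_one algebra_simps)
  then have "B (v\<^sup>\<star> * (v - w)) = B (1 - v\<^sup>\<star> * w)"
    using B_scale_left[OF N_D_one(1)[OF H_N[OF v]], of 1] by (intro B_eqI) simp
  then have "B (1 - v\<^sup>\<star> * w) < 1/8" using near v by (simp add: H_star)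
  then obtain z where z: "cmod z = 1" "B (v\<^sup>\<star> * w - z *\<^sub>C 1) = 0"
    using near_one_scalar[of "v\<^sup>\<star> * w"] v w by (auto simp: H_mult H_star)
  have "B (v * (v\<^sup>\<star> * w - z *\<^sub>C 1)) = 0" using z v by simp
  moreover have "v * (v\<^sup>\<star> * w - z *\<^sub>C 1) = (v * v\<^sup>\<star> * w - \<sigma> (v * v\<^sup>\<star>) *\<^sub>C w) + (w - z *\<^sub>C v)"
    using v by (simp add: H_s_one' algebra_simps mult_scaleC_right)
  moreover have "B (v * v\<^sup>\<star> * w - \<sigma> (v * v\<^sup>\<star>) *\<^sub>C w) = 0"
    using v by (intro B_scale_left N_D_one H_N)
  ultimately have "B (w - z *\<^sub>C v) = 0"
    using B_eqI[of "v * v\<^sup>\<star> * w - \<sigma> (v * v\<^sup>\<star>) *\<^sub>C w + (w - z *\<^sub>C v)" "w - z *\<^sub>C v"] by simp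
  then have "cls w = cls (z *\<^sub>C v)" using v w z by (simp add: cls_eq_iff H_scaleC)
  then show ?thesis using z by (auto simp: orb_def)
qed

lemma near_orb:
  assumes v: "v \<in> H" and s: "s \<in> orb v" and t: "t \<in> carrier G" "gdist s t < 1/8"
  shows "t \<in> orb v"
proof -
  obtain z where z: "cmod z = 1" "s = cls (z *\<^sub>C v)" using s by (auto simp: orb_def)
  obtain w where w: "w \<in> H" "t = cls w" using t by (auto simp: carrier_G)
  have zv: "z *\<^sub>C v \<in> H" using v z H_scaleC by blast
  have "t \<in> orb (z *\<^sub>C v)" using near_same_orb[OF zv w(1)] t zv w z by simp
  moreover have "orb (z *\<^sub>C v) = orb v"
    using orb_eq[OF zv v cls_mem_orb[OF zv]] s z by simp
  ultimately show ?thesis by simp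
qed

lemma openin_orb: "v \<in> H \<Longrightarrow> openin X (orb v)"
  unfolding openin_X using near_orb orb_carrier
  by (metis divide_pos_pos zero_less_numeral zero_less_one)

text \<open>Points at distance less than 1/8 lie both in the coset or both outside it, and inside
  the coset the distance is that of the coordinates.\<close>

lemma continuous_co: assumes v: "v \<in> H" shows "continuous_map X euclidean (co v)"
proof (rule continuous_on_X)
  fix s and e :: real assume s: "s \<in> carrier G" and e: "0 < e"
  show "\<exists>r>0. \<forall>t\<in>carrier G. gdist s t < r \<longrightarrow> dist (co v s) (co v t) < e"
  proof (intro exI[of _ "min e (1/8)"] conjI ballI impI)
    fix t assume t: "t \<in> carrier G" "gdist s t < min e (1/8)"
    show "dist (co v s) (co v t) < e"
    proof (cases "s \<in> orb v")
      case True
      then have "t \<in> orb v" using near_orb v t by simp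
      then show ?thesis
        using True t v co_orb[OF v] gdist_scaleC[OF v, of "co v s" "co v t"] by (simp add: dist_norm)
    next
      case False
      then have "t \<notin> orb v" using near_orb[of v t s] v t s by (auto simp: GM.commute)
      then show ?thesis using False e by (simp add: co_outside)
    qed
  qed (use e in auto)
qed

text \<open>One representative is kept per coset, so distinct members of \<open>F\<close> have
  disjoint cosets.\<close>

lemma finite_orbs_of_compact:
  assumes K: "compactin X K"
  obtains F where "finite F" "F \<subseteq> H" "inj_on orb F" "K \<subseteq> (\<Union>v\<in>F. orb v)"
proof -
  have "K \<subseteq> carrier G" using compactin_subset_topspace[OF K] by simp
  then have "K \<subseteq> \<Union> (orb ` H)" using cls_mem_orb by (auto simp: carrier_G)
  then obtain \<F> where \<F>: "finite \<F>" "\<F> \<subseteq> orb ` H" "K \<subseteq> \<Union> \<F>"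
    using K openin_orb unfolding compactin_def by (metis imageE)
  obtain F where F: "F \<subseteq> H" "inj_on orb F" "\<F> = orb ` F" using \<F>(2) by (auto simp: subset_image_inj)
  then have "finite F" using \<F>(1) finite_image_iff by blast
  then show thesis using that F \<F> by blast
qed

end

section \<open>Haar measure\<close>

lemma emeasure_circle: "emeasure circle_measure (sphere 0 1) = 1"
proof -
  have [measurable]: "(\<lambda>t. cis (2 * pi * t)) \<in> borel_measurable borel"
    by (intro borel_measurable_continuous_onI continuous_intros)
  have "emeasure circle_measure (sphere 0 1)
      = emeasure (uniform_measure lborel {0..1}) ((\<lambda>t. cis (2 * pi * t)) -` sphere 0 1 \<inter> UNIV)"
    unfolding circle_measure_def by (subst emeasure_distr) (auto cong: measurable_cong_sets)
  also have "(\<lambda>t. cis (2 * pi * t)) -` sphere 0 1 \<inter> UNIV = UNIV" by auto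
  also have "emeasure (uniform_measure lborel {0..1 :: real}) UNIV = 1"
    by (subst emeasure_uniform_measure) auto
  finally show ?thesis .
qed

context character
begin

abbreviation "M \<equiv> HR_haar D \<sigma>"

lemma space_M [simp]: "space M = carrier G"
  unfolding haar_measure_def by (rule space_measure_of) (use openin_subset in force)

lemma sets_M: "sets M = sigma_sets (carrier G) {U. openin X U}"
  unfolding haar_measure_def by (rule sets_measure_of) (use openin_subset in force)

lemma openin_sets_M: "openin X U \<Longrightarrow> U \<in> sets M"
  by (simp add: sets_M sigma_sets.Basic)

text \<open>\<open>measure_of\<close> returns its formula only if that formula is a measure. The
  slices of a set in \<open>M\<close> are Borel because
  \<open>z \<mapsto> cls (z *\<^sub>C w)\<close> is continuous, and countable additivity passes
  through the counting integral.\<close>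

lemma emeasure_M:
  assumes A: "A \<in> sets M"
  shows "emeasure M A = (\<integral>\<^sup>+ c. emeasure circle_measure {z \<in> sphere 0 1. \<iota> z \<otimes>\<^bsub>G\<^esub> (SOME g. g \<in> c) \<in> A}
            \<partial>count_space (rcosets\<^bsub>G\<^esub> (\<iota> ` sphere 0 1)))"
proof (rule emeasure_measure_of[OF haar_measure_def _ _ _ A])
  show "{U. openin X U} \<subseteq> Pow (carrier G)" using openin_subset by force
  define S where "S = (\<lambda>c A. {z \<in> sphere 0 1. \<iota> z \<otimes>\<^bsub>G\<^esub> (SOME g. g \<in> c) \<in> A})"
  have meas: "S c A \<in> sets circle_measure" if c: "c \<in> rcosets\<^bsub>G\<^esub> (\<iota> ` sphere 0 1)" and A: "A \<in> sets M" for c A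
  proof -
    obtain v where v: "v \<in> H" "c = orb v" using c by (auto simp: rcosets_orb)
    obtain w where w: "w \<in> H" "(SOME g. g \<in> c) = cls w"
      using some_orb v by metis
    have "(\<lambda>z. cls (z *\<^sub>C w)) \<in> measurable (restrict_space borel (sphere 0 1)) M"
    proof (rule measurable_sigma_sets[OF sets_M])
      show "{U. openin X U} \<subseteq> Pow (carrier G)" using openin_subset by force
      show "(\<lambda>z. cls (z *\<^sub>C w)) \<in> space (restrict_space borel (sphere 0 1)) \<rightarrow> carrier G"
        using w by (auto simp: space_restrict_space H_scaleC)
      fix U assume "U \<in> {U. openin X U}"
      then have "openin (top_of_set (sphere 0 1)) {z \<in> sphere 0 1. cls (z *\<^sub>C w) \<in> U}"
        using continuous_scaleC_cls[OF w(1)] by (auto simp: continuous_map_def)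
      then obtain T where T: "open T" "{z \<in> sphere 0 1. cls (z *\<^sub>C w) \<in> U} = sphere 0 1 \<inter> T"
        unfolding openin_open by blast
      have "(\<lambda>z. cls (z *\<^sub>C w)) -` U \<inter> space (restrict_space borel (sphere 0 1))
          = {z \<in> sphere 0 1. cls (z *\<^sub>C w) \<in> U}"
        by (auto simp: space_restrict_space)
      also have "\<dots> \<in> sets (restrict_space borel (sphere 0 1))"
        unfolding T(2) sets_restrict_space by (rule imageI[OF borel_open[OF T(1)]])
      finally show "(\<lambda>z. cls (z *\<^sub>C w)) -` U \<inter> space (restrict_space borel (sphere 0 1))
        \<in> sets (restrict_space borel (sphere 0 1))" .
    qed
    then have "(\<lambda>z. cls (z *\<^sub>C w)) -` A \<inter> space (restrict_space borel (sphere 0 1))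
        \<in> sets (restrict_space borel (sphere 0 1))"
      using A by (rule measurable_sets)
    moreover have "(\<lambda>z. cls (z *\<^sub>C w)) -` A \<inter> space (restrict_space borel (sphere 0 1)) = S c A"
      using w by (auto simp: S_def space_restrict_space)
    ultimately have "S c A \<in> sets (restrict_space borel (sphere 0 1))" by simp
    then have "S c A \<in> sets borel" by (auto simp: sets_restrict_space)
    then show ?thesis by (simp add: circle_measure_def)
  qed
  let ?\<mu> = "\<lambda>A. \<integral>\<^sup>+ c. emeasure circle_measure (S c A) \<partial>count_space (rcosets\<^bsub>G\<^esub> (\<iota> ` sphere 0 1))"
  show "positive (sets M) (\<lambda>A. \<integral>\<^sup>+ c. emeasure circle_measure {z \<in> sphere 0 1. \<iota> z \<otimes>\<^bsub>G\<^esub> (SOME g. g \<in> c) \<in> A}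
            \<partial>count_space (rcosets\<^bsub>G\<^esub> (\<iota> ` sphere 0 1)))"
    by (simp add: positive_def)
  have "countably_additive (sets M) ?\<mu>"
    unfolding countably_additive_def
  proof (intro allI impI)
    fix A :: "nat \<Rightarrow> _" assume A: "range A \<subseteq> sets M" "disjoint_family A"
    have "(\<Sum>i. emeasure circle_measure (S c (A i))) = emeasure circle_measure (S c (\<Union>i. A i))"
      if "c \<in> rcosets\<^bsub>G\<^esub> (\<iota> ` sphere 0 1)" for c
    proof -
      have "(\<Union>i. S c (A i)) = S c (\<Union>i. A i)" by (auto simp: S_def)
      moreover have "range (\<lambda>i. S c (A i)) \<subseteq> sets circle_measure" using A meas that by auto
      moreover have "disjoint_family (\<lambda>i. S c (A i))"
        using A(2) unfolding disjoint_family_on_def S_def by blast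
      ultimately show ?thesis using suminf_emeasure[of "\<lambda>i. S c (A i)" circle_measure] by simp
    qed
    then have "?\<mu> (\<Union>i. A i) = (\<integral>\<^sup>+ c. (\<Sum>i. emeasure circle_measure (S c (A i)))
        \<partial>count_space (rcosets\<^bsub>G\<^esub> (\<iota> ` sphere 0 1)))"
      by (intro nn_integral_cong) simp
    also have "\<dots> = (\<Sum>i. ?\<mu> (A i))" by (rule nn_integral_suminf) simp
    finally show "(\<Sum>i. ?\<mu> (A i)) = ?\<mu> (\<Union>i. A i)" by simp
  qed
  then show "countably_additive (sets M) (\<lambda>A. \<integral>\<^sup>+ c. emeasure circle_measure
      {z \<in> sphere 0 1. \<iota> z \<otimes>\<^bsub>G\<^esub> (SOME g. g \<in> c) \<in> A} \<partial>count_space (rcosets\<^bsub>G\<^esub> (\<iota> ` sphere 0 1)))"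
    unfolding S_def .
qed

lemma continuous_measurable_M:
  fixes f :: "'a set \<Rightarrow> 'b::topological_space"
  assumes "continuous_map X euclidean f"
  shows "f \<in> borel_measurable M"
proof (rule borel_measurableI)
  fix U :: "'b set" assume "open U"
  then have "openin X {x \<in> carrier G. f x \<in> U}" using assms by (auto simp: continuous_map_def)
  moreover have "f -` U \<inter> space M = {x \<in> carrier G. f x \<in> U}" by auto
  ultimately show "f -` U \<inter> space M \<in> sets M" using openin_sets_M by metis
qed

end

context masa_character
begin

lemma orb_sets [simp]: "v \<in> H \<Longrightarrow> orb v \<in> sets M"
  by (intro openin_sets_M openin_orb)

text \<open>Only the slice belonging to the coset itself is nonempty, and it is the full circle
  whichever representative was chosen.\<close>

lemma emeasure_orb: assumes v: "v \<in> H" shows "emeasure M (orb v) = 1"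
proof -
  have "{z \<in> sphere 0 1. \<iota> z \<otimes>\<^bsub>G\<^esub> (SOME g. g \<in> c) \<in> orb v} = (if c = orb v then sphere 0 1 else {})"
    if c: "c \<in> orb ` H" for c
  proof -
    obtain u where u: "u \<in> H" "c = orb u" using c by auto
    obtain w where w: "w \<in> H" "(SOME g. g \<in> c) = cls w" "cls w \<in> c"
      using some_orb u by metis
    have cw: "c = orb w"
      using orb_eq[OF u(1) w(1) _ cls_mem_orb[OF w(1)]] u w by simp
    have "cls (z *\<^sub>C w) \<in> orb v \<longleftrightarrow> c = orb v" if "cmod z = 1" for z
    proof
      have mem: "cls (z *\<^sub>C w) \<in> orb w" using that by (auto simp: orb_def)
      then show "c = orb v" if "cls (z *\<^sub>C w) \<in> orb v" using orb_eq[OF w(1) v _ that] cw by simp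
      show "cls (z *\<^sub>C w) \<in> orb v" if "c = orb v" using mem cw that by simp
    qed
    then show ?thesis using w by auto
  qed
  then have "emeasure M (orb v) = (\<integral>\<^sup>+ c. indicator {orb v} c \<partial>count_space (orb ` H))"
    unfolding emeasure_M[OF orb_sets[OF v]] rcosets_orb
    by (intro nn_integral_cong) (auto simp: emeasure_circle)
  also have "\<dots> = 1" using v by (subst nn_integral_indicator) auto
  finally show ?thesis .
qed

lemma measure_orb: "v \<in> H \<Longrightarrow> measure M (orb v) = 1"
  by (simp add: measure_def emeasure_orb)

end

section \<open>Integrals with values in a quotient\<close>

lemma csubspace_closure: 
  fixes S :: "'a::unital_cstar_algebra set"
  assumes "csubspace S" shows "csubspace (closure S)"
proof (rule complex_vector.subspaceI)
  show "0 \<in> closure S" using complex_vector.subspace_0[OF assms] closure_subset by blast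
  fix x y assume "x \<in> closure S" "y \<in> closure S"
  then obtain a b where "\<And>n. a n \<in> S" "a \<longlonglongrightarrow> x" "\<And>n. b n \<in> S" "b \<longlonglongrightarrow> y"
    by (auto simp: closure_sequential)
  then have "\<And>n. a n + b n \<in> S" "(\<lambda>n. a n + b n) \<longlonglongrightarrow> x + y"
    using assms by (auto intro: complex_vector.subspace_add tendsto_add)
  then show "x + y \<in> closure S" unfolding closure_sequential by (intro exI[of _ "\<lambda>n. a n + b n"]) simp
next
  fix c x assume "x \<in> closure S"
  then obtain a where "\<And>n. a n \<in> S" "a \<longlonglongrightarrow> x" by (auto simp: closure_sequential)
  then have "\<And>n. c *\<^sub>C a n \<in> S" "(\<lambda>n. c *\<^sub>C a n) \<longlonglongrightarrow> c *\<^sub>C x"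
    using assms bounded_linear.tendsto[OF bounded_linear_scaleC_right]
    by (auto intro: complex_vector.subspace_scale)
  then show "c *\<^sub>C x \<in> closure S" unfolding closure_sequential by (intro exI[of _ "\<lambda>n. c *\<^sub>C a n"]) simp
qed

section \<open>Cosets of a closed subspace and the quotient norm\<close>

locale closed_csubspace =
  fixes J :: "'a::unital_cstar_algebra set"
  assumes J_csubspace: "csubspace J" and J_closed: "closed J"
begin

lemma J_zero [simp]: "0 \<in> J" and J_add: "x \<in> J \<Longrightarrow> y \<in> J \<Longrightarrow> x + y \<in> J"
  and J_diff: "x \<in> J \<Longrightarrow> y \<in> J \<Longrightarrow> x - y \<in> J" and J_scaleC: "x \<in> J \<Longrightarrow> c *\<^sub>C x \<in> J"
  using J_csubspace by (auto simp: complex_vector.subspace_0 complex_vector.subspace_add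
      complex_vector.subspace_diff complex_vector.subspace_scale)

lemma J_nonempty: "J \<noteq> {}" using J_zero by blast

lemma mem_coset_of: "y \<in> coset_of J x \<longleftrightarrow> y - x \<in> J"
proof
  assume "y - x \<in> J"
  then show "y \<in> coset_of J x" unfolding coset_of_def by (intro image_eqI[of _ _ "y - x"]) auto
qed (auto simp: coset_of_def)

lemma coset_of_eq_iff: "coset_of J x = coset_of J y \<longleftrightarrow> x - y \<in> J"
proof
  assume "coset_of J x = coset_of J y"
  then show "x - y \<in> J" using mem_coset_of[of x x] mem_coset_of[of x y] by simp
next
  assume xy: "x - y \<in> J"
  have "z - x \<in> J \<longleftrightarrow> z - y \<in> J" for z
    using J_add[of "z - x" "x - y"] J_diff[of "z - y" "x - y"] xy by auto
  then show "coset_of J x = coset_of J y" by (auto simp: mem_coset_of)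
qed

lemma coset_diff_coset_of: "coset_diff (coset_of J x) (coset_of J y) = coset_of J (x - y)"
proof (intro Set.set_eqI iffI)
  fix z assume "z \<in> coset_diff (coset_of J x) (coset_of J y)"
  then obtain a b where ab: "z = a - b" "a - x \<in> J" "b - y \<in> J" by (auto simp: coset_diff_def mem_coset_of)
  have "z - (x - y) = (a - x) - (b - y)" by (simp add: ab(1))
  then show "z \<in> coset_of J (x - y)" using J_diff[OF ab(2,3)] by (simp only: mem_coset_of)
next
  fix z assume "z \<in> coset_of J (x - y)"
  then have "z + y \<in> coset_of J x" "y \<in> coset_of J y" by (auto simp: mem_coset_of algebra_simps)
  moreover have "z = (z + y) - y" by simp
  ultimately show "z \<in> coset_diff (coset_of J x) (coset_of J y)" unfolding coset_diff_def by blast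
qed

definition q :: "'a \<Rightarrow> real" where "q x = coset_norm (coset_of J x)"

lemma q_infdist: "q x = infdist x J"
proof -
  have "norm ` coset_of J x = dist x ` J"
  proof (intro Set.set_eqI iffI)
    fix r assume "r \<in> norm ` coset_of J x"
    then obtain j where "j \<in> J" "r = norm (x + j)" by (auto simp: coset_of_def)
    then show "r \<in> dist x ` J"
      using J_diff[OF J_zero, of j] by (intro image_eqI[of _ _ "- j"]) (auto simp: dist_norm)
  next
    fix r assume "r \<in> dist x ` J"
    then obtain j where "j \<in> J" "r = norm (x - j)" by (auto simp: dist_norm)
    then show "r \<in> norm ` coset_of J x"
      using J_diff[OF J_zero, of j] by (intro image_eqI[of _ _ "x - j"]) (auto simp: mem_coset_of)
  qed
  then show ?thesis by (simp add: q_def coset_norm_def infdist_notempty[OF J_nonempty])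
qed

lemma q_nonneg [simp]: "0 \<le> q x"
  by (simp add: q_infdist infdist_nonneg)

lemma q_le: "j \<in> J \<Longrightarrow> q x \<le> norm (x - j)"
  unfolding q_infdist using infdist_le[of j J x] by (simp add: dist_norm)

lemma q_greatest: "(\<And>j. j \<in> J \<Longrightarrow> c \<le> norm (x - j)) \<Longrightarrow> c \<le> q x"
  unfolding q_infdist infdist_notempty[OF J_nonempty]
  by (rule cINF_greatest[OF J_nonempty]) (auto simp: dist_norm)

lemma q_le_norm: "q x \<le> norm x"
  using q_le[OF J_zero, of x] by simp

lemma q_triangle: "q (x + y) \<le> q x + q y"
proof -
  have "q (x + y) - q x \<le> q y"
  proof (rule q_greatest)
    fix j assume j: "j \<in> J"
    have "q (x + y) - norm (y - j) \<le> q x"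
    proof (rule q_greatest)
      fix i assume "i \<in> J"
      then have "q (x + y) \<le> norm (x + y - (i + j))" using j by (intro q_le J_add)
      also have "x + y - (i + j) = (x - i) + (y - j)" by simp
      also have "norm \<dots> \<le> norm (x - i) + norm (y - j)" by (rule norm_triangle_ineq)
      finally show "q (x + y) - norm (y - j) \<le> norm (x - i)" by simp
    qed
    then show "q (x + y) - q x \<le> norm (y - j)" by simp
  qed
  then show ?thesis by simp
qed

lemma q_zero_iff: "q x = 0 \<longleftrightarrow> x \<in> J"
  unfolding q_infdist by (rule in_closed_iff_infdist_zero[OF J_closed J_nonempty, symmetric])

lemma q_zero [simp]: "q 0 = 0"
  by (simp add: q_zero_iff)

lemma q_scaleR_le: assumes "0 \<le> a" shows "q (a *\<^sub>R x) \<le> a * q x"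
proof (cases "a = 0")
  case True
  then show ?thesis by simp
next
  case False
  then have a: "0 < a" using assms by simp
  have "q (a *\<^sub>R x) / a \<le> q x"
  proof (rule q_greatest)
    fix j assume "j \<in> J"
    then have "q (a *\<^sub>R x) \<le> norm (a *\<^sub>R x - a *\<^sub>R j)" by (intro q_le csubspace_scaleR[OF J_csubspace])
    also have "\<dots> = a * norm (x - j)" using a by (simp flip: scaleR_diff_right)
    finally show "q (a *\<^sub>R x) / a \<le> norm (x - j)" using a by (simp add: divide_le_eq mult.commute)
  qed
  then show ?thesis using a by (simp add: divide_le_eq mult.commute)
qed

lemma q_sum_le: "q (\<Sum>i\<in>I. f i) \<le> (\<Sum>i\<in>I. q (f i))"
proof (induction I rule: infinite_finite_induct)
  case (insert i I)
  then show ?case using q_triangle[of "f i" "\<Sum>i\<in>I. f i"] by simp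
qed auto

lemma continuous_q: "continuous_on S q"
  unfolding q_infdist[abs_def] by (intro continuous_on_infdist continuous_on_id)

text \<open>The triangle inequality for the quotient norm; it allows approximants known only modulo
  \<open>J\<close> to be compared.\<close>

lemma q_simple_integral_le:
  assumes s: "Bochner_Integration.simple_bochner_integrable M s"
  shows "ennreal (q (Bochner_Integration.simple_bochner_integral M s)) \<le> (\<integral>\<^sup>+ t. ennreal (q (s t)) \<partial>M)"
proof -
  have "q (Bochner_Integration.simple_bochner_integral M s)
      \<le> (\<Sum>y\<in>s ` space M. q (measure M {x \<in> space M. s x = y} *\<^sub>R y))"
    unfolding simple_bochner_integral_def by (rule q_sum_le)
  also have "\<dots> \<le> (\<Sum>y\<in>s ` space M. measure M {x \<in> space M. s x = y} *\<^sub>R q y)"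
    by (intro sum_mono) (simp add: q_scaleR_le)
  also have "\<dots> = Bochner_Integration.simple_bochner_integral M (\<lambda>x. q (s x))"
    using s by (intro simple_bochner_integral_partition[symmetric])
      (auto intro: s simple_bochner_integrable_compose2[where p = "\<lambda>x y. q x"] simp: q_zero_iff
        elim: simple_bochner_integrable.cases)
  finally have "ennreal (q (Bochner_Integration.simple_bochner_integral M s))
      \<le> ennreal (Bochner_Integration.simple_bochner_integral M (\<lambda>x. q (s x)))"
    by (rule ennreal_leI)
  also have "\<dots> = (\<integral>\<^sup>+ t. ennreal (q (s t)) \<partial>M)"
    by (intro simple_bochner_integral_eq_nn_integral simple_bochner_integrable_compose2[where p = "\<lambda>x y. q x", OF _ s s])
      (auto simp: q_zero_iff)
  finally show ?thesis .
qed

end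

lemma null_sequence_le_ennreal:
  fixes f g :: "nat \<Rightarrow> ennreal"
  assumes "\<And>n. f n \<le> g n" "g \<longlonglongrightarrow> 0"
  shows "f \<longlonglongrightarrow> 0"
  by (rule tendsto_sandwich[OF _ _ tendsto_const assms(2)]) (simp_all add: assms(1))

lemma simple_function_scaleC_sum:
  fixes s :: "'i \<Rightarrow> 'g \<Rightarrow> complex"
  assumes "\<And>i. i \<in> I \<Longrightarrow> simple_function M (s i)"
  shows "simple_function M (\<lambda>t. \<Sum>i\<in>I. s i t *\<^sub>C (v i :: 'a::unital_cstar_algebra))"
proof (rule simple_function_sum)
  show "simple_function M (\<lambda>t. s i t *\<^sub>C v i)" if "i \<in> I" for i
    by (rule simple_function_compose1[OF assms[OF that], where g = "\<lambda>c. c *\<^sub>C v i"])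
qed

text \<open>In a nonseparable algebra a sum of Borel functions may fail to be Borel. Approximating
  the scalar coefficients makes the function a pointwise limit of simple ones.\<close>

lemma borel_measurable_scaleC_sum:
  fixes \<psi> :: "'i \<Rightarrow> 'g \<Rightarrow> complex" and v :: "'i \<Rightarrow> 'a::unital_cstar_algebra"
  assumes \<psi>: "\<And>i. i \<in> I \<Longrightarrow> \<psi> i \<in> borel_measurable M" and s: "simple_function M s"
  shows "(\<lambda>t. (\<Sum>i\<in>I. \<psi> i t *\<^sub>C v i) - s t) \<in> borel_measurable M"
proof -
  have "\<exists>r. (\<forall>n. simple_function M (r n)) \<and> (\<forall>t\<in>space M. (\<lambda>n. r n t) \<longlonglongrightarrow> \<psi> i t)" if "i \<in> I" for i
    using borel_measurable_implies_sequence_metric[OF \<psi>[OF that], of 0] by metis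
  then obtain r where r: "\<And>i n. i \<in> I \<Longrightarrow> simple_function M (r i n)"
    "\<And>i t. i \<in> I \<Longrightarrow> t \<in> space M \<Longrightarrow> (\<lambda>n. r i n t) \<longlonglongrightarrow> \<psi> i t" by metis
  show ?thesis
  proof (rule borel_measurable_LIMSEQ_metric)
    have "simple_function M (\<lambda>t. (\<Sum>i\<in>I. r i n t *\<^sub>C v i) - s t)" for n
      by (rule simple_function_compose2[OF simple_function_scaleC_sum s]) (use r in auto)
    then show "(\<lambda>t. (\<Sum>i\<in>I. r i n t *\<^sub>C v i) - s t) \<in> borel_measurable M" for n
      by (rule borel_measurable_simple_function)
    show "(\<lambda>n. (\<Sum>i\<in>I. r i n t *\<^sub>C v i) - s t) \<longlonglongrightarrow> (\<Sum>i\<in>I. \<psi> i t *\<^sub>C v i) - s t" if "t \<in> space M" for t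
      using r(2) that by (intro tendsto_diff tendsto_sum tendsto_const bounded_linear.tendsto[OF bounded_linear_scaleC_left])
  qed
qed

lemma simple_bochner_integral_scaleC_sum:
  fixes s :: "'i \<Rightarrow> 'g \<Rightarrow> complex" and v :: "'i \<Rightarrow> 'a::unital_cstar_algebra"
  assumes "\<And>i. i \<in> I \<Longrightarrow> Bochner_Integration.simple_bochner_integrable M (s i)"
  shows "Bochner_Integration.simple_bochner_integrable M (\<lambda>t. \<Sum>i\<in>I. s i t *\<^sub>C v i) \<and>
    Bochner_Integration.simple_bochner_integral M (\<lambda>t. \<Sum>i\<in>I. s i t *\<^sub>C v i)
      = (\<Sum>i\<in>I. Bochner_Integration.simple_bochner_integral M (s i) *\<^sub>C v i)"
  using assms
proof (induction I rule: infinite_finite_induct)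
  case (insert i I)
  have si: "Bochner_Integration.simple_bochner_integrable M (\<lambda>t. s i t *\<^sub>C v i)"
    using insert.prems[of i] by (intro simple_bochner_integrable_compose2[where p = "\<lambda>c y. c *\<^sub>C v i"]) auto
  have eq: "Bochner_Integration.simple_bochner_integral M (\<lambda>t. s i t *\<^sub>C v i)
      = Bochner_Integration.simple_bochner_integral M (s i) *\<^sub>C v i"
    using insert.prems[of i] bounded_linear.linear[OF bounded_linear_scaleC_left]
    by (intro simple_bochner_integral_linear) auto
  have IH: "Bochner_Integration.simple_bochner_integrable M (\<lambda>t. \<Sum>i\<in>I. s i t *\<^sub>C v i)"
    "Bochner_Integration.simple_bochner_integral M (\<lambda>t. \<Sum>i\<in>I. s i t *\<^sub>C v i)
      = (\<Sum>i\<in>I. Bochner_Integration.simple_bochner_integral M (s i) *\<^sub>C v i)"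
    using insert by auto
  have "Bochner_Integration.simple_bochner_integrable M (\<lambda>t. s i t *\<^sub>C v i + (\<Sum>i\<in>I. s i t *\<^sub>C v i))"
    by (rule simple_bochner_integrable_compose2[OF _ si IH(1)]) simp
  then show ?case
    using insert(1,2) simple_bochner_integral_add[OF si IH(1)] by (simp add: eq IH(2))
qed (auto simp: simple_bochner_integral_def intro!: sum.neutral simple_bochner_integrable.intros simple_function_const)

context closed_csubspace
begin

text \<open>With finitely many directions \<open>v i\<close>, simple approximations of the scalar
  coefficients approximate the lift in norm, hence also modulo \<open>J\<close>. Because the
  integral is a definite description, uniqueness of its value is part of the claim.\<close>

lemma quotient_integral_scaleC_sum:
  fixes \<psi> :: "'i \<Rightarrow> 'g \<Rightarrow> complex" and M :: "'g measure"
  assumes A: "csubspace A" and I: "finite I" and v: "\<And>i. i \<in> I \<Longrightarrow> v i \<in> A"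
    and \<psi>: "\<And>i. i \<in> I \<Longrightarrow> integrable M (\<psi> i)"
    and F: "\<And>t. t \<in> space M \<Longrightarrow> F t = coset_of J (\<Sum>i\<in>I. \<psi> i t *\<^sub>C v i)"
  shows "quotient_integral A J M F = coset_of J (\<Sum>i\<in>I. (\<integral>t. \<psi> i t \<partial>M) *\<^sub>C v i)"
proof -
  define \<Psi> where "\<Psi> = (\<lambda>t. \<Sum>i\<in>I. \<psi> i t *\<^sub>C v i)"
  define Y where "Y = (\<Sum>i\<in>I. (\<integral>t. \<psi> i t \<partial>M) *\<^sub>C v i)"
  have inA: "(\<Sum>i\<in>I. c i *\<^sub>C v i) \<in> A" for c
    using A v by (intro complex_vector.subspace_sum complex_vector.subspace_scale)
  have F: "F t = coset_of J (\<Psi> t)" if "t \<in> space M" for t using F that by (simp add: \<Psi>_def)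
  define P where "P = (\<lambda>i s. (\<forall>n. Bochner_Integration.simple_bochner_integrable M (s n)) \<and>
      (\<lambda>n. \<integral>\<^sup>+ t. norm (\<psi> i t - s n t) \<partial>M) \<longlonglongrightarrow> 0 \<and>
      (\<lambda>n. Bochner_Integration.simple_bochner_integral M (s n)) \<longlonglongrightarrow> (\<integral>t. \<psi> i t \<partial>M))"
  have "\<exists>s. P i s" if "i \<in> I" for i
    using has_bochner_integral_integrable[OF \<psi>[OF that]]
  proof (rule has_bochner_integral.cases)
    fix s assume "\<And>n. Bochner_Integration.simple_bochner_integrable M (s n)"
      "(\<lambda>n. \<integral>\<^sup>+ t. norm (\<psi> i t - s n t) \<partial>M) \<longlonglongrightarrow> 0"
      "(\<lambda>n. Bochner_Integration.simple_bochner_integral M (s n)) \<longlonglongrightarrow> (\<integral>t. \<psi> i t \<partial>M)"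
    then show ?thesis unfolding P_def by (intro exI[of _ s] conjI allI)
  qed
  then obtain s where sP: "\<And>i. i \<in> I \<Longrightarrow> P i (s i)" by metis
  have s: "\<And>i n. i \<in> I \<Longrightarrow> Bochner_Integration.simple_bochner_integrable M (s i n)"
    "\<And>i. i \<in> I \<Longrightarrow> (\<lambda>n. \<integral>\<^sup>+ t. norm (\<psi> i t - s i n t) \<partial>M) \<longlonglongrightarrow> 0"
    "\<And>i. i \<in> I \<Longrightarrow> (\<lambda>n. Bochner_Integration.simple_bochner_integral M (s i n)) \<longlonglongrightarrow> (\<integral>t. \<psi> i t \<partial>M)"
    using sP unfolding P_def by (simp_all only: simp_thms)
  define S where "S = (\<lambda>n t. \<Sum>i\<in>I. s i n t *\<^sub>C v i)"
  have S: "Bochner_Integration.simple_bochner_integrable M (S n)"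
    "Bochner_Integration.simple_bochner_integral M (S n)
      = (\<Sum>i\<in>I. Bochner_Integration.simple_bochner_integral M (s i n) *\<^sub>C v i)" for n
    using simple_bochner_integral_scaleC_sum[of I M "\<lambda>i. s i n" v] s(1) by (auto simp: S_def)
  have S_simple: "simple_function M (S n)" for n using S(1) by (auto elim: simple_bochner_integrable.cases)
  define e where "e = (\<lambda>n. \<integral>\<^sup>+ t. ennreal (norm (\<Psi> t - S n t)) \<partial>M)"
  have \<psi>_meas: "\<psi> i \<in> borel_measurable M" if "i \<in> I" for i using \<psi>[OF that] by (rule borel_measurable_integrable)
  have e_le: "e n \<le> (\<Sum>i\<in>I. (\<integral>\<^sup>+ t. norm (\<psi> i t - s i n t) \<partial>M) * ennreal (norm (v i)))" for n
  proof -
    have meas: "(\<lambda>t. ennreal (norm (\<psi> i t - s i n t))) \<in> borel_measurable M" if "i \<in> I" for i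
    proof -
      have "s i n \<in> borel_measurable M"
        using s(1)[OF that, of n] by (auto elim!: simple_bochner_integrable.cases intro: borel_measurable_simple_function)
      then show ?thesis using \<psi>_meas[OF that] by measurable
    qed
    have "ennreal (norm (\<Psi> t - S n t)) \<le> (\<Sum>i\<in>I. ennreal (norm (\<psi> i t - s i n t)) * ennreal (norm (v i)))" for t
    proof -
      have "\<Psi> t - S n t = (\<Sum>i\<in>I. (\<psi> i t - s i n t) *\<^sub>C v i)"
        by (simp add: \<Psi>_def S_def scaleC_diff_left sum_subtractf)
      then have "norm (\<Psi> t - S n t) \<le> (\<Sum>i\<in>I. norm (\<psi> i t - s i n t) * norm (v i))"
        by (auto intro: order.trans[OF norm_sum] simp: norm_scaleC)
      then have "ennreal (norm (\<Psi> t - S n t)) \<le> ennreal (\<Sum>i\<in>I. norm (\<psi> i t - s i n t) * norm (v i))"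
        by (rule ennreal_leI)
      then show ?thesis by (simp add: ennreal_mult flip: sum_ennreal)
    qed
    then have "e n \<le> (\<integral>\<^sup>+ t. (\<Sum>i\<in>I. ennreal (norm (\<psi> i t - s i n t)) * ennreal (norm (v i))) \<partial>M)"
      unfolding e_def by (intro nn_integral_mono)
    also have "\<dots> = (\<Sum>i\<in>I. \<integral>\<^sup>+ t. ennreal (norm (\<psi> i t - s i n t)) * ennreal (norm (v i)) \<partial>M)"
      using meas by (intro nn_integral_sum borel_measurable_times) auto
    also have "\<dots> = (\<Sum>i\<in>I. (\<integral>\<^sup>+ t. norm (\<psi> i t - s i n t) \<partial>M) * ennreal (norm (v i)))"
      using meas by (intro sum.cong refl nn_integral_multc)
    finally show ?thesis .
  qed
  have "(\<lambda>n. \<Sum>i\<in>I. (\<integral>\<^sup>+ t. norm (\<psi> i t - s i n t) \<partial>M) * ennreal (norm (v i))) \<longlonglongrightarrow> (\<Sum>i\<in>I. 0 * ennreal (norm (v i)))"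
  proof (intro tendsto_sum)
    fix i assume "i \<in> I"
    then show "(\<lambda>n. (\<integral>\<^sup>+ t. norm (\<psi> i t - s i n t) \<partial>M) * ennreal (norm (v i))) \<longlonglongrightarrow> 0 * ennreal (norm (v i))"
      unfolding mult.commute[of _ "ennreal (norm (v i))"] by (intro ennreal_tendsto_cmult s(2)) auto
  qed
  then have e_lim: "e \<longlonglongrightarrow> 0"
    using null_sequence_le_ennreal[OF e_le] by simp
  have "(\<lambda>n. Bochner_Integration.simple_bochner_integral M (S n)) \<longlonglongrightarrow> Y"
    unfolding S(2) Y_def by (intro tendsto_sum bounded_linear.tendsto[OF bounded_linear_scaleC_left] s(3))
  then have "(\<lambda>n. norm (Y - Bochner_Integration.simple_bochner_integral M (S n))) \<longlonglongrightarrow> norm (Y - Y)"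
    by (intro tendsto_norm tendsto_diff tendsto_const)
  then have S_lim: "(\<lambda>n. norm (Y - Bochner_Integration.simple_bochner_integral M (S n))) \<longlonglongrightarrow> 0" by simp
  have norm_F: "coset_norm (coset_diff (F t) (coset_of J x)) = q (\<Psi> t - x)" if "t \<in> space M" for t x
    using F[OF that] by (simp add: coset_diff_coset_of q_def)
  have norm_coset: "coset_norm (coset_diff (coset_of J x) (coset_of J y)) = q (x - y)" for x y
    by (simp add: coset_diff_coset_of q_def)

  have "has_quotient_integral A J M F (coset_of J Y)"
    unfolding has_quotient_integral_def
  proof (intro conjI allI impI ballI exI[of _ S])
    show "F t \<in> coset_of J ` A" if "t \<in> space M" for t using F[OF that] inA by (simp add: \<Psi>_def)
    show "coset_of J Y \<in> coset_of J ` A" using inA by (simp add: Y_def)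
    show "{t \<in> space M. F t \<subseteq> U} \<in> sets M" if U: "open U \<and> (\<forall>x\<in>U. coset_of J x \<subseteq> U)" for U
    proof -
      have "x \<in> coset_of J x" for x by (simp add: mem_coset_of)
      then have "{t \<in> space M. F t \<subseteq> U} = \<Psi> -` U \<inter> space M" using F U by blast
      moreover have "\<Psi> \<in> borel_measurable M"
        using borel_measurable_scaleC_sum[of I \<psi> M "\<lambda>_. 0" v] \<psi>_meas by (simp add: \<Psi>_def)
      ultimately show ?thesis using U by (simp add: measurable_sets)
    qed
    show "Bochner_Integration.simple_bochner_integrable M (S n)" for n by (rule S)
    show "S n ` space M \<subseteq> A" for n using inA by (auto simp: S_def)
    have "(\<integral>\<^sup>+ t. ennreal (coset_norm (coset_diff (F t) (coset_of J (S n t)))) \<partial>M) \<le> e n" for n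
      unfolding e_def by (intro nn_integral_mono ennreal_leI) (simp add: norm_F q_le_norm)
    then show "(\<lambda>n. \<integral>\<^sup>+ t. ennreal (coset_norm (coset_diff (F t) (coset_of J (S n t)))) \<partial>M) \<longlonglongrightarrow> 0"
      using e_lim by (rule null_sequence_le_ennreal)
    show "(\<lambda>n. coset_norm (coset_diff (coset_of J Y)
        (coset_of J (Bochner_Integration.simple_bochner_integral M (S n))))) \<longlonglongrightarrow> 0"
      unfolding norm_coset by (rule Lim_null_comparison[OF always_eventually S_lim]) (simp add: q_le_norm)
  qed
  \<comment> \<open>A rival value comes with simple functions \<open>s'\<close> that approximate
    \<open>F\<close> only modulo \<open>J\<close>. The difference of the two values splits into the
    error of \<open>s'\<close>, the difference of the integrals of \<open>s'\<close> and
    \<open>S\<close>, and the error of \<open>S\<close>; all are small in \<open>q\<close>.\<close>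
  moreover have "Z = coset_of J Y" if Z: "has_quotient_integral A J M F Z" for Z
  proof -
    obtain z where z: "Z = coset_of J z" using Z unfolding has_quotient_integral_def by blast
    obtain s' where s': "\<And>n. Bochner_Integration.simple_bochner_integrable M (s' n)"
      and lim1: "(\<lambda>n. \<integral>\<^sup>+ t. ennreal (coset_norm (coset_diff (F t) (coset_of J (s' n t)))) \<partial>M) \<longlonglongrightarrow> 0"
      and lim2: "(\<lambda>n. coset_norm (coset_diff Z (coset_of J (Bochner_Integration.simple_bochner_integral M (s' n))))) \<longlonglongrightarrow> 0"
      using Z unfolding has_quotient_integral_def by blast
    have s'_simple: "simple_function M (s' n)" for n using s' by (auto elim: simple_bochner_integrable.cases)
    let ?int = "Bochner_Integration.simple_bochner_integral M"
    have "ennreal (q (z - Y)) \<le> ennreal (q (z - ?int (s' n))) + ((\<integral>\<^sup>+ t. ennreal (q (\<Psi> t - s' n t)) \<partial>M) + e n)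
        + ennreal (norm (Y - ?int (S n)))" for n
    proof -
      have sbi: "Bochner_Integration.simple_bochner_integrable M (\<lambda>t. s' n t - S n t)"
        by (rule simple_bochner_integrable_compose2[OF _ s' S(1)]) simp
      have "z - Y = (z - ?int (s' n)) + ((?int (s' n) - ?int (S n)) + (?int (S n) - Y))" by simp
      then have "q (z - Y) \<le> q (z - ?int (s' n)) + (q (?int (s' n) - ?int (S n)) + q (?int (S n) - Y))"
        by (metis q_triangle add_left_mono order.trans)
      also have "\<dots> \<le> q (z - ?int (s' n)) + q (?int (s' n) - ?int (S n)) + norm (Y - ?int (S n))"
        using q_le_norm[of "?int (S n) - Y"] by (simp add: norm_minus_commute)
      finally have 1: "ennreal (q (z - Y)) \<le> ennreal (q (z - ?int (s' n)) + q (?int (s' n) - ?int (S n)) + norm (Y - ?int (S n)))"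
        by (rule ennreal_leI)
      have "ennreal (q (?int (s' n) - ?int (S n))) \<le> (\<integral>\<^sup>+ t. ennreal (q (s' n t - S n t)) \<partial>M)"
        using q_simple_integral_le[OF sbi] simple_bochner_integral_diff[OF s' S(1)] by simp
      also have "\<dots> \<le> (\<integral>\<^sup>+ t. ennreal (q (\<Psi> t - s' n t)) + ennreal (norm (\<Psi> t - S n t)) \<partial>M)"
      proof (intro nn_integral_mono)
        fix t
        have "s' n t - S n t = - 1 *\<^sub>R (\<Psi> t - s' n t) + (\<Psi> t - S n t)" by simp
        moreover have "q (- 1 *\<^sub>R (\<Psi> t - s' n t)) = q (\<Psi> t - s' n t)"
        proof -
          have "q (- x) \<le> q x" for x
          proof (rule q_greatest)
            fix j assume "j \<in> J"
            then show "q (- x) \<le> norm (x - j)" using q_le[OF J_diff[OF J_zero], of j "- x"] by (simp add: norm_minus_commute)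
          qed
          from this[of "\<Psi> t - s' n t"] this[of "- (\<Psi> t - s' n t)"] show ?thesis by simp
        qed
        ultimately have "q (s' n t - S n t) \<le> q (\<Psi> t - s' n t) + norm (\<Psi> t - S n t)"
          using q_triangle[of "- 1 *\<^sub>R (\<Psi> t - s' n t)" "\<Psi> t - S n t"] q_le_norm[of "\<Psi> t - S n t"] by simp
        then show "ennreal (q (s' n t - S n t)) \<le> ennreal (q (\<Psi> t - s' n t)) + ennreal (norm (\<Psi> t - S n t))"
          by (simp add: ennreal_leI flip: ennreal_plus)
      qed
      also have "\<dots> = (\<integral>\<^sup>+ t. ennreal (q (\<Psi> t - s' n t)) \<partial>M) + e n"
      proof -
        have m: "(\<lambda>t. \<Psi> t - s' n t) \<in> borel_measurable M" "(\<lambda>t. \<Psi> t - S n t) \<in> borel_measurable M"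
          using borel_measurable_scaleC_sum[OF \<psi>_meas s'_simple] borel_measurable_scaleC_sum[OF \<psi>_meas S_simple]
          by (simp_all add: \<Psi>_def)
        have "(\<lambda>t. q (\<Psi> t - s' n t)) \<in> borel_measurable M"
          by (rule measurable_compose[OF m(1) borel_measurable_continuous_onI[OF continuous_q]])
        moreover have "(\<lambda>t. norm (\<Psi> t - S n t)) \<in> borel_measurable M"
          by (rule measurable_compose[OF m(2) borel_measurable_norm])
        ultimately show ?thesis unfolding e_def by (intro nn_integral_add) auto
      qed
      finally have 2: "ennreal (q (?int (s' n) - ?int (S n))) \<le> (\<integral>\<^sup>+ t. ennreal (q (\<Psi> t - s' n t)) \<partial>M) + e n" .
      show ?thesis using 1 2 by (auto simp: ennreal_plus intro: order.trans add_mono)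
    qed
    moreover have "(\<lambda>n. ennreal (q (z - ?int (s' n))) + ((\<integral>\<^sup>+ t. ennreal (q (\<Psi> t - s' n t)) \<partial>M) + e n)
        + ennreal (norm (Y - ?int (S n)))) \<longlonglongrightarrow> ennreal 0 + (0 + 0) + ennreal 0"
    proof (intro tendsto_add tendsto_ennrealI S_lim e_lim)
      show "(\<lambda>n. q (z - ?int (s' n))) \<longlonglongrightarrow> 0" using lim2 unfolding z norm_coset .
      have "(\<integral>\<^sup>+ t. ennreal (coset_norm (coset_diff (F t) (coset_of J (s' n t)))) \<partial>M)
          = (\<integral>\<^sup>+ t. ennreal (q (\<Psi> t - s' n t)) \<partial>M)" for n
        by (intro nn_integral_cong) (simp add: norm_F)
      then show "(\<lambda>n. \<integral>\<^sup>+ t. ennreal (q (\<Psi> t - s' n t)) \<partial>M) \<longlonglongrightarrow> 0" using lim1 by simp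
    qed
    ultimately have "ennreal (q (z - Y)) \<le> ennreal 0 + (0 + 0) + ennreal 0"
      by (intro LIMSEQ_le_const) auto
    then have "q (z - Y) \<le> 0" by (simp add: ennreal_eq_0_iff)
    then have "q (z - Y) = 0" using q_nonneg[of "z - Y"] by simp
    then show ?thesis unfolding z by (simp add: q_zero_iff coset_of_eq_iff)
  qed
  ultimately have "quotient_integral A J M F = coset_of J Y"
    unfolding quotient_integral_def by (intro the_equality)
  then show ?thesis by (simp add: Y_def)
qed

end

section \<open>The algebra \<open>\<C>\<^sub>\<sigma>\<close> and its ideal\<close>

context character
begin

abbreviation "A \<equiv> C_sub D \<sigma>"
abbreviation "J \<equiv> I_ideal D \<sigma>"

lemma A_closed: "closed A" and A_csubspace: "csubspace A" and H_A: "v \<in> H \<Longrightarrow> v \<in> A"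
  unfolding C_sub_def
  by (auto intro: csubspace_closure complex_vector.subspace_span
      subsetD[OF closure_subset complex_vector.span_base])

lemma span_mult_closed:
  assumes S: "\<And>x y. x \<in> S \<Longrightarrow> y \<in> S \<Longrightarrow> x * y \<in> (S :: 'a set)"
    and x: "x \<in> closure (cspan S)" and y: "y \<in> closure (cspan S)"
  shows "x * y \<in> closure (cspan S)"
proof -
  have 1: "x * y \<in> cspan S" if x: "x \<in> cspan S" and y: "y \<in> S" for x y
    using x
  proof (induction rule: complex_vector.span_induct_alt)
    case (step c a b)
    then show ?case using S[OF step(1) y]
      by (simp add: distrib_right mult_scaleC_left complex_vector.span_add complex_vector.span_scale complex_vector.span_base)
  qed (simp add: complex_vector.span_zero)
  have 2: "x * y \<in> cspan S" if x: "x \<in> cspan S" and y: "y \<in> cspan S" for x y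
    using y
  proof (induction rule: complex_vector.span_induct_alt)
    case (step c a b)
    then show ?case using 1[OF x step(1)]
      by (simp add: distrib_left mult_scaleC_right complex_vector.span_add complex_vector.span_scale)
  qed (simp add: complex_vector.span_zero)
  obtain a b where "\<And>n. a n \<in> cspan S" "a \<longlonglongrightarrow> x" "\<And>n. b n \<in> cspan S" "b \<longlonglongrightarrow> y"
    using x y by (auto simp: closure_sequential)
  then have "\<And>n. a n * b n \<in> cspan S" "(\<lambda>n. a n * b n) \<longlonglongrightarrow> x * y"
    using 2 by (auto intro: tendsto_mult)
  then show ?thesis unfolding closure_sequential by (intro exI[of _ "\<lambda>n. a n * b n"]) simp
qed

lemma A_mult: "x \<in> A \<Longrightarrow> y \<in> A \<Longrightarrow> x * y \<in> A"
  unfolding C_sub_def by (rule span_mult_closed[OF H_mult])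

lemma D_A: assumes d: "d \<in> D" shows "d \<in> A"
proof -
  \<comment> \<open>The subtracted scalar makes the value of \<open>\<sigma>\<close> equal to 1, so
    that the remainder lies in \<open>H\<close>.\<close>
  have "d - (\<sigma> d - 1) *\<^sub>C 1 \<in> A" using d by (intro H_A H_D) (auto simp: s_diff s_scaleC)
  moreover have "(\<sigma> d - 1) *\<^sub>C 1 \<in> A"
    using A_csubspace H_A[OF H_one] by (rule complex_vector.subspace_scale)
  ultimately have "d - (\<sigma> d - 1) *\<^sub>C 1 + (\<sigma> d - 1) *\<^sub>C 1 \<in> A"
    using A_csubspace by (intro complex_vector.subspace_add)
  then show ?thesis by simp
qed

lemma B_closed: "closed {x. B x = 0}"
proof -
  have "B x = 0" if "\<And>n. B (a n) = 0" "a \<longlonglongrightarrow> x" for a x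
  proof (rule B_le_zeroI)
    fix e :: real assume "0 < e"
    then obtain n where "dist (a n) x < e" using \<open>a \<longlonglongrightarrow> x\<close> by (auto simp: lim_sequentially)
    then show "B x \<le> e" using B_triangle[of "x - a n" "a n"] B_le_norm[of "x - a n"] \<open>\<And>n. B (a n) = 0\<close>[of n]
      by (simp add: dist_norm norm_minus_commute)
  qed
  then show ?thesis unfolding closed_sequential_limits by blast
qed

lemma B_null_ideal: assumes x: "B x = 0" and a: "a \<in> A" shows "B (a * x) = 0" "B (x * a) = 0"
proof -
  have span: "B (a * x) = 0 \<and> B (x * a) = 0" if "a \<in> cspan H" for a
    using that
  proof (induction rule: complex_vector.span_induct_alt)
    case (step c u b)
    then have "B (c *\<^sub>C (u * x)) = 0" "B (c *\<^sub>C (x * u)) = 0" using x by (auto simp: B_scaleC)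
    then show ?case using step
      by (simp add: distrib_left distrib_right mult_scaleC_left mult_scaleC_right B_add_zero)
  qed simp
  obtain s where s: "\<And>n. s n \<in> cspan H" "s \<longlonglongrightarrow> a"
    using a by (auto simp: C_sub_def closure_sequential)
  have "(\<lambda>n. s n * x) \<longlonglongrightarrow> a * x" "(\<lambda>n. x * s n) \<longlonglongrightarrow> x * a"
    using s(2) by (auto intro!: tendsto_mult)
  then show "B (a * x) = 0" "B (x * a) = 0"
    using closed_sequentially[OF B_closed, of "\<lambda>n. s n * x"] closed_sequentially[OF B_closed, of "\<lambda>n. x * s n"] span s(1)
    by auto
qed

lemma closed_ideal_J: "closed_ideal A J" and ker_J: "d \<in> D \<Longrightarrow> \<sigma> d = 0 \<Longrightarrow> d \<in> J"
proof -
  let ?K = "{d \<in> D. \<sigma> d = 0}"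
  have "closed_ideal A A"
    by (simp add: closed_ideal_def A_csubspace A_closed A_mult)
  then have ne: "A \<in> {t. closed_ideal A t \<and> ?K \<subseteq> t}" using D_A by auto
  have J: "J = \<Inter> {t. closed_ideal A t \<and> ?K \<subseteq> t}" by (simp add: I_ideal_def hull_def)
  show "closed_ideal A J" unfolding closed_ideal_def
  proof (intro conjI ballI)
    show "J \<subseteq> A" using ne J by blast
    show "csubspace J" unfolding J by (intro complex_vector.subspace_Inter) (auto simp: closed_ideal_def)
    show "closed J" unfolding J by (intro closed_Inter) (auto simp: closed_ideal_def)
    show "a * x \<in> J" "x * a \<in> J" if "a \<in> A" "x \<in> J" for a x
      using that unfolding J by (auto simp: closed_ideal_def)
  qed
  show "d \<in> J" if "d \<in> D" "\<sigma> d = 0" using that unfolding J by blast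
qed

text \<open>The null space of \<open>B\<close> in \<open>A\<close> is a closed ideal containing the
  kernel of \<open>\<sigma>\<close>. Conversely \<open>1 - k\<close> lies in \<open>J\<close>, so a
  null \<open>x\<close> agrees modulo \<open>J\<close> with cut-downs \<open>k * x * k\<close> of
  arbitrarily small norm, and \<open>J\<close> is closed.\<close>

lemma J_iff: "x \<in> J \<longleftrightarrow> x \<in> A \<and> B x = 0"
proof
  have "closed_ideal A {x \<in> A. B x = 0}"
    unfolding closed_ideal_def
  proof (intro conjI ballI)
    show "csubspace {x \<in> A. B x = 0}"
      using A_csubspace by (intro complex_vector.subspaceI)
        (auto simp: complex_vector.subspace_0 complex_vector.subspace_add complex_vector.subspace_scale B_scaleC B_add_zero)
    have "{x \<in> A. B x = 0} = A \<inter> {x. B x = 0}" by auto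
    then show "closed {x \<in> A. B x = 0}" using A_closed B_closed by auto
  qed (auto simp: A_mult B_null_ideal)
  moreover have "{d \<in> D. \<sigma> d = 0} \<subseteq> {x \<in> A. B x = 0}"
    using D_A B_ker_left[of _ 1] by auto
  ultimately have "J \<subseteq> {x \<in> A. B x = 0}" unfolding I_ideal_def by (intro hull_minimal)
  then show "x \<in> A \<and> B x = 0" if "x \<in> J" using that by blast
next
  assume x: "x \<in> A \<and> B x = 0"
  have "csubspace J" "closed J" using closed_ideal_J by (auto simp: closed_ideal_def)
  then interpret closed_csubspace J by unfold_locales
  have "q x \<le> \<epsilon>" if \<epsilon>: "0 < \<epsilon>" for \<epsilon>
  proof -
    obtain k where k: "k \<in> D" "\<sigma> k = 1" "norm (k * x * k) < \<epsilon>" using B_less_obtain[of x \<epsilon>] x \<epsilon> by auto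
    have "1 - k \<in> J" using k by (intro ker_J) (auto simp: s_diff)
    then have "(1 - k) * x + k * x * (1 - k) \<in> J"
      using closed_ideal_J x D_A[OF k(1)] A_mult by (intro J_add) (auto simp: closed_ideal_def)
    then have "q x \<le> norm (x - ((1 - k) * x + k * x * (1 - k)))" by (rule q_le)
    also have "x - ((1 - k) * x + k * x * (1 - k)) = k * x * k" by (simp add: algebra_simps)
    finally show ?thesis using k by simp
  qed
  then have "q x \<le> 0" by (rule field_le_epsilon[of _ 0, simplified])
  then show "x \<in> J" using q_nonneg[of x] by (simp flip: q_zero_iff)
qed

sublocale JS: closed_csubspace J
  using closed_ideal_J by unfold_locales (auto simp: closed_ideal_def)

lemma T_hom_cls: assumes v: "v \<in> H" shows "T_hom D \<sigma> (cls v) = coset_of J v"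
  unfolding T_hom_def
proof (rule UN_cls_const[OF v])
  fix w assume "w \<in> H" "B (v - w) = 0"
  then show "coset_of J w = coset_of J v"
    using v H_A A_csubspace
    by (auto simp: JS.coset_of_eq_iff J_iff B_minus_commute complex_vector.subspace_diff)
qed

lemma coset_scale_coset_of: "coset_scale J c (coset_of J x) = coset_of J (c *\<^sub>C x)"
proof -
  have "coset_of J (c *\<^sub>C u) = coset_of J (c *\<^sub>C x)" if "u \<in> coset_of J x" for u
    using that JS.J_scaleC[of "u - x" c] by (simp add: JS.mem_coset_of JS.coset_of_eq_iff scaleC_diff_right)
  moreover have "coset_of J x \<noteq> {}" using JS.mem_coset_of[of x x] by auto
  ultimately show ?thesis unfolding coset_scale_def by auto
qed

end

section \<open>Positive functionals\<close>

lemma star_mult_sum: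
  "(\<Sum>i\<in>I. c i *\<^sub>C v i)\<^sup>\<star> * (\<Sum>j\<in>I. c j *\<^sub>C v j)
    = (\<Sum>i\<in>I. \<Sum>j\<in>I. (cnj (c i) * c j) *\<^sub>C ((v i)\<^sup>\<star> * (v j :: 'a::unital_cstar_algebra)))"
  unfolding star_sum star_scaleC sum_product by (simp add: mult_scaleC_left mult_scaleC_right mult.commute)

locale positive_linear =
  fixes \<tau> :: "'a::unital_cstar_algebra \<Rightarrow> complex"
  assumes positive: "positive_functional \<tau>"
begin

lemma \<tau>_add: "\<tau> (x + y) = \<tau> x + \<tau> y" and \<tau>_scaleC: "\<tau> (c *\<^sub>C x) = c * \<tau> x"
proof -
  interpret Vector_Spaces.linear scaleC "(*)" \<tau>
    using positive by (simp add: positive_functional_def)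
  show "\<tau> (x + y) = \<tau> x + \<tau> y" "\<tau> (c *\<^sub>C x) = c * \<tau> x" by (rule add, rule scale)
qed

lemma \<tau>_zero [simp]: "\<tau> 0 = 0"
  using \<tau>_scaleC[of 0 0] by simp

lemma \<tau>_diff: "\<tau> (x - y) = \<tau> x - \<tau> y"
  using \<tau>_add[of x "(-1) *\<^sub>C y"] \<tau>_scaleC[of "-1" y] by simp

lemma \<tau>_scaleR: "\<tau> (r *\<^sub>R x) = of_real r * \<tau> x"
  by (simp add: \<tau>_scaleC flip: scaleC_of_real)

lemma \<tau>_sum: "\<tau> (\<Sum>i\<in>I. f i) = (\<Sum>i\<in>I. \<tau> (f i))"
  by (induction I rule: infinite_finite_induct) (simp_all add: \<tau>_add)

lemma \<tau>_star_mult: "\<tau> (x\<^sup>\<star> * x) \<in> \<real>\<^sub>\<ge>\<^sub>0"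
  using positive by (simp add: positive_functional_def)

lemma \<tau>_star_mult_Re: "0 \<le> Re (\<tau> (x\<^sup>\<star> * x))" "Im (\<tau> (x\<^sup>\<star> * x)) = 0"
  using \<tau>_star_mult[of x] by (auto simp: complex_nonneg_Reals_iff)

lemma \<tau>_expand:
  "\<tau> ((x + c *\<^sub>C y)\<^sup>\<star> * (x + c *\<^sub>C y)) = \<tau> (x\<^sup>\<star> * x) + c * \<tau> (x\<^sup>\<star> * y) + cnj c * \<tau> (y\<^sup>\<star> * x)
     + cnj c * c * \<tau> (y\<^sup>\<star> * y)"
  by (simp add: star_add star_scaleC distrib_left distrib_right mult_scaleC_left mult_scaleC_right
      \<tau>_add \<tau>_scaleC)

lemma \<tau>_hermitian: "\<tau> (y\<^sup>\<star> * x) = cnj (\<tau> (x\<^sup>\<star> * y))"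
  using \<tau>_star_mult_Re(2)[of "x + 1 *\<^sub>C y"] \<tau>_star_mult_Re(2)[of "x + \<i> *\<^sub>C y"]
    \<tau>_star_mult_Re(2)[of x] \<tau>_star_mult_Re(2)[of y]
  unfolding \<tau>_expand by (auto simp: complex_eq_iff)

lemma Cauchy_Schwarz: "(cmod (\<tau> (x\<^sup>\<star> * y)))\<^sup>2 \<le> Re (\<tau> (x\<^sup>\<star> * x)) * Re (\<tau> (y\<^sup>\<star> * y))"
proof -
  define a b t where "a = Re (\<tau> (x\<^sup>\<star> * x))" and "b = Re (\<tau> (y\<^sup>\<star> * y))" and "t = \<tau> (x\<^sup>\<star> * y)"
  have ab: "\<tau> (x\<^sup>\<star> * x) = of_real a" "\<tau> (y\<^sup>\<star> * y) = of_real b" "0 \<le> a" "0 \<le> b"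
    using \<tau>_star_mult_Re by (auto simp: a_def b_def complex_eq_iff)
  have quad: "0 \<le> a - 2 * s * (cmod t)\<^sup>2 + s * s * (cmod t)\<^sup>2 * b" for s
  proof -
    \<comment> \<open>The phase is chosen so that both cross terms become
      \<open>- s * (cmod t)\<^sup>2\<close>.\<close>
    define c where "c = - (of_real s * cnj t)"
    have t2: "cnj t * t = of_real ((cmod t)\<^sup>2)" by (simp only: complex_norm_square mult.commute)
    have "\<tau> ((x + c *\<^sub>C y)\<^sup>\<star> * (x + c *\<^sub>C y))
        = of_real a - 2 * of_real s * (cnj t * t) + of_real (s * s) * (cnj t * t) * of_real b"
      unfolding \<tau>_expand \<tau>_hermitian[of y x] ab t_def[symmetric] by (simp add: c_def algebra_simps)
    then have "\<tau> ((x + c *\<^sub>C y)\<^sup>\<star> * (x + c *\<^sub>C y))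
        = of_real (a - 2 * s * (cmod t)\<^sup>2 + s * s * (cmod t)\<^sup>2 * b)"
      unfolding t2 by simp
    then show ?thesis using \<tau>_star_mult_Re(1)[of "x + c *\<^sub>C y"] by simp
  qed
  have "(cmod t)\<^sup>2 \<le> a * b"
  proof (cases "b = 0")
    case True
    have "t = 0"
    proof (rule ccontr)
      assume "t \<noteq> 0"
      \<comment> \<open>At this value of \<open>s\<close> the quadratic expression equals
        -1.\<close>
      then have "2 * ((a + 1) / (2 * (cmod t)\<^sup>2)) * (cmod t)\<^sup>2 = a + 1" by simp
      then show False using quad[of "(a + 1) / (2 * (cmod t)\<^sup>2)"] True by simp
    qed
    then show ?thesis using ab by simp
  next
    case False
    then have "0 < b" using ab by simp
    then show ?thesis using quad[of "1 / b"] by (simp add: field_simps power2_eq_square)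
  qed
  then show ?thesis by (simp add: a_def b_def t_def)
qed

lemma zero_of_Cauchy_Schwarz:
  "\<tau> (x\<^sup>\<star> * x) = 0 \<Longrightarrow> \<tau> (x\<^sup>\<star> * y) = 0" "\<tau> (y\<^sup>\<star> * y) = 0 \<Longrightarrow> \<tau> (x\<^sup>\<star> * y) = 0"
  using Cauchy_Schwarz[of x y] by auto

text \<open>For \<open>norm y < 1\<close> the element \<open>1 - y\<^sup>\<star> * y\<close> is the
  square of a self-adjoint \<open>k\<close>, so \<open>\<tau> (y\<^sup>\<star> * y) \<le> 1\<close>;
  Cauchy-Schwarz against 1 then bounds \<open>\<tau> y\<close>.\<close>

lemma \<tau>_bound: assumes one: "\<tau> 1 = 1" shows "cmod (\<tau> x) \<le> norm x"
proof -
  have ball: "cmod (\<tau> y) \<le> 1" if y: "norm y < 1" for y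
  proof -
    have "norm (y\<^sup>\<star> * y) < 1" using y by (simp add: cstar_identity power_less_one_iff)
    then obtain k where k: "k\<^sup>\<star> = k" "k * k = 1 - y\<^sup>\<star> * y"
      using sqrt_one_minus[of UNIV "y\<^sup>\<star> * y"] by (auto simp: star_mult)
    have "0 \<le> Re (\<tau> (1 - y\<^sup>\<star> * y))" using \<tau>_star_mult_Re(1)[of k] k by simp
    then have "Re (\<tau> (y\<^sup>\<star> * y)) \<le> 1" using one by (simp add: \<tau>_diff)
    then have "(cmod (\<tau> y))\<^sup>2 \<le> 1" using Cauchy_Schwarz[of 1 y] one by simp
    then show ?thesis using power2_le_imp_le[of "cmod (\<tau> y)" 1] by simp
  qed
  show ?thesis
  proof (rule dense_ge)
    fix c assume c: "norm x < c"
    then have "0 < c" using norm_ge_zero[of x] by linarith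
    then have "cmod (\<tau> ((1 / c) *\<^sub>R x)) \<le> 1" using c by (intro ball) simp
    then show "cmod (\<tau> x) \<le> c" using \<open>0 < c\<close> by (simp add: \<tau>_scaleR norm_mult norm_divide)
  qed
qed

end

section \<open>From states to pre-homomorphisms\<close>

locale state_over = character D \<sigma> + positive_linear \<tau>
  for D :: "'a::unital_cstar_algebra set" and \<sigma> \<tau> +
  assumes state_over: "\<tau> \<in> compatible_states_over D \<sigma>"
begin

lemma \<tau>_D: "d \<in> D \<Longrightarrow> \<tau> d = \<sigma> d"
  using state_over by (auto simp: compatible_states_over_def)

lemma \<tau>_one [simp]: "\<tau> 1 = 1"
  by (simp add: \<tau>_D)

text \<open>For \<open>a = d - \<sigma> d\<close> one has \<open>\<tau> (a * a\<^sup>\<star>) =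
  \<sigma> (a * a\<^sup>\<star>) = 0\<close>, and Cauchy-Schwarz gives
  \<open>\<tau> (a * x) = 0\<close>.\<close>

lemma \<tau>_scale_left: assumes d: "d \<in> D" shows "\<tau> (d * x) = \<sigma> d * \<tau> x"
proof -
  define a where "a = d - \<sigma> d *\<^sub>C 1"
  have a: "a \<in> D" "\<sigma> a = 0" using d by (auto simp: a_def s_diff s_scaleC)
  have "\<tau> ((a\<^sup>\<star>)\<^sup>\<star> * x) = 0"
    by (rule zero_of_Cauchy_Schwarz) (use a in \<open>simp add: \<tau>_D s_mult\<close>)
  then show ?thesis by (simp add: a_def left_diff_distrib mult_scaleC_left \<tau>_diff \<tau>_scaleC)
qed

lemma \<tau>_scale_right: assumes d: "d \<in> D" shows "\<tau> (x * d) = \<sigma> d * \<tau> x"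
proof -
  define a where "a = d - \<sigma> d *\<^sub>C 1"
  have a: "a \<in> D" "\<sigma> a = 0" using d by (auto simp: a_def s_diff s_scaleC)
  have "\<tau> ((x\<^sup>\<star>)\<^sup>\<star> * a) = 0"
    by (rule zero_of_Cauchy_Schwarz) (use a in \<open>simp add: \<tau>_D s_mult\<close>)
  then show ?thesis by (simp add: a_def right_diff_distrib mult_scaleC_right \<tau>_diff \<tau>_scaleC)
qed

lemma \<tau>_le_B: "cmod (\<tau> x) \<le> B x"
proof (rule B_greatest)
  fix d e assume "d \<in> D" "e \<in> D" "\<sigma> d = 1" "\<sigma> e = 1"
  then have "\<tau> (d * x * e) = \<tau> x" by (simp add: \<tau>_scale_left \<tau>_scale_right)
  then show "cmod (\<tau> x) \<le> norm (d * x * e)" using \<tau>_bound[of "d * x * e"] by simp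
qed

lemma \<tau>_eq_of_B: "B (x - y) = 0 \<Longrightarrow> \<tau> x = \<tau> y"
  using \<tau>_le_B[of "x - y"] by (simp add: \<tau>_diff)

lemma \<tau>_respects: "\<tau> respects R1 D \<sigma>"
  by (rule congruentI) (simp add: R1_iff \<tau>_eq_of_B)

lemma tilde_cls: assumes v: "v \<in> H" shows "tilde D \<sigma> \<tau> (cls v) = \<tau> v"
proof -
  have "\<tau> ` cls v = {\<tau> v}"
  proof -
    have "v \<in> cls v" using v by (simp add: mem_cls_iff)
    moreover have "\<tau> w = \<tau> v" if "w \<in> cls v" for w
      using that \<tau>_eq_of_B[of v w] by (simp add: mem_cls_iff)
    ultimately show ?thesis by blast
  qed
  then show ?thesis using v by (simp add: tilde_def)
qed

lemma tilde_pHom: "tilde D \<sigma> \<tau> \<in> pHom 1 G X \<iota>"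
proof -
  have "tilde D \<sigma> \<tau> \<in> extensional (carrier G)" by (simp add: tilde_def)
  moreover have "continuous_map X euclidean (tilde D \<sigma> \<tau>)"
  proof (rule continuous_on_X)
    fix x and e :: real assume x: "x \<in> carrier G" and e: "0 < e"
    show "\<exists>r>0. \<forall>y\<in>carrier G. gdist x y < r \<longrightarrow> dist (tilde D \<sigma> \<tau> x) (tilde D \<sigma> \<tau> y) < e"
    proof (intro exI[of _ e] conjI ballI impI e)
      fix y assume y: "y \<in> carrier G" "gdist x y < e"
      obtain v w where vw: "v \<in> H" "w \<in> H" "x = cls v" "y = cls w" using x y by (auto simp: carrier_G)
      then show "dist (tilde D \<sigma> \<tau> x) (tilde D \<sigma> \<tau> y) < e"
        using \<tau>_le_B[of "v - w"] y by (simp add: tilde_cls dist_norm \<tau>_diff)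
    qed
  qed
  moreover have "positive_semidefinite n (\<lambda>i j. tilde D \<sigma> \<tau> (inv\<^bsub>G\<^esub> (g i) \<otimes>\<^bsub>G\<^esub> g j))"
    if g: "\<forall>i<n. g i \<in> carrier G" for n g
    unfolding positive_semidefinite_def
  proof
    fix c :: "nat \<Rightarrow> complex"
    have "\<exists>v. i < n \<longrightarrow> v \<in> H \<and> g i = cls v" for i using g by (auto simp: carrier_G)
    then obtain v where v: "\<And>i. i < n \<Longrightarrow> v i \<in> H" "\<And>i. i < n \<Longrightarrow> g i = cls (v i)" by metis
    define x where "x = (\<Sum>j<n. c j *\<^sub>C v j)"
    have "x\<^sup>\<star> * x = (\<Sum>i<n. \<Sum>j<n. (cnj (c i) * c j) *\<^sub>C ((v i)\<^sup>\<star> * v j))"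
      unfolding x_def by (rule star_mult_sum)
    then have "\<tau> (x\<^sup>\<star> * x) = (\<Sum>i<n. \<Sum>j<n. cnj (c i) * c j * \<tau> ((v i)\<^sup>\<star> * v j))"
      by (simp add: \<tau>_sum \<tau>_scaleC)
    also have "\<dots> = (\<Sum>i<n. \<Sum>j<n. cnj (c i) * tilde D \<sigma> \<tau> (inv\<^bsub>G\<^esub> (g i) \<otimes>\<^bsub>G\<^esub> g j) * c j)"
      using v by (intro sum.cong refl) (simp add: inv_G H_star H_mult tilde_cls)
    finally show "(\<Sum>i<n. \<Sum>j<n. cnj (c i) * tilde D \<sigma> \<tau> (inv\<^bsub>G\<^esub> (g i) \<otimes>\<^bsub>G\<^esub> g j) * c j) \<in> \<real>\<^sub>\<ge>\<^sub>0"
      using \<tau>_star_mult[of x] by simp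
  qed
  moreover have "cmod (tilde D \<sigma> \<tau> x) \<in> {0, 1}" if "x \<in> carrier G" for x
  proof -
    obtain v where v: "v \<in> H" "x = cls v" using \<open>x \<in> carrier G\<close> by (auto simp: carrier_G)
    have "complex_of_real ((cmod (\<tau> v))\<^sup>2) \<in> {0, \<tau> (v\<^sup>\<star> * v)}"
      using state_over H_N[OF v(1)] by (auto simp: compatible_states_over_def compatible_states_def)
    moreover have "\<tau> (v\<^sup>\<star> * v) = 1" using v N_D_one[OF H_N] by (simp add: \<tau>_D H_s_one)
    ultimately have "complex_of_real ((cmod (\<tau> v))\<^sup>2) \<in> of_real ` {0, 1}" by simp
    then have "(cmod (\<tau> v))\<^sup>2 \<in> {0, 1}" by (auto simp del: of_real_power)
    then show ?thesis using v by (auto simp: tilde_cls power2_eq_1_iff) (smt (verit) norm_ge_zero)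
  qed
  moreover have "has_index G \<iota> (tilde D \<sigma> \<tau>) 1"
    unfolding has_index_def by (auto simp: carrier_G H_scaleC tilde_cls \<tau>_scaleC)
  ultimately show ?thesis
    by (simp add: pHom_def pre_homomorphism_def positive_definite_def one_G tilde_cls)
qed

lemma \<tau>_le_quotient_norm: "cmod (\<tau> y) \<le> JS.q y"
proof (rule JS.q_greatest)
  fix j assume "j \<in> J"
  then have "\<tau> (y - j) = \<tau> y" using \<tau>_le_B[of j] by (simp add: J_iff \<tau>_diff)
  then show "cmod (\<tau> y) \<le> norm (y - j)" using \<tau>_bound[of "y - j"] by simp
qed

end

section \<open>Integrals over finitely many cosets, and domination of states\<close>

context masa_character
begin

text \<open>A point \<open>t\<close> of the coset of \<open>u i\<close> is the class of
  \<open>co (u i) t\<close> times \<open>u i\<close>, so \<open>T_hom\<close> and any function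
  homogeneous of degree one acquire the same scalar factor. The cosets of the \<open>u i\<close> may
  coincide, which lets the lemma serve both a partition of a support and an arbitrary finite family
  in \<open>H\<close>.\<close>

lemma integrals_of_orb_sum:
  assumes I: "finite I" and u: "\<And>i. i \<in> I \<Longrightarrow> u i \<in> H"
    and \<phi>: "\<And>t. t \<in> carrier G \<Longrightarrow> \<phi> t = (\<Sum>i\<in>I. \<phi>' i t)"
    and supp: "\<And>i t. i \<in> I \<Longrightarrow> t \<in> carrier G \<Longrightarrow> t \<notin> orb (u i) \<Longrightarrow> \<phi>' i t = 0"
    and int: "\<And>i. i \<in> I \<Longrightarrow> integrable M (\<lambda>t. \<phi>' i t * co (u i) t)"
  shows "quotient_integral A J M (\<lambda>t. coset_scale J (\<phi> t) (T_hom D \<sigma> t))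
      = coset_of J (\<Sum>i\<in>I. (\<integral>t. \<phi>' i t * co (u i) t \<partial>M) *\<^sub>C u i)" (is ?quotient)
    and "(\<And>z v. cmod z = 1 \<Longrightarrow> v \<in> H \<Longrightarrow> f (cls (z *\<^sub>C v)) = z * f (cls v)) \<Longrightarrow>
      (\<integral>t. \<phi> t * f t \<partial>M) = (\<Sum>i\<in>I. (\<integral>t. \<phi>' i t * co (u i) t \<partial>M) * f (cls (u i)))"
proof -
  show ?quotient
  proof (rule JS.quotient_integral_scaleC_sum[OF A_csubspace I H_A[OF u] int])
    fix t assume "t \<in> space M"
    then obtain w where w: "w \<in> H" "t = cls w" by (auto simp: carrier_G)
    have diff: "\<phi>' i t *\<^sub>C w - (\<phi>' i t * co (u i) t) *\<^sub>C u i \<in> J" if i: "i \<in> I" for i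
    proof (cases "t \<in> orb (u i)")
      case True
      then have co: "cmod (co (u i) t) = 1" "t = cls (co (u i) t *\<^sub>C u i)" using co_orb u i by auto
      then have "B (w - co (u i) t *\<^sub>C u i) = 0"
        using cls_eq_iff[of w "co (u i) t *\<^sub>C u i"] w u[OF i] by (simp add: H_scaleC)
      then have "w - co (u i) t *\<^sub>C u i \<in> J"
        using w u[OF i] co H_A A_csubspace by (simp add: J_iff complex_vector.subspace_diff H_scaleC)
      from JS.J_scaleC[OF this, of "\<phi>' i t"] show ?thesis by (simp add: scaleC_diff_right)
    next
      case False
      then show ?thesis using supp[OF i] w by simp
    qed
    have "(\<Sum>i\<in>I. \<phi>' i t) *\<^sub>C w - (\<Sum>i\<in>I. (\<phi>' i t * co (u i) t) *\<^sub>C u i)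
        = (\<Sum>i\<in>I. \<phi>' i t *\<^sub>C w - (\<phi>' i t * co (u i) t) *\<^sub>C u i)"
      by (simp add: complex_vector.scale_sum_left sum_subtractf)
    also have "\<dots> \<in> J" using JS.J_csubspace diff by (intro complex_vector.subspace_sum)
    finally show "coset_scale J (\<phi> t) (T_hom D \<sigma> t) = coset_of J (\<Sum>i\<in>I. (\<phi>' i t * co (u i) t) *\<^sub>C u i)"
      using w \<phi>[of t] by (simp add: T_hom_cls coset_scale_coset_of JS.coset_of_eq_iff)
  qed
  assume f: "\<And>z v. cmod z = 1 \<Longrightarrow> v \<in> H \<Longrightarrow> f (cls (z *\<^sub>C v)) = z * f (cls v)"
  have "\<phi> t * f t = (\<Sum>i\<in>I. \<phi>' i t * co (u i) t * f (cls (u i)))" if t: "t \<in> space M" for t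
  proof -
    have "\<phi>' i t * f t = \<phi>' i t * co (u i) t * f (cls (u i))" if i: "i \<in> I" for i
    proof (cases "t \<in> orb (u i)")
      case True
      then have "f t = co (u i) t * f (cls (u i))" using co_orb[OF u[OF i]] f u[OF i] by metis
      then show ?thesis by simp
    qed (use supp i t in simp)
    then have "(\<Sum>i\<in>I. \<phi>' i t * f t) = (\<Sum>i\<in>I. \<phi>' i t * co (u i) t * f (cls (u i)))"
      by (rule sum.cong[OF refl])
    then show ?thesis using \<phi>[of t] t by (simp add: sum_distrib_right)
  qed
  then have "(\<integral>t. \<phi> t * f t \<partial>M) = (\<integral>t. (\<Sum>i\<in>I. \<phi>' i t * co (u i) t * f (cls (u i))) \<partial>M)"
    by (intro Bochner_Integration.integral_cong) auto
  also have "\<dots> = (\<Sum>i\<in>I. \<integral>t. \<phi>' i t * co (u i) t * f (cls (u i)) \<partial>M)"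
    using int by (intro Bochner_Integration.integral_sum integrable_mult_left) auto
  also have "\<dots> = (\<Sum>i\<in>I. (\<integral>t. \<phi>' i t * co (u i) t \<partial>M) * f (cls (u i)))" by simp
  finally show "(\<integral>t. \<phi> t * f t \<partial>M) = (\<Sum>i\<in>I. (\<integral>t. \<phi>' i t * co (u i) t \<partial>M) * f (cls (u i)))" .
qed

lemma integrable_orb_bounded:
  assumes v: "v \<in> H" and g: "g \<in> borel_measurable M"
    and bound: "\<And>t. t \<in> carrier G \<Longrightarrow> cmod (g t) \<le> b * indicator (orb v) t"
  shows "integrable M g"
proof (rule Bochner_Integration.integrable_bound[OF _ g])
  show "integrable M (\<lambda>t. b * indicator (orb v) t :: real)"
    using v emeasure_orb[OF v] by (intro integrable_mult_right integrable_real_indicator) auto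
  show "AE t in M. norm (g t) \<le> norm (b * indicator (orb v) t)"
  proof (rule AE_I2)
    fix t assume "t \<in> space M"
    then have "cmod (g t) \<le> b * indicator (orb v) t" using bound by simp
    then show "norm (g t) \<le> norm (b * indicator (orb v) t)" using abs_ge_self order.trans unfolding real_norm_def by blast
  qed
qed

end

locale masa_state_over = masa_character D \<sigma> + state_over D \<sigma> \<tau>
  for D :: "'a::unital_cstar_algebra set" and \<sigma> \<tau>
begin

lemma tilde_dominated: "dominated D \<sigma> (tilde D \<sigma> \<tau>)"
  unfolding dominated_def
proof
  fix \<phi> assume "\<phi> \<in> compactly_supported X"
  then have cont: "continuous_map X euclidean \<phi>"
    and K: "compactin X (X closure_of {t \<in> topspace X. \<phi> t \<noteq> 0})" (is "compactin X ?K")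
    by (auto simp: compactly_supported_def)
  have suppK: "t \<in> ?K" if "t \<in> carrier G" "\<phi> t \<noteq> 0" for t
    using that closure_of_subset[of "{t \<in> topspace X. \<phi> t \<noteq> 0}" X] by auto
  obtain F where F: "finite F" "F \<subseteq> H" "inj_on orb F" "?K \<subseteq> (\<Union>v\<in>F. orb v)"
    by (rule finite_orbs_of_compact[OF K])
  have "compactin euclidean (\<phi> ` ?K)" by (rule image_compactin[OF K cont])
  then have "bounded (\<phi> ` ?K)" by (simp only: compactin_euclidean_iff compact_imp_bounded)
  then obtain b where "\<And>z. z \<in> \<phi> ` ?K \<Longrightarrow> cmod z \<le> b" unfolding bounded_iff by metis
  then have b: "cmod (\<phi> t) \<le> b" if "t \<in> ?K" for t using imageI[OF that] by metis
  define \<phi>' where "\<phi>' = (\<lambda>v t. \<phi> t * indicator (orb v) t)"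
  have prod: "\<phi>' v t * co v t = \<phi> t * co v t" for v t
    by (cases "t \<in> orb v") (auto simp: \<phi>'_def co_outside)
  have int: "integrable M (\<lambda>t. \<phi>' v t * co v t)" if v: "v \<in> F" for v
    unfolding prod
  \<comment> \<open>The maximum with 0 handles points of the coset where \<open>\<phi>\<close>
    vanishes; \<open>b\<close> may be negative when the support is empty.\<close>
  proof (rule integrable_orb_bounded[where v = v and b = "max b 0"])
    show vH: "v \<in> H" using F v by blast
    show "(\<lambda>t. \<phi> t * co v t) \<in> borel_measurable M"
      using continuous_measurable_M[OF cont] continuous_measurable_M[OF continuous_co[OF vH]] by measurable
    fix t assume t: "t \<in> carrier G"
    show "cmod (\<phi> t * co v t) \<le> max b 0 * indicator (orb v) t"
    proof (cases "t \<in> orb v \<and> \<phi> t \<noteq> 0")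
      case True
      then have "cmod (\<phi> t) \<le> b" using b suppK t by blast
      then show ?thesis using True co_orb[OF vH] by (simp add: norm_mult)
    qed (auto simp: co_outside)
  qed
  have sum: "\<phi> t = (\<Sum>v\<in>F. \<phi>' v t)" if t: "t \<in> carrier G" for t
  proof (cases "\<phi> t = 0")
    case False
    then obtain v where v: "v \<in> F" "t \<in> orb v" using suppK t F by blast
    \<comment> \<open>By injectivity of \<open>orb\<close> on \<open>F\<close> the cosets are
      disjoint, so a single summand survives.\<close>
    have "t \<notin> orb w" if "w \<in> F" "w \<noteq> v" for w
      using orb_eq[of v w t] v that F by (auto dest: inj_onD)
    then have "(\<Sum>w\<in>F. \<phi>' w t) = (\<Sum>w\<in>F. if w = v then \<phi> t else 0)"
      using v by (intro sum.cong) (auto simp: \<phi>'_def)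
    then show ?thesis using F v by simp
  qed (simp add: \<phi>'_def)
  have supp: "\<phi>' v t = 0" if "t \<notin> orb v" for v t using that by (simp add: \<phi>'_def)
  define y where "y = (\<Sum>v\<in>F. (\<integral>t. \<phi>' v t * co v t \<partial>M) *\<^sub>C v)"
  have FH: "v \<in> H" if "v \<in> F" for v using F that by blast
  have "quotient_integral A J M (\<lambda>t. coset_scale J (\<phi> t) (T_hom D \<sigma> t)) = coset_of J y"
    unfolding y_def by (rule integrals_of_orb_sum(1)[OF F(1) FH sum supp int])
  moreover have "(\<integral>t. \<phi> t * tilde D \<sigma> \<tau> t \<partial>M) = (\<Sum>v\<in>F. (\<integral>t. \<phi>' v t * co v t \<partial>M) * tilde D \<sigma> \<tau> (cls v))"
    by (rule integrals_of_orb_sum(2)[OF F(1) FH sum supp int]) (simp_all add: tilde_cls H_scaleC \<tau>_scaleC)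
  then have "(\<integral>t. \<phi> t * tilde D \<sigma> \<tau> t \<partial>M) = \<tau> y"
    using FH by (simp add: y_def \<tau>_sum \<tau>_scaleC tilde_cls)
  ultimately show "cmod (\<integral>t. \<phi> t * tilde D \<sigma> \<tau> t \<partial>M)
      \<le> coset_norm (quotient_integral A J M (\<lambda>t. coset_scale J (\<phi> t) (T_hom D \<sigma> t)))"
    using \<tau>_le_quotient_norm[of y] by (simp add: JS.q_def)
qed

lemma tilde_M_set: "tilde D \<sigma> \<tau> \<in> M_set D \<sigma>"
  using tilde_pHom tilde_dominated by (simp add: M_set_def)

end

context masa_character
begin

lemma masa_state_overI: "\<tau> \<in> compatible_states_over D \<sigma> \<Longrightarrow> masa_state_over D \<sigma> \<tau>"
  by unfold_locales (auto simp: compatible_states_over_def compatible_states_def state_def)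

lemma tilde_inj:
  assumes dense: "closure (cspan N) = UNIV"
    and \<tau>1: "\<tau>1 \<in> compatible_states_over D \<sigma>" and \<tau>2: "\<tau>2 \<in> compatible_states_over D \<sigma>"
    and eq: "tilde D \<sigma> \<tau>1 = tilde D \<sigma> \<tau>2"
  shows "\<tau>1 = \<tau>2"
proof
  fix x
  interpret t1: masa_state_over D \<sigma> \<tau>1 by (rule masa_state_overI[OF \<tau>1])
  interpret t2: masa_state_over D \<sigma> \<tau>2 by (rule masa_state_overI[OF \<tau>2])
  have H: "\<tau>1 v = \<tau>2 v" if "v \<in> H" for v
    using t1.tilde_cls[OF that] t2.tilde_cls[OF that] eq by simp
  have N: "\<tau>1 v = \<tau>2 v" if "v \<in> N" for v
    using that
  proof (cases v rule: N_cases)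
    case 1
    then show ?thesis using t1.\<tau>_le_B[of v] t2.\<tau>_le_B[of v] by simp
  qed (simp add: t1.\<tau>_scaleR t2.\<tau>_scaleR H)
  have span: "\<tau>1 y = \<tau>2 y" if "y \<in> cspan N" for y
    using that
    by (induction rule: complex_vector.span_induct_alt)
      (simp_all add: t1.\<tau>_add t2.\<tau>_add t1.\<tau>_scaleC t2.\<tau>_scaleC N)
  obtain s where s: "\<And>n. s n \<in> cspan N" "s \<longlonglongrightarrow> x"
    using dense by (metis UNIV_I closure_sequential)
  have "(\<lambda>n. norm (s n - x)) \<longlonglongrightarrow> 0" using s(2) by (simp add: LIM_zero tendsto_norm_zero)
  then have "(\<lambda>n. \<tau>1 (s n) - \<tau>1 x) \<longlonglongrightarrow> 0" "(\<lambda>n. \<tau>2 (s n) - \<tau>2 x) \<longlonglongrightarrow> 0"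
    using t1.\<tau>_bound[OF t1.\<tau>_one] t2.\<tau>_bound[OF t2.\<tau>_one]
    by (auto intro!: Lim_null_comparison[of _ "\<lambda>n. norm (s n - x)"] simp flip: t1.\<tau>_diff t2.\<tau>_diff)
  then have "(\<lambda>n. \<tau>1 (s n)) \<longlonglongrightarrow> \<tau>1 x" "(\<lambda>n. \<tau>2 (s n)) \<longlonglongrightarrow> \<tau>2 x"
    by (simp_all add: LIM_zero_iff)
  then show "\<tau>1 x = \<tau>2 x" using span[OF s(1)] LIMSEQ_unique by simp
qed

end

section \<open>From pre-homomorphisms to states\<close>

locale dominated_pre_hom = masa_character +
  fixes f :: "'a set \<Rightarrow> complex"
  assumes f: "f \<in> M_set D \<sigma>"
begin

lemma f_one: "f (cls 1) = 1"
  and f_norm: "v \<in> H \<Longrightarrow> cmod (f (cls v)) \<in> {0, 1}"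
  and f_extensional: "f \<in> extensional (carrier G)"
  using f by (auto simp: M_set_def pHom_def pre_homomorphism_def positive_definite_def one_G)

lemma f_scaleC:
  assumes "cmod z = 1" "v \<in> H"
  shows "f (cls (z *\<^sub>C v)) = z * f (cls v)"
proof -
  have "has_index G \<iota> f 1" using f by (simp add: M_set_def pHom_def)
  then have "f (\<iota> z \<otimes>\<^bsub>G\<^esub> cls v) = z powi 1 * f (cls v)"
    using assms unfolding has_index_def by (metis cls_carrier mem_sphere_0)
  then show ?thesis using assms by simp
qed

lemma f_cls_cong: "v \<in> H \<Longrightarrow> w \<in> H \<Longrightarrow> B (v - w) = 0 \<Longrightarrow> f (cls v) = f (cls w)"
  using cls_eq_iff[of v w] by simp

text \<open>Positive definiteness is given for families indexed by an initial segment; an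
  enumeration moves it to finite index sets, the form in which classes of normalizers arise.\<close>

lemma f_positive_definite:
  assumes S: "finite S" and u: "\<And>a. a \<in> S \<Longrightarrow> u a \<in> H"
  shows "(\<Sum>a\<in>S. \<Sum>b\<in>S. cnj (c a) * f (cls ((u a)\<^sup>\<star> * u b)) * c b) \<in> \<real>\<^sub>\<ge>\<^sub>0"
proof -
  obtain h where h: "bij_betw h {..<card S} S"
    using ex_bij_betw_nat_finite[OF S] by (auto simp: atLeast0LessThan)
  have hS: "h i \<in> S" if "i < card S" for i using h that by (auto simp: bij_betw_def)
  have "positive_definite G X f" using f by (simp add: M_set_def pHom_def pre_homomorphism_def)
  then have "positive_semidefinite (card S) (\<lambda>i j. f (inv\<^bsub>G\<^esub> (cls (u (h i))) \<otimes>\<^bsub>G\<^esub> cls (u (h j))))"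
    using hS u unfolding positive_definite_def by (elim conjE allE[of _ "card S"]) (auto dest: spec[of _ "\<lambda>i. cls (u (h i))"])
  then have "(\<Sum>i<card S. \<Sum>j<card S. cnj (c (h i)) * f (inv\<^bsub>G\<^esub> (cls (u (h i))) \<otimes>\<^bsub>G\<^esub> cls (u (h j))) * c (h j)) \<in> \<real>\<^sub>\<ge>\<^sub>0"
    unfolding positive_semidefinite_def by (rule spec)
  also have "(\<Sum>i<card S. \<Sum>j<card S. cnj (c (h i)) * f (inv\<^bsub>G\<^esub> (cls (u (h i))) \<otimes>\<^bsub>G\<^esub> cls (u (h j))) * c (h j))
      = (\<Sum>i<card S. \<Sum>j<card S. cnj (c (h i)) * f (cls ((u (h i))\<^sup>\<star> * u (h j))) * c (h j))"
    using hS u by (intro sum.cong refl) (simp add: inv_G H_star)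
  also have "\<dots> = (\<Sum>i<card S. \<Sum>b\<in>S. cnj (c (h i)) * f (cls ((u (h i))\<^sup>\<star> * u b)) * c b)"
    by (intro sum.cong refl sum.reindex_bij_betw[OF h])
  also have "\<dots> = (\<Sum>a\<in>S. \<Sum>b\<in>S. cnj (c a) * f (cls ((u a)\<^sup>\<star> * u b)) * c b)"
    by (rule sum.reindex_bij_betw[OF h])
  finally show ?thesis .
qed

text \<open>The test function is \<open>c\<^sub>i\<close> times the conjugate coordinate on the coset of \<open>u\<^sub>i\<close>; this cancels
  the phase of both \<open>f\<close> and \<open>T\<^sub>\<sigma>\<close>.\<close>

lemma f_sum_le_norm:
  assumes I: "finite I" and u: "\<And>i. i \<in> I \<Longrightarrow> u i \<in> H"
  shows "cmod (\<Sum>i\<in>I. c i * f (cls (u i))) \<le> norm (\<Sum>i\<in>I. c i *\<^sub>C u i)"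
proof -
  define \<phi>' where "\<phi>' = (\<lambda>i t. c i * cnj (co (u i) t))"
  define \<phi> where "\<phi> = (\<lambda>t. \<Sum>i\<in>I. \<phi>' i t)"
  have "continuous_map X euclidean (\<lambda>t. \<phi>' i t)" if i: "i \<in> I" for i
  proof -
    have "continuous_on UNIV (\<lambda>z. c i * cnj z)" by (intro continuous_intros)
    then have "continuous_map euclidean euclidean (\<lambda>z. c i * cnj z)" by simp
    from continuous_map_compose[OF continuous_co[OF u[OF i]] this] show ?thesis
      by (simp add: \<phi>'_def o_def)
  qed
  then have cont: "continuous_map X euclidean \<phi>"
    unfolding \<phi>_def using I by (intro continuous_map_sum) auto
  have supp: "\<phi>' i t = 0" if "t \<notin> orb (u i)" for i t using that by (simp add: \<phi>'_def co_outside)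
  have "compactin X (\<Union> ((\<lambda>i. orb (u i)) ` I))"
    using I u by (intro compactin_Union) (auto simp: compactin_orb)
  moreover have "X closure_of {t \<in> topspace X. \<phi> t \<noteq> 0} \<subseteq> \<Union> ((\<lambda>i. orb (u i)) ` I)"
  proof (rule closure_of_minimal)
    have "t \<in> \<Union> ((\<lambda>i. orb (u i)) ` I)" if "\<phi> t \<noteq> 0" for t
    proof (rule ccontr)
      assume "t \<notin> \<Union> ((\<lambda>i. orb (u i)) ` I)"
      then have "\<phi> t = 0" unfolding \<phi>_def by (intro sum.neutral) (auto simp: supp)
      then show False using that by simp
    qed
    then show "{t \<in> topspace X. \<phi> t \<noteq> 0} \<subseteq> \<Union> ((\<lambda>i. orb (u i)) ` I)" by blast
    show "closedin X (\<Union> ((\<lambda>i. orb (u i)) ` I))"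
      using \<open>compactin X _\<close> GM.Hausdorff_space_mtopology unfolding X_def by (rule compactin_imp_closedin[rotated])
  qed
  ultimately have "compactin X (X closure_of {t \<in> topspace X. \<phi> t \<noteq> 0})"
    by (rule closed_compactin) simp
  then have "\<phi> \<in> compactly_supported X" using cont by (simp add: compactly_supported_def)
  then have dom: "cmod (\<integral>t. \<phi> t * f t \<partial>M)
      \<le> coset_norm (quotient_integral A J M (\<lambda>t. coset_scale J (\<phi> t) (T_hom D \<sigma> t)))"
    using f unfolding M_set_def dominated_def by blast
  have prod: "\<phi>' i t * co (u i) t = c i * indicator (orb (u i)) t" if i: "i \<in> I" for i t
  proof (cases "t \<in> orb (u i)")
    case True
    then have "cmod (co (u i) t) = 1" using co_orb u i by blast
    then have "cnj (co (u i) t) * co (u i) t = 1"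
      using complex_norm_square[of "co (u i) t"] by (simp add: mult.commute)
    then show ?thesis using True by (simp add: \<phi>'_def)
  qed (simp add: co_outside)
  have int_ind: "integrable M (\<lambda>t. c i * indicator (orb (u i)) t)" if i: "i \<in> I" for i
  proof (rule integrable_orb_bounded[OF u[OF i], where b = "cmod (c i)"])
    show "(\<lambda>t. c i * indicator (orb (u i)) t) \<in> borel_measurable M"
      using u[OF i] by (intro borel_measurable_times borel_measurable_const borel_measurable_indicator orb_sets)
  qed (auto simp: norm_mult split: split_indicator)
  then have int: "integrable M (\<lambda>t. \<phi>' i t * co (u i) t)" if "i \<in> I" for i
    using that by (simp add: prod)
  have val: "(\<integral>t. \<phi>' i t * co (u i) t \<partial>M) = c i" if i: "i \<in> I" for i
  proof -
    have "(\<integral>t. indicator (orb (u i)) t \<partial>M) = (1 :: complex)"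
    proof -
      have "has_bochner_integral M (\<lambda>t. indicator (orb (u i)) t *\<^sub>R (1 :: complex)) (measure M (orb (u i)) *\<^sub>R 1)"
        using u[OF i] emeasure_orb[OF u[OF i]] by (intro has_bochner_integral_indicator) auto
      moreover have "indicator (orb (u i)) t *\<^sub>R (1 :: complex) = indicator (orb (u i)) t" for t
        by (simp split: split_indicator)
      ultimately show ?thesis using measure_orb u[OF i] by (simp add: has_bochner_integral_integral_eq)
    qed
    then show ?thesis using prod[OF i] by simp
  qed
  have \<phi>_eq: "\<phi> t = (\<Sum>i\<in>I. \<phi>' i t)" for t by (simp add: \<phi>_def)
  have "(\<integral>t. \<phi> t * f t \<partial>M) = (\<Sum>i\<in>I. (\<integral>t. \<phi>' i t * co (u i) t \<partial>M) * f (cls (u i)))"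
    by (rule integrals_of_orb_sum(2)[OF I u \<phi>_eq supp int f_scaleC])
  then have 1: "(\<integral>t. \<phi> t * f t \<partial>M) = (\<Sum>i\<in>I. c i * f (cls (u i)))" using val by simp
  have "quotient_integral A J M (\<lambda>t. coset_scale J (\<phi> t) (T_hom D \<sigma> t))
      = coset_of J (\<Sum>i\<in>I. (\<integral>t. \<phi>' i t * co (u i) t \<partial>M) *\<^sub>C u i)"
    by (rule integrals_of_orb_sum(1)[OF I u \<phi>_eq supp int])
  then have "quotient_integral A J M (\<lambda>t. coset_scale J (\<phi> t) (T_hom D \<sigma> t)) = coset_of J (\<Sum>i\<in>I. c i *\<^sub>C u i)"
    using val by simp
  then show ?thesis using dom 1 JS.q_le_norm[of "\<Sum>i\<in>I. c i *\<^sub>C u i"] by (simp add: JS.q_def)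
qed

lemma f_sum_le_B:
  assumes I: "finite I" and u: "\<And>i. i \<in> I \<Longrightarrow> u i \<in> H"
  shows "cmod (\<Sum>i\<in>I. c i * f (cls (u i))) \<le> B (\<Sum>i\<in>I. c i *\<^sub>C u i)"
proof (rule B_greatest)
  fix d e assume de: "d \<in> D" "e \<in> D" "\<sigma> d = 1" "\<sigma> e = 1"
  have H: "d * u i * e \<in> H" if "i \<in> I" for i
    using H_mult[OF H_mult[OF H_D[OF de(1)] u[OF that]] H_D[OF de(2)]] de by simp
  have "f (cls (d * u i * e)) = f (cls (u i))" if i: "i \<in> I" for i
  proof (rule f_cls_cong[OF H[OF i] u[OF i]])
    have "d * u i * e - u i = (d * u i * e - \<sigma> e *\<^sub>C (d * u i)) + (d * u i - \<sigma> d *\<^sub>C u i)"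
      using de by simp
    then show "B (d * u i * e - u i) = 0"
      using B_scale_right[OF de(2), of "d * u i"] B_scale_left[OF de(1), of "u i"] by (simp only: B_add_zero)
  qed
  then have "cmod (\<Sum>i\<in>I. c i * f (cls (u i))) = cmod (\<Sum>i\<in>I. c i * f (cls (d * u i * e)))" by simp
  also have "\<dots> \<le> norm (\<Sum>i\<in>I. c i *\<^sub>C (d * u i * e))" by (rule f_sum_le_norm[OF I H])
  also have "(\<Sum>i\<in>I. c i *\<^sub>C (d * u i * e)) = d * (\<Sum>i\<in>I. c i *\<^sub>C u i) * e"
    by (simp add: sum_distrib_left sum_distrib_right mult_scaleC_left mult_scaleC_right)
  finally show "cmod (\<Sum>i\<in>I. c i * f (cls (u i))) \<le> norm (d * (\<Sum>i\<in>I. c i *\<^sub>C u i) * e)" .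
qed

text \<open>A normalizer that is not null is \<open>B v\<close> times an element of
  \<open>H\<close>, since \<open>B\<close> equals 1 on \<open>H\<close>. This is therefore the
  positively homogeneous extension of \<open>f\<close> from \<open>H\<close> to all normalizers,
  zero on the null ones.\<close>

definition g :: "'a \<Rightarrow> complex" where
  "g v = (if B v = 0 then 0 else of_real (B v) * f (cls ((1 / B v) *\<^sub>R v)))"

lemma B_scaleR: "0 \<le> t \<Longrightarrow> B (t *\<^sub>R x) = t * B x"
  using B_scaleC[of "of_real t" x] by (simp add: scaleC_of_real)

lemma g_scaleR_H: assumes "0 < t" "u \<in> H" shows "g (t *\<^sub>R u) = of_real t * f (cls u)"
  using assms by (simp add: g_def B_scaleR B_H)

lemma g_H: "u \<in> H \<Longrightarrow> g u = f (cls u)"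
  using g_scaleR_H[of 1 u] by simp

lemma N_normalized: assumes "v \<in> N" "B v \<noteq> 0" shows "(1 / B v) *\<^sub>R v \<in> H"
  using assms(1)
proof (cases v rule: N_cases)
  case (2 t u)
  then show ?thesis by (simp add: B_scaleR B_H)
qed (use assms in simp)

lemma g_sum_le_B:
  assumes S: "finite S" "S \<subseteq> N"
  shows "cmod (\<Sum>v\<in>S. r v * g v) \<le> B (\<Sum>v\<in>S. r v *\<^sub>C v)"
proof -
  define S' where "S' = {v \<in> S. B v \<noteq> 0}"
  have fin: "finite S'" using S by (simp add: S'_def)
  have "(\<Sum>v\<in>S. r v * g v) = (\<Sum>v\<in>S'. r v * g v)"
    using S by (intro sum.mono_neutral_right) (auto simp: S'_def g_def)
  also have "\<dots> = (\<Sum>v\<in>S'. (r v * of_real (B v)) * f (cls ((1 / B v) *\<^sub>R v)))"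
    by (intro sum.cong) (auto simp: S'_def g_def)
  finally have "cmod (\<Sum>v\<in>S. r v * g v) \<le> B (\<Sum>v\<in>S'. (r v * of_real (B v)) *\<^sub>C ((1 / B v) *\<^sub>R v))"
    using f_sum_le_B[OF fin, of "\<lambda>v. (1 / B v) *\<^sub>R v" "\<lambda>v. r v * of_real (B v)"] N_normalized S by (auto simp: S'_def)
  also have "(\<Sum>v\<in>S'. (r v * of_real (B v)) *\<^sub>C ((1 / B v) *\<^sub>R v)) = (\<Sum>v\<in>S'. r v *\<^sub>C v)"
  proof (intro sum.cong refl)
    fix v assume "v \<in> S'"
    then have "B v \<noteq> 0" by (simp add: S'_def)
    then show "(r v * of_real (B v)) *\<^sub>C ((1 / B v) *\<^sub>R v) = r v *\<^sub>C v"
      by (simp add: scaleC_of_real flip: scaleC_scaleC)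
  qed
  also have "B (\<Sum>v\<in>S'. r v *\<^sub>C v) = B (\<Sum>v\<in>S. r v *\<^sub>C v)"
  proof (rule B_eqI)
    have "(\<Sum>v\<in>S. r v *\<^sub>C v) = (\<Sum>v\<in>S'. r v *\<^sub>C v) + (\<Sum>v\<in>S - S'. r v *\<^sub>C v)"
      using S sum.subset_diff[of S' S "\<lambda>v. r v *\<^sub>C v"] by (auto simp: S'_def add.commute)
    then have eq: "(\<Sum>v\<in>S'. r v *\<^sub>C v) - (\<Sum>v\<in>S. r v *\<^sub>C v) = - (\<Sum>v\<in>S - S'. r v *\<^sub>C v)" by simp
    have "B (\<Sum>v\<in>S - S'. r v *\<^sub>C v) \<le> (\<Sum>v\<in>S - S'. B (r v *\<^sub>C v))" by (rule B_sum_le)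
    also have "\<dots> = 0" by (intro sum.neutral) (auto simp: S'_def B_scaleC)
    finally show "B ((\<Sum>v\<in>S'. r v *\<^sub>C v) - (\<Sum>v\<in>S. r v *\<^sub>C v)) = 0"
      unfolding eq B_minus using B_nonneg by (intro antisym)
  qed
  finally show ?thesis .
qed

text \<open>The linear extension of \<open>g\<close> to the span of the normalizers is given by its graph, as its
  single-valuedness is a consequence of the estimate by \<open>B\<^sub>\<sigma>\<close>.\<close>

definition \<Gamma> :: "('a \<times> complex) set" where
  "\<Gamma> = {(\<Sum>v\<in>S. r v *\<^sub>C v, \<Sum>v\<in>S. r v * g v) |S r. finite S \<and> S \<subseteq> N}"

lemma \<Gamma>I: "finite S \<Longrightarrow> S \<subseteq> N \<Longrightarrow> (\<Sum>v\<in>S. r v *\<^sub>C v, \<Sum>v\<in>S. r v * g v) \<in> \<Gamma>"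
  unfolding \<Gamma>_def by blast

lemma \<Gamma>E:
  assumes "(x, y) \<in> \<Gamma>"
  obtains S r where "finite S" "S \<subseteq> N" "x = (\<Sum>v\<in>S. r v *\<^sub>C v)" "y = (\<Sum>v\<in>S. r v * g v)"
  using assms unfolding \<Gamma>_def by blast

lemma \<Gamma>_le_B: "(x, y) \<in> \<Gamma> \<Longrightarrow> cmod y \<le> B x"
  by (auto elim!: \<Gamma>E intro: g_sum_le_B)

lemma \<Gamma>_N: "v \<in> N \<Longrightarrow> (v, g v) \<in> \<Gamma>"
  using \<Gamma>I[of "{v}" "\<lambda>_. 1"] by simp

lemma \<Gamma>_scaleC: "(x, y) \<in> \<Gamma> \<Longrightarrow> (c *\<^sub>C x, c * y) \<in> \<Gamma>"
  using \<Gamma>I[of _ "\<lambda>v. c * _ v"]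
  by (auto elim!: \<Gamma>E simp: complex_vector.scale_sum_right sum_distrib_left mult.assoc)

lemma \<Gamma>_add: assumes "(x, y) \<in> \<Gamma>" "(x', y') \<in> \<Gamma>" shows "(x + x', y + y') \<in> \<Gamma>"
proof -
  obtain S r where S: "finite S" "S \<subseteq> N" "x = (\<Sum>v\<in>S. r v *\<^sub>C v)" "y = (\<Sum>v\<in>S. r v * g v)"
    using assms(1) by (rule \<Gamma>E)
  obtain S' r' where S': "finite S'" "S' \<subseteq> N" "x' = (\<Sum>v\<in>S'. r' v *\<^sub>C v)" "y' = (\<Sum>v\<in>S'. r' v * g v)"
    using assms(2) by (rule \<Gamma>E)
  define R where "R = (\<lambda>v. if v \<in> S then r v else 0)"
  define R' where "R' = (\<lambda>v. if v \<in> S' then r' v else 0)"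
  have "x = (\<Sum>v\<in>S \<union> S'. R v *\<^sub>C v)" "y = (\<Sum>v\<in>S \<union> S'. R v * g v)"
    unfolding S(3,4) using S(1) S'(1) by (intro sum.mono_neutral_cong_left; auto simp: R_def)+
  moreover have "x' = (\<Sum>v\<in>S \<union> S'. R' v *\<^sub>C v)" "y' = (\<Sum>v\<in>S \<union> S'. R' v * g v)"
    unfolding S'(3,4) using S(1) S'(1) by (intro sum.mono_neutral_cong_left; auto simp: R'_def)+
  ultimately have "(x + x', y + y') = (\<Sum>v\<in>S \<union> S'. (R v + R' v) *\<^sub>C v, \<Sum>v\<in>S \<union> S'. (R v + R' v) * g v)"
    by (simp add: scaleC_add_left distrib_right sum.distrib)
  then show ?thesis using \<Gamma>I[of "S \<union> S'" "\<lambda>v. R v + R' v"] S(1,2) S'(1,2) by simp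
qed

lemma \<Gamma>_diff: "(x, y) \<in> \<Gamma> \<Longrightarrow> (x', y') \<in> \<Gamma> \<Longrightarrow> (x - x', y - y') \<in> \<Gamma>"
  using \<Gamma>_add[of x y "(-1) *\<^sub>C x'" "(-1) * y'"] \<Gamma>_scaleC[of x' y' "-1"] by simp

lemma \<Gamma>_span: "x \<in> cspan N \<Longrightarrow> \<exists>y. (x, y) \<in> \<Gamma>"
  unfolding complex_vector.span_explicit using \<Gamma>I by blast

lemma closure_\<Gamma>_le: assumes "(x, y) \<in> closure \<Gamma>" shows "cmod y \<le> norm x"
proof -
  have "closed {p :: 'a \<times> complex. cmod (snd p) \<le> norm (fst p)}"
    by (intro closed_Collect_le continuous_intros)
  moreover have "\<Gamma> \<subseteq> {p. cmod (snd p) \<le> norm (fst p)}"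
    by clarsimp (meson \<Gamma>_le_B B_le_norm order.trans)
  ultimately have "closure \<Gamma> \<subseteq> {p. cmod (snd p) \<le> norm (fst p)}" by (intro closure_minimal)
  then show ?thesis using assms by auto
qed

lemma closure_\<Gamma>_seq:
  "(x, y) \<in> closure \<Gamma> \<longleftrightarrow> (\<exists>a b. (\<forall>n. (a n, b n) \<in> \<Gamma>) \<and> a \<longlonglongrightarrow> x \<and> b \<longlonglongrightarrow> y)"
proof
  assume "(x, y) \<in> closure \<Gamma>"
  then obtain p where p: "\<And>n. p n \<in> \<Gamma>" "p \<longlonglongrightarrow> (x, y)" by (auto simp: closure_sequential)
  then show "\<exists>a b. (\<forall>n. (a n, b n) \<in> \<Gamma>) \<and> a \<longlonglongrightarrow> x \<and> b \<longlonglongrightarrow> y"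
    using tendsto_fst[OF p(2)] tendsto_snd[OF p(2)]
    by (intro exI[of _ "\<lambda>n. fst (p n)"] exI[of _ "\<lambda>n. snd (p n)"]) simp
next
  assume "\<exists>a b. (\<forall>n. (a n, b n) \<in> \<Gamma>) \<and> a \<longlonglongrightarrow> x \<and> b \<longlonglongrightarrow> y"
  then obtain a b where "\<And>n. (a n, b n) \<in> \<Gamma>" "a \<longlonglongrightarrow> x" "b \<longlonglongrightarrow> y" by blast
  then show "(x, y) \<in> closure \<Gamma>"
    unfolding closure_sequential by (intro exI[of _ "\<lambda>n. (a n, b n)"]) (auto intro: tendsto_Pair)
qed

lemma closure_\<Gamma>_add:
  assumes "(x, y) \<in> closure \<Gamma>" "(x', y') \<in> closure \<Gamma>" shows "(x + x', y + y') \<in> closure \<Gamma>"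
proof -
  obtain a b where "\<And>n. (a n, b n) \<in> \<Gamma>" "a \<longlonglongrightarrow> x" "b \<longlonglongrightarrow> y" using assms(1) by (auto simp: closure_\<Gamma>_seq)
  moreover obtain a' b' where "\<And>n. (a' n, b' n) \<in> \<Gamma>" "a' \<longlonglongrightarrow> x'" "b' \<longlonglongrightarrow> y'" using assms(2) by (auto simp: closure_\<Gamma>_seq)
  ultimately show ?thesis unfolding closure_\<Gamma>_seq
    by (intro exI[of _ "\<lambda>n. a n + a' n"] exI[of _ "\<lambda>n. b n + b' n"]) (auto intro: \<Gamma>_add tendsto_add)
qed

lemma closure_\<Gamma>_scaleC:
  assumes "(x, y) \<in> closure \<Gamma>" shows "(c *\<^sub>C x, c * y) \<in> closure \<Gamma>"
proof -
  obtain a b where "\<And>n. (a n, b n) \<in> \<Gamma>" "a \<longlonglongrightarrow> x" "b \<longlonglongrightarrow> y" using assms by (auto simp: closure_\<Gamma>_seq)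
  then show ?thesis unfolding closure_\<Gamma>_seq
    by (intro exI[of _ "\<lambda>n. c *\<^sub>C a n"] exI[of _ "\<lambda>n. c * b n"])
      (auto intro: \<Gamma>_scaleC tendsto_mult bounded_linear.tendsto[OF bounded_linear_scaleC_right])
qed

lemma closure_\<Gamma>_unique:
  assumes "(x, y) \<in> closure \<Gamma>" "(x, y') \<in> closure \<Gamma>" shows "y = y'"
  using closure_\<Gamma>_le[OF closure_\<Gamma>_add[OF assms(1) closure_\<Gamma>_scaleC[OF assms(2), of "-1"]]] by simp

text \<open>Closing the graph extends by continuity while keeping the contraction bound, so a value
  is unique whenever it exists. Existence for every \<open>x\<close> is supplied later by
  density.\<close>

definition ext :: "'a \<Rightarrow> complex" where
  "ext x = (THE y. (x, y) \<in> closure \<Gamma>)"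

lemma ext_eq: "(x, y) \<in> closure \<Gamma> \<Longrightarrow> ext x = y"
  unfolding ext_def using closure_\<Gamma>_unique by blast

lemma ext_\<Gamma>: "(x, y) \<in> \<Gamma> \<Longrightarrow> ext x = y"
  using closure_subset ext_eq by blast

lemma ext_N: "v \<in> N \<Longrightarrow> ext v = g v"
  by (intro ext_\<Gamma> \<Gamma>_N)

text \<open>The element \<open>d - \<sigma> d *\<^sub>C 1\<close> is null, and values on
  \<open>\<Gamma>\<close> are bounded by \<open>B\<close>.\<close>

lemma ext_D: assumes d: "d \<in> D" shows "ext d = \<sigma> d"
proof -
  have "(d - \<sigma> d *\<^sub>C 1, g d - \<sigma> d * g 1) \<in> \<Gamma>"
    using d by (intro \<Gamma>_diff \<Gamma>_scaleC \<Gamma>_N D_N) auto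
  then have "cmod (g d - \<sigma> d * g 1) \<le> 0" using \<Gamma>_le_B B_scale_left[OF d, of 1] by fastforce
  then show ?thesis using ext_N[OF D_N[OF d]] g_H[OF H_one] by (simp add: f_one)
qed

lemma g_cong: assumes "v \<in> N" "w \<in> N" "B (v - w) = 0" shows "g v = g w"
  using \<Gamma>_le_B[OF \<Gamma>_diff[OF \<Gamma>_N[OF assms(1)] \<Gamma>_N[OF assms(2)]]] assms(3) by simp

lemma g_zero: "B v = 0 \<Longrightarrow> g v = 0"
  by (simp add: g_def)

subsection \<open>Positivity of the extension\<close>

abbreviation wt :: "'a \<Rightarrow> real" where "wt a \<equiv> Re (\<sigma> (a\<^sup>\<star> * a))"

lemma s_N: "a \<in> N \<Longrightarrow> \<sigma> (a\<^sup>\<star> * a) = of_real (wt a)" "a \<in> N \<Longrightarrow> 0 \<le> wt a"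
  using s_pos[OF N_pos] by (auto simp: complex_eq_iff)

text \<open>For nonzero \<open>wt a\<close> this is the character to which the partial homeomorphism
  of the character space induced by \<open>a\<close> moves \<open>\<sigma>\<close>. Restriction to
  \<open>D\<close> makes equality of keys the same as agreement on \<open>D\<close>.\<close>

definition key :: "'a \<Rightarrow> 'a \<Rightarrow> complex" where
  "key a = (\<lambda>d\<in>D. \<sigma> (a\<^sup>\<star> * d * a) / \<sigma> (a\<^sup>\<star> * a))"

lemma s_N_nonzero: "wt a \<noteq> 0 \<Longrightarrow> \<sigma> (a\<^sup>\<star> * a) \<noteq> 0"
  by auto

lemma s_key:
  assumes "wt a \<noteq> 0" "a \<in> N" "d \<in> D"
  shows "\<sigma> (a\<^sup>\<star> * d * a) = key a d * of_real (wt a)"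
  unfolding s_N(1)[OF assms(2), symmetric] using s_N_nonzero[OF assms(1)] assms(3) by (simp add: key_def)

lemma key_mult:
  assumes a: "a \<in> N" "wt a \<noteq> 0" and d: "d \<in> D" "e \<in> D"
  shows "key a (d * e) = key a d * key a e"
proof -
  have aa: "a * a\<^sup>\<star> \<in> D" "a\<^sup>\<star> * a \<in> D" using a N_D_one by auto
  have "(a\<^sup>\<star> * d * a) * (a\<^sup>\<star> * e * a) = a\<^sup>\<star> * d * ((a * a\<^sup>\<star>) * e) * a" by (simp add: mult.assoc)
  also have "(a * a\<^sup>\<star>) * e = e * (a * a\<^sup>\<star>)" by (rule D_comm[OF aa(1) d(2)])
  finally have "(a\<^sup>\<star> * d * a) * (a\<^sup>\<star> * e * a) = (a\<^sup>\<star> * (d * e) * a) * (a\<^sup>\<star> * a)" by (simp add: mult.assoc)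
  then have "\<sigma> (a\<^sup>\<star> * d * a) * \<sigma> (a\<^sup>\<star> * e * a) = \<sigma> (a\<^sup>\<star> * (d * e) * a) * \<sigma> (a\<^sup>\<star> * a)"
    using N_D(1)[OF a(1)] d aa by (simp flip: s_mult)
  then show ?thesis using d s_N_nonzero[OF a(2)] by (simp add: key_def field_simps)
qed

text \<open>The value of \<open>a * a\<^sup>\<star>\<close> at the moved character is that of
  \<open>a\<^sup>\<star> * a\<close> at \<open>\<sigma>\<close>. This supplies the scalar by which a
  base point can be inserted into a product.\<close>

lemma key_self: assumes a: "a \<in> N" "wt a \<noteq> 0" shows "key a (a * a\<^sup>\<star>) = of_real (wt a)"
proof -
  have "a\<^sup>\<star> * (a * a\<^sup>\<star>) * a = (a\<^sup>\<star> * a) * (a\<^sup>\<star> * a)" by (simp add: mult.assoc)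
  then have "\<sigma> (a\<^sup>\<star> * (a * a\<^sup>\<star>) * a) = \<sigma> (a\<^sup>\<star> * a) * \<sigma> (a\<^sup>\<star> * a)" using a N_D_one by (simp add: s_mult)
  then show ?thesis using a s_N(1)[OF a(1)] N_D_one by (simp add: key_def)
qed

lemma key_diff: assumes a: "a \<in> N" and d: "d \<in> D" "e \<in> D" shows "key a (d - e) = key a d - key a e"
  using N_D(1)[OF a] d by (simp add: key_def right_diff_distrib left_diff_distrib s_diff diff_divide_distrib)

lemma key_of_real: assumes a: "a \<in> N" "wt a \<noteq> 0" shows "key a (of_real r) = of_real r"
proof -
  have "a\<^sup>\<star> * of_real r * a = r *\<^sub>R (a\<^sup>\<star> * a)" by (simp add: of_real_def)
  then show ?thesis using N_D_one[OF a(1)] s_N_nonzero[OF a(2)] by (simp add: key_def s_scaleR)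
qed

text \<open>The normalizer \<open>b\<close> moves \<open>\<sigma>\<close> to the common key and
  \<open>a\<^sup>\<star>\<close> moves it back; the weights are the two scalars picked up on the
  way.\<close>

lemma H_of_same_key:
  assumes a: "a \<in> N" "wt a \<noteq> 0" and b: "b \<in> N" "wt b \<noteq> 0" and key: "key a = key b"
  shows "(1 / sqrt (wt a * wt b)) *\<^sub>R (a\<^sup>\<star> * b) \<in> H"
proof -
  define t where "t = 1 / sqrt (wt a * wt b)"
  have w: "0 < wt a" "0 < wt b" using a b s_N(2) by (auto simp: less_le)
  then have t: "t * t * (wt a * wt b) = 1" by (simp add: t_def)
  have u: "a\<^sup>\<star> * b \<in> N" using a b by (intro N_mult N_star)
  have "t *\<^sub>R (a\<^sup>\<star> * b) \<in> N" using N_scaleC[OF u, of "of_real t"] by (simp add: scaleC_of_real)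
  moreover have "\<sigma> ((t *\<^sub>R (a\<^sup>\<star> * b))\<^sup>\<star> * d * (t *\<^sub>R (a\<^sup>\<star> * b))) = \<sigma> d" if d: "d \<in> D" for d
  proof -
    have ada: "a * d * a\<^sup>\<star> \<in> D" using N_D(2)[OF a(1) d] .
    have aa: "a\<^sup>\<star> * a \<in> D" using a N_D_one by simp
    have "\<sigma> (b\<^sup>\<star> * (a * d * a\<^sup>\<star>) * b) = key a (a * d * a\<^sup>\<star>) * of_real (wt b)"
      using s_key[OF b(2,1) ada] key by simp
    moreover have "a\<^sup>\<star> * (a * d * a\<^sup>\<star>) * a = (a\<^sup>\<star> * a) * d * (a\<^sup>\<star> * a)" by (simp add: mult.assoc)
    then have "\<sigma> (a\<^sup>\<star> * (a * d * a\<^sup>\<star>) * a) = \<sigma> (a\<^sup>\<star> * a) * \<sigma> d * \<sigma> (a\<^sup>\<star> * a)"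
      using aa d by (simp only: s_mult D_mult)
    then have "key a (a * d * a\<^sup>\<star>) = \<sigma> (a\<^sup>\<star> * a) * \<sigma> d"
      using ada s_N_nonzero[OF a(2)] by (simp add: key_def)
    then have "key a (a * d * a\<^sup>\<star>) = of_real (wt a) * \<sigma> d" unfolding s_N(1)[OF a(1), symmetric] .
    ultimately have eq: "\<sigma> (b\<^sup>\<star> * (a * d * a\<^sup>\<star>) * b) = of_real (wt a * wt b) * \<sigma> d" by simp
    have conj: "(t *\<^sub>R (a\<^sup>\<star> * b))\<^sup>\<star> * d * (t *\<^sub>R (a\<^sup>\<star> * b)) = (t * t) *\<^sub>R (b\<^sup>\<star> * (a * d * a\<^sup>\<star>) * b)"
      by (simp add: star_mult mult.assoc)
    have "\<sigma> ((t *\<^sub>R (a\<^sup>\<star> * b))\<^sup>\<star> * d * (t *\<^sub>R (a\<^sup>\<star> * b))) = of_real (t * t) * (of_real (wt a * wt b) * \<sigma> d)"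
      unfolding conj eq[symmetric] by (rule s_scaleR[OF N_D(1)[OF b(1) ada]])
    also have "\<dots> = of_real (t * t * (wt a * wt b)) * \<sigma> d" by simp
    finally show ?thesis unfolding t by simp
  qed
  ultimately show ?thesis by (simp add: H_set_def t_def)
qed

text \<open>If \<open>a\<^sup>\<star> * b\<close> is not null, it is \<open>s\<close> times some
  \<open>h\<close> in \<open>H\<close>. With \<open>x = a * a\<^sup>\<star>\<close>, evaluating
  \<open>\<sigma> (b\<^sup>\<star> * (x * e * x) * b)\<close> through \<open>b\<close> and through
  \<open>h\<close> gives the two keys at \<open>e\<close> with proportional factors;
  \<open>e = 1\<close> shows that the factors agree, so the keys would coincide.\<close>

lemma B_zero_of_different_key:
  assumes a: "a \<in> N" "wt a \<noteq> 0" and b: "b \<in> N" "wt b \<noteq> 0" and key: "key a \<noteq> key b"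
  shows "B (a\<^sup>\<star> * b) = 0"
proof -
  have u: "a\<^sup>\<star> * b \<in> N" using a b by (intro N_mult N_star)
  show ?thesis
    using u
  proof (cases "a\<^sup>\<star> * b" rule: N_cases)
    case (2 s h)
    define x where "x = a * a\<^sup>\<star>"
    have x: "x \<in> D" using a N_D_one by (simp add: x_def)
    have eq: "key b e * key b (x * x) * of_real (wt b) = of_real (s * s * wt a) * key a e" if e: "e \<in> D" for e
    proof -
      have aea: "a\<^sup>\<star> * e * a \<in> D" using N_D(1)[OF a(1) e] .
      have "b\<^sup>\<star> * (x * e * x) * b = (a\<^sup>\<star> * b)\<^sup>\<star> * (a\<^sup>\<star> * e * a) * (a\<^sup>\<star> * b)"
        by (simp add: x_def star_mult mult.assoc)
      also have "\<dots> = (s * s) *\<^sub>R (h\<^sup>\<star> * (a\<^sup>\<star> * e * a) * h)" unfolding 2(3) by simp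
      finally have 1: "\<sigma> (b\<^sup>\<star> * (x * e * x) * b) = of_real (s * s) * \<sigma> (a\<^sup>\<star> * e * a)"
        using H_s[OF 2(2) aea] N_D(1)[OF H_N[OF 2(2)] aea] by (simp add: s_scaleR)
      have "x * e * x = e * (x * x)" using D_comm[OF x e] by (simp add: mult.assoc)
      then have "\<sigma> (b\<^sup>\<star> * (x * e * x) * b) = key b e * key b (x * x) * of_real (wt b)"
        using s_key[OF b(2,1) D_mult[OF e D_mult[OF x x]]] key_mult[OF b e D_mult[OF x x]] by (simp only:)
      then show ?thesis using 1 s_key[OF a(2,1) e] by (simp only: of_real_mult mult_ac)
    qed
    have one: "key b 1 = 1" "key a 1 = 1" using key_of_real[OF b, of 1] key_of_real[OF a, of 1] by simp_all
    have C: "key b (x * x) * of_real (wt b) = of_real (s * s * wt a)" using eq[OF D_one] one by simp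
    have "key a = key b"
    proof
      fix e show "key a e = key b e"
      proof (cases "e \<in> D")
        case True
        then have "key b e * of_real (s * s * wt a) = of_real (s * s * wt a) * key a e"
          using eq[OF True] C by (simp add: mult.assoc)
        moreover have "complex_of_real (s * s * wt a) \<noteq> 0" unfolding of_real_eq_0_iff using 2(1) a by simp
        ultimately show ?thesis by (metis mult.commute mult_left_cancel)
      qed (simp add: key_def)
    qed
    then show ?thesis using key by simp
  qed
qed

text \<open>The base point \<open>c\<close> is inserted between \<open>a\<^sup>\<star>\<close> and
  \<open>b\<close>: the key of \<open>b\<close> takes the value \<open>wt c\<close> on
  \<open>c * c\<^sup>\<star>\<close>, so \<open>x * b\<close> is null for
  \<open>x = wt c - c * c\<^sup>\<star>\<close>. Hence \<open>a\<^sup>\<star> * b\<close> agrees, up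
  to a null element, with a multiple of \<open>(u a)\<^sup>\<star> * u b\<close>.\<close>

lemma g_same_key:
  assumes c: "c \<in> N" "wt c \<noteq> 0" and a: "a \<in> N" "wt a \<noteq> 0" "key a = key c"
    and b: "b \<in> N" "wt b \<noteq> 0" "key b = key c"
  defines "u \<equiv> \<lambda>a. (1 / sqrt (wt c * wt a)) *\<^sub>R (c\<^sup>\<star> * a)"
  shows "g (a\<^sup>\<star> * b) = of_real (sqrt (wt a)) * f (cls ((u a)\<^sup>\<star> * u b)) * of_real (sqrt (wt b))"
proof -
  have w: "0 < wt a" "0 < wt b" "0 < wt c" using a b c s_N(2) by (auto simp: less_le)
  have H: "u a \<in> H" "u b \<in> H" unfolding u_def using H_of_same_key[OF c a(1,2)] H_of_same_key[OF c b(1,2)] a b by auto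
  define x where "x = of_real (wt c) - c * c\<^sup>\<star>"
  have x: "x \<in> D" using c N_D_one by (simp add: x_def)
  have "key b x = 0"
    using key_diff[OF b(1), of "of_real (wt c)" "c * c\<^sup>\<star>"] key_of_real[OF b(1,2)] key_self[OF c] b(3) N_D_one c
    by (simp add: x_def)
  then have "key b (x\<^sup>\<star> * x) = 0" using key_mult[OF b(1,2) D_star[OF x] x] by simp
  then have "\<sigma> (b\<^sup>\<star> * (x\<^sup>\<star> * x) * b) = 0" using s_key[OF b(2,1)] x by simp
  then have "B (a\<^sup>\<star> * (x * b)) = 0"
    using N_D(1)[OF b(1), of "x\<^sup>\<star> * x"] x by (intro B_small_right) (simp_all add: star_mult mult.assoc)
  define t where "t = sqrt (wt a) * sqrt (wt b)"
  have t: "0 < t" using w by (simp add: t_def)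
  have coef: "t * ((1 / sqrt (wt c * wt a)) * (1 / sqrt (wt c * wt b))) = 1 / wt c"
    using w by (simp add: t_def real_sqrt_mult)
  have "(u a)\<^sup>\<star> * u b = ((1 / sqrt (wt c * wt a)) * (1 / sqrt (wt c * wt b))) *\<^sub>R (a\<^sup>\<star> * (c * c\<^sup>\<star>) * b)"
    by (simp add: u_def star_mult mult.assoc)
  then have tu: "t *\<^sub>R ((u a)\<^sup>\<star> * u b) = (1 / wt c) *\<^sub>R (a\<^sup>\<star> * (c * c\<^sup>\<star>) * b)"
    by (simp only: scaleR_scaleR coef)
  have "a\<^sup>\<star> * b = (1 / wt c) *\<^sub>R (a\<^sup>\<star> * of_real (wt c) * b)" using w by (simp add: of_real_def)
  then have "a\<^sup>\<star> * b - t *\<^sub>R ((u a)\<^sup>\<star> * u b) = (1 / wt c) *\<^sub>R (a\<^sup>\<star> * (x * b))"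
    unfolding tu by (simp add: x_def algebra_simps)
  then have "B (a\<^sup>\<star> * b - t *\<^sub>R ((u a)\<^sup>\<star> * u b)) = 0"
    using \<open>B (a\<^sup>\<star> * (x * b)) = 0\<close> w by (simp add: B_scaleR)
  moreover have uH: "(u a)\<^sup>\<star> * u b \<in> H" using H by (intro H_mult H_star)
  moreover have "t *\<^sub>R ((u a)\<^sup>\<star> * u b) \<in> N"
    using N_scaleC[OF H_N[OF uH], of "of_real t"] by (simp add: scaleC_of_real)
  ultimately have "g (a\<^sup>\<star> * b) = g (t *\<^sub>R ((u a)\<^sup>\<star> * u b))"
    using a b by (intro g_cong N_mult N_star) auto
  then show ?thesis using g_scaleR_H[OF t uH] by (simp add: t_def)
qed

lemma nonneg_Reals_sum: "(\<And>i. i \<in> I \<Longrightarrow> h i \<in> \<real>\<^sub>\<ge>\<^sub>0) \<Longrightarrow> (\<Sum>i\<in>I. h i) \<in> (\<real>\<^sub>\<ge>\<^sub>0 :: complex set)"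
  by (induction I rule: infinite_finite_induct) auto

lemma g_positive_semidefinite:
  assumes S: "finite S" "S \<subseteq> N"
  shows "(\<Sum>a\<in>S. \<Sum>b\<in>S. cnj (r a) * r b * g (a\<^sup>\<star> * b)) \<in> \<real>\<^sub>\<ge>\<^sub>0"
proof -
  let ?F = "\<lambda>a b. cnj (r a) * r b * g (a\<^sup>\<star> * b)"
  define T where "T = {a \<in> S. wt a \<noteq> 0}"
  have T: "finite T" "T \<subseteq> S" using S by (auto simp: T_def)
  have TN: "a \<in> N" "wt a \<noteq> 0" if "a \<in> T" for a using that S by (auto simp: T_def)
  have zero: "g (a\<^sup>\<star> * b) = 0" if "a \<in> S" "b \<in> S" "a \<notin> T \<or> b \<notin> T" for a b
  proof -
    have B0: "B (y * a) = 0" if a: "a \<in> S" "a \<notin> T" for a y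
    proof (rule B_small_right)
      show "a\<^sup>\<star> * a \<in> D" using a S N_D_one by auto
      show "\<sigma> (a\<^sup>\<star> * a) = 0" using a S s_N(1)[of a] by (auto simp: T_def)
    qed
    have "B (a\<^sup>\<star> * b) = 0"
      using that(3)
    proof
      assume "a \<notin> T"
      then have "B ((b\<^sup>\<star> * a)\<^sup>\<star>) = 0" unfolding B_star using B0 that by blast
      then show ?thesis by (simp add: star_mult)
    qed (use B0 that in blast)
    then show ?thesis by (rule g_zero)
  qed
  have "(\<Sum>a\<in>S. \<Sum>b\<in>S. ?F a b) = (\<Sum>a\<in>T. \<Sum>b\<in>T. ?F a b)"
  proof -
    have "(\<Sum>a\<in>S. \<Sum>b\<in>S. ?F a b) = (\<Sum>a\<in>T. \<Sum>b\<in>S. ?F a b)"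
      using S(1) T zero by (intro sum.mono_neutral_right) (auto intro!: sum.neutral)
    also have "\<dots> = (\<Sum>a\<in>T. \<Sum>b\<in>T. ?F a b)"
      using S(1) T zero by (intro sum.cong refl sum.mono_neutral_right) (auto simp: subset_iff)
    finally show ?thesis .
  qed
  also have "\<dots> = (\<Sum>k\<in>key ` T. \<Sum>a\<in>{a \<in> T. key a = k}. \<Sum>b\<in>T. ?F a b)"
    by (rule sum.image_gen[OF T(1)])
  also have "\<dots> = (\<Sum>k\<in>key ` T. \<Sum>a\<in>{a \<in> T. key a = k}. \<Sum>b\<in>{b \<in> T. key b = k}. ?F a b)"
  proof (rule sum.cong[OF refl], rule sum.cong[OF refl], rule sum.mono_neutral_right[OF T(1)])
    fix k a assume a: "a \<in> {a \<in> T. key a = k}"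
    show "\<forall>b\<in>T - {b \<in> T. key b = k}. ?F a b = 0"
    proof
      fix b assume "b \<in> T - {b \<in> T. key b = k}"
      then have "B (a\<^sup>\<star> * b) = 0" using TN a by (intro B_zero_of_different_key) auto
      then show "?F a b = 0" by (simp add: g_zero)
    qed
  qed auto
  also have "\<dots> \<in> \<real>\<^sub>\<ge>\<^sub>0"
  proof (rule nonneg_Reals_sum)
    fix k assume "k \<in> key ` T"
    \<comment> \<open>Any member of the class can be the base point. The block then becomes the form
      of \<open>f\<close> on the elements \<open>u a\<close>, the roots of the weights going into
      the coefficients.\<close>
    then obtain c where c: "c \<in> T" "k = key c" by blast
    let ?K = "{a \<in> T. key a = k}"
    define u where "u = (\<lambda>a. (1 / sqrt (wt c * wt a)) *\<^sub>R (c\<^sup>\<star> * a))"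
    have uH: "u a \<in> H" if "a \<in> ?K" for a
      using that TN c unfolding u_def by (intro H_of_same_key) auto
    have "?F a b = cnj (r a * of_real (sqrt (wt a))) * f (cls ((u a)\<^sup>\<star> * u b)) * (r b * of_real (sqrt (wt b)))"
      if "a \<in> ?K" "b \<in> ?K" for a b
      using g_same_key[of c a b] that TN c by (simp add: u_def)
    then have "(\<Sum>a\<in>?K. \<Sum>b\<in>?K. ?F a b) = (\<Sum>a\<in>?K. \<Sum>b\<in>?K.
        cnj (r a * of_real (sqrt (wt a))) * f (cls ((u a)\<^sup>\<star> * u b)) * (r b * of_real (sqrt (wt b))))"
      by (intro sum.cong refl)
    also have "\<dots> \<in> \<real>\<^sub>\<ge>\<^sub>0" by (rule f_positive_definite) (use T uH in auto)
    finally show "(\<Sum>a\<in>?K. \<Sum>b\<in>?K. ?F a b) \<in> \<real>\<^sub>\<ge>\<^sub>0" .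
  qed
  finally show ?thesis .
qed

end

locale dense_dominated_pre_hom = dominated_pre_hom +
  assumes dense: "closure (cspan N) = UNIV"
begin

text \<open>As \<open>\<Gamma>\<close> is the graph of a contraction, the values along a Cauchy sequence converge.\<close>

lemma closure_\<Gamma>_total: "\<exists>y. (x, y) \<in> closure \<Gamma>"
proof -
  obtain a where a: "\<And>n. a n \<in> cspan N" "a \<longlonglongrightarrow> x" using dense by (metis UNIV_I closure_sequential)
  obtain b where b: "\<And>n. (a n, b n) \<in> \<Gamma>" using \<Gamma>_span[OF a(1)] by metis
  have le: "dist (b m) (b n) \<le> dist (a m) (a n)" for m n
    using \<Gamma>_le_B[OF \<Gamma>_diff[OF b b], of m n] B_le_norm[of "a m - a n"] by (simp add: dist_norm)
  have "Cauchy a" using a(2) by (rule LIMSEQ_imp_Cauchy)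
  then have "Cauchy b" unfolding Cauchy_def using le by (meson order.strict_trans1)
  then obtain y where "b \<longlonglongrightarrow> y" using Cauchy_convergent convergentD by blast
  then show ?thesis using a b unfolding closure_\<Gamma>_seq by blast
qed

lemma ext_closure: "(x, ext x) \<in> closure \<Gamma>"
  using closure_\<Gamma>_total[of x] ext_eq by blast

lemma ext_add: "ext (x + y) = ext x + ext y"
  by (intro ext_eq closure_\<Gamma>_add ext_closure)

lemma ext_scaleC: "ext (c *\<^sub>C x) = c * ext x"
  by (intro ext_eq closure_\<Gamma>_scaleC ext_closure)

lemma ext_sum: "ext (\<Sum>i\<in>I. h i) = (\<Sum>i\<in>I. ext (h i))"
  using ext_scaleC[of 0 0] by (induction I rule: infinite_finite_induct) (simp_all add: ext_add)

lemma ext_bound: "cmod (ext x) \<le> norm x"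
  by (rule closure_\<Gamma>_le[OF ext_closure])

lemma ext_scaleR: "ext (t *\<^sub>R x) = of_real t * ext x"
  by (simp add: ext_scaleC flip: scaleC_of_real)

lemma tendsto_ext: assumes "s \<longlonglongrightarrow> x" shows "(\<lambda>n. ext (s n)) \<longlonglongrightarrow> ext x"
proof -
  have eq: "ext (s n) - ext x = ext (s n - x)" for n
    using ext_add[of "s n" "(-1) *\<^sub>C x"] ext_scaleC[of "-1" x] by simp
  have "(\<lambda>n. norm (s n - x)) \<longlonglongrightarrow> 0" using assms by (simp add: LIM_zero tendsto_norm_zero)
  then have "(\<lambda>n. ext (s n - x)) \<longlonglongrightarrow> 0"
    by (rule Lim_null_comparison[rotated]) (simp add: ext_bound)
  then show ?thesis unfolding eq[symmetric] by (rule LIM_zero_cancel)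
qed

lemma ext_positive: "ext (x\<^sup>\<star> * x) \<in> \<real>\<^sub>\<ge>\<^sub>0"
proof -
  have span: "ext (y\<^sup>\<star> * y) \<in> \<real>\<^sub>\<ge>\<^sub>0" if "y \<in> cspan N" for y
  proof -
    obtain S r where S: "finite S" "S \<subseteq> N" and y: "y = (\<Sum>v\<in>S. r v *\<^sub>C v)"
      using \<open>y \<in> cspan N\<close> unfolding complex_vector.span_explicit by blast
    have "ext (y\<^sup>\<star> * y) = (\<Sum>a\<in>S. \<Sum>b\<in>S. cnj (r a) * r b * ext (a\<^sup>\<star> * b))"
      unfolding y star_mult_sum by (simp add: ext_sum ext_scaleC)
    also have "\<dots> = (\<Sum>a\<in>S. \<Sum>b\<in>S. cnj (r a) * r b * g (a\<^sup>\<star> * b))"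
    proof (intro sum.cong refl)
      fix a b assume "a \<in> S" "b \<in> S"
      then have "a\<^sup>\<star> * b \<in> N" using S(2) N_mult N_star by blast
      then show "cnj (r a) * r b * ext (a\<^sup>\<star> * b) = cnj (r a) * r b * g (a\<^sup>\<star> * b)" by (simp add: ext_N)
    qed
    finally show ?thesis using g_positive_semidefinite[OF S] by simp
  qed
  obtain s where s: "\<And>n. s n \<in> cspan N" "s \<longlonglongrightarrow> x" using dense by (metis UNIV_I closure_sequential)
  have "(\<lambda>n. ext ((s n)\<^sup>\<star> * s n)) \<longlonglongrightarrow> ext (x\<^sup>\<star> * x)"
    by (intro tendsto_ext tendsto_mult tendsto_star s(2))
  then show ?thesis
    using closed_sequentially[OF closed_nonneg_Reals_complex, of "\<lambda>n. ext ((s n)\<^sup>\<star> * s n)"] span s(1) by blast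
qed

text \<open>Compatibility follows from the dichotomy for normalizers: null ones get the value 0,
  while for \<open>v = t *\<^sub>R u\<close> the squared modulus is \<open>t * t\<close> times 0 or
  1, and \<open>ext (v\<^sup>\<star> * v)\<close> is \<open>t * t\<close>.\<close>

lemma ext_compatible: "ext \<in> compatible_states_over D \<sigma>"
proof -
  have "Vector_Spaces.linear scaleC (*) ext"
    unfolding Vector_Spaces.linear_iff
  proof (intro conjI allI)
    show "vector_space ((*) :: complex \<Rightarrow> complex \<Rightarrow> complex)" by unfold_locales (simp_all add: algebra_simps)
  qed (simp_all add: ext_add ext_scaleC complex_vector.vector_space_axioms)
  then have "state ext"
    by (simp add: state_def positive_functional_def ext_positive ext_D)
  moreover have "complex_of_real ((cmod (ext v))\<^sup>2) \<in> {0, ext (v\<^sup>\<star> * v)}" if v: "v \<in> N" for v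
    using v
  proof (cases v rule: N_cases)
    case 1
    then show ?thesis using v by (simp add: ext_N g_zero)
  next
    case (2 t u)
    have "ext (u\<^sup>\<star> * u) = 1" using 2 N_D_one H_N by (simp add: ext_D H_s_one)
    moreover have "v\<^sup>\<star> * v = (t * t) *\<^sub>R (u\<^sup>\<star> * u)" unfolding 2(3) by simp
    ultimately have "ext (v\<^sup>\<star> * v) = of_real (t * t)" by (simp add: ext_scaleR)
    moreover have "cmod (ext v) = t * cmod (f (cls u))"
      unfolding 2(3) using 2(1,2) by (simp add: ext_scaleR ext_N H_N g_H norm_mult)
    ultimately show ?thesis using f_norm[OF 2(2)] by (auto simp: power2_eq_square)
  qed
  moreover have "restrict ext D = \<sigma>"
    using s_extensional by (auto simp: restrict_def ext_D extensional_def)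
  ultimately show ?thesis by (simp add: compatible_states_over_def compatible_states_def)
qed

lemma tilde_ext: "tilde D \<sigma> ext = f"
proof
  fix x
  interpret masa_state_over D \<sigma> ext by (rule masa_state_overI[OF ext_compatible])
  show "tilde D \<sigma> ext x = f x"
  proof (cases "x \<in> carrier G")
    case True
    then obtain v where "v \<in> H" "x = cls v" by (auto simp: carrier_G)
    then show ?thesis by (simp add: tilde_cls ext_N H_N g_H)
  next
    case False
    then show ?thesis using f_extensional by (simp add: tilde_def extensional_def)
  qed
qed

end

theorem theorem7p13:
  fixes D :: "'a::unital_cstar_algebra set" and \<sigma> :: "'a \<Rightarrow> complex"
  assumes "regular_masa_inclusion D" and "\<sigma> \<in> characters D"
  shows "(\<forall>\<tau>\<in>compatible_states_over D \<sigma>.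
            \<tau> respects R1 D \<sigma> \<and>
            (\<forall>v\<in>H_set D \<sigma>. tilde D \<sigma> \<tau> (cls1 D \<sigma> v) = \<tau> v) \<and>
            tilde D \<sigma> \<tau> \<in> M_set D \<sigma>) \<and>
         bij_betw (tilde D \<sigma>) (compatible_states_over D \<sigma>) (M_set D \<sigma>)"
proof -
  interpret masa_character D \<sigma>
    using assms by unfold_locales (auto simp: regular_masa_inclusion_def regular_inclusion_def)
  have dense: "closure (cspan N) = UNIV"
    using assms(1) by (simp add: regular_masa_inclusion_def regular_inclusion_def)
  have 1: "\<tau> respects R1 D \<sigma> \<and> (\<forall>v\<in>H. tilde D \<sigma> \<tau> (cls v) = \<tau> v) \<and> tilde D \<sigma> \<tau> \<in> M_set D \<sigma>"
    if "\<tau> \<in> compatible_states_over D \<sigma>" for \<tau>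
  proof -
    interpret masa_state_over D \<sigma> \<tau> by (rule masa_state_overI[OF that])
    show ?thesis using \<tau>_respects tilde_cls tilde_M_set by blast
  qed
  have "f \<in> tilde D \<sigma> ` compatible_states_over D \<sigma>" if f: "f \<in> M_set D \<sigma>" for f
  proof -
    interpret dense_dominated_pre_hom D \<sigma> f using f dense by unfold_locales
    show ?thesis using tilde_ext ext_compatible by (metis imageI)
  qed
  then have "bij_betw (tilde D \<sigma>) (compatible_states_over D \<sigma>) (M_set D \<sigma>)"
    using 1 tilde_inj[OF dense] by (auto simp: bij_betw_def inj_on_def)
  then show ?thesis using 1 by blast
qed

end
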